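(* Let $\mathcal C=\mathcal A\circ\mathcal B$ be an admissible composition scheme of singular exponent $s$. Let $\rho$ be the radius of convergence of $C(z)$, and $\mu,\sigma$ the expectation and standard deviation of the size of an object of $\mathcal B$ under the Boltzmann distribution at $\rho$. Let $\pi_n$ be the uniform distribution on $\mathcal C_n$ and $\pi_n'$ the distribution on $\mathcal C_n$ of the output of the leap generator. Then, as $n\to\infty$, $$d_{\mathrm{TV}}(\pi_n,\pi_n')=\Big(\frac{|s-1|\,\sigma}{\sqrt{2\pi\mu}}+o(1)\Big)\frac1{\sqrt n},$$ that is, $d_{\mathrm{TV}}(\pi_n,\pi_n')\sim\frac{|s-1|\sigma}{\sqrt{2\pi\mu}}\frac1{\sqrt n}$ when $s\ne1$.
   Context: $\mathbb N=\{0,1,2,\dots\}$ and $\mathbb N^*=\mathbb N\setminus\{0\}$. For probability distributions $\pi,\pi'$ on a finite set $E$, $d_{\mathrm{TV}}(\pi,\pi')=\frac12\sum_{x\in E}|\pi(x)-\pi'(x)|$. A combinatorial class $\mathcal C$ is a set with a size function $\gamma\mapsto|\gamma|\in\mathbb N$ such that every $\mathcal C_n=\{\gamma\in\mathcal C:|\gamma|=n\}$ is finite; an object of size $n$ is made of $n$ atoms. Classes are either all unlabeled (set $\delta_n=1$) or all labeled (the atoms of an object of size $n$ carry distinct labels in $\{1,\dots,n\}$, and $\mathcal C_n$ is closed under relabeling; set $\delta_n=1/n!$). The generating function is $C(z)=\sum_n\delta_n|\mathcal C_n|z^n$, and similarly $A(y),B(z)$ for $\mathcal A,\mathcal B$.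 Composition: if $\mathcal B$ has no object of size $0$, $\mathcal C=\mathcal A\circ\mathcal B$ is the class of objects $\gamma$ obtained from some $\alpha\in\mathcal A$, of size $k$ say, by substituting its atoms by objects $\beta_1,\dots,\beta_k\in\mathcal B$; the size is $|\beta_1|+\cdots+|\beta_k|$ and $k$ is the core-size of $\gamma$. In the labeled case this is the usual labeled substitution (a partition of the label set into $k$ blocks, a $\mathcal B$-structure on each block and an $\mathcal A$-structure on the set of blocks). In the unlabeled case the atoms of each object of $\mathcal A$ are assumed to be unambiguously ranked, so $\gamma$ is a pair $(\alpha,(\beta_1,\dots,\beta_{|\alpha|}))$. In both cases $C(z)=A(B(z))$. Let $\rho_A,\rho_B,\rho_C>0$ be the radii of convergence of $A,B,C$ ($\rho_A,\rho_C$ finite). The scheme is supercritical if $\rho_B>\rho_C$ (in which case $B(\rho_C)=\rho_A$). The support of a series is the set of indices of its nonzero coefficients; a series is periodic if its support is contained in $c+d\,\mathbb N$ for some $d\ge2$, $c\ge0$, and aperiodic otherwise. The scheme is admissible if it is supercritical, $A(y),B(z),C(z)$ are aperiodic, and the support of $A(y)$ contains $\mathbb N^*$. For $s\in\mathbb R$ with $-s\notin\mathbb N$, a generating function $F(z)$ with radius of convergence $\rho_F\in(0,\infty)$ has singular exponent $s$ if $\rho_F$ is its unique dominant singularity and there are a nonzero constant $\kappa_F$ and a polynomial $P(z)$ such that $F(z)=P(z)+\kappa_F(1-z/\rho_F)^{-s}+O((1-z/\rho_F)^{-s+1})$ in a $\Delta$-neighborhood of $\rho_F$ (a domain $\{|z|<\rho_F(1+\eta),\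 z\ne\rho_F,\ |\arg(z/\rho_F-1)|>\theta\}$ with $\eta>0$, $0<\theta<\pi/2$, as usual in singularity analysis). An admissible scheme has singular exponent $s$ if $A(y)$ has singular exponent $s$. The Boltzmann distribution on $\mathcal B$ at $\rho$ gives $\beta$ probability $\delta_{|\beta|}\rho^{|\beta|}/B(\rho)$; thus $\mu=\mu(\rho)$ and $\sigma=\sqrt{\rho\mu'(\rho)}$ with $\mu(x)=xB'(x)/B(x)$. Leap generator for $\mathcal C$ at size $n$ (for $n\ge1$ such that $\mathcal C_n\neq\emptyset$): at each trial, generate independent objects $\beta_1,\beta_2,\dots\in\mathcal B$, each under the Boltzmann distribution at $\rho=\rho_C$, and stop at the largest $k$ such that $S:=|\beta_1|+\cdots+|\beta_k|\le n$. If $S<n$, the trial fails and one restarts with a new independent trial. If $S=n$, draw $\alpha$ uniformly at random in $\mathcal A_k$, substitute the $i$th atom of $\alpha$ by $\beta_i$ for each $i\in\{1,\dots,k\}$ (in the labeled setting, moreover assign to the atoms uniformly randomly permuted labels in $\{1,\dots,n\}$), and return the resulting object of $\mathcal C_n$. *)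

theory Defs
  imports
    "HOL-Probability.Probability"
    "HOL-Complex_Analysis.Complex_Analysis"
    "HOL-Combinatorics.Permutations"
    "HOL-Library.Landau_Symbols"
begin

section \<open>Combinatorial classes\<close>

datatype setting = Unlabeled | Labeled

fun size_weight :: "setting \<Rightarrow> nat \<Rightarrow> real" where
  "size_weight Unlabeled n = 1"
| "size_weight Labeled n = 1 / fact n"

record 'a cclass =
  objs :: "'a set"
  osize :: "'a \<Rightarrow> nat"

text \<open>
  The field \<open>relabel\<close> matters in the labeled setting only: \<open>relabel C \<sigma> \<gamma>\<close> is the object \<open>\<gamma>\<close>
  in which each label \<open>i\<close> is replaced by \<open>\<sigma> i\<close>.
\<close>

record 'a lclass = "'a cclass" +
  relabel :: "(nat \<Rightarrow> nat) \<Rightarrow> 'a \<Rightarrow> 'a"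

definition objs_of_size :: "('a, 'm) cclass_scheme \<Rightarrow> nat \<Rightarrow> 'a set" where
  "objs_of_size C n = {\<gamma> \<in> objs C. osize C \<gamma> = n}"

definition relabeling_action :: "'a lclass \<Rightarrow> bool" where
  "relabeling_action C \<longleftrightarrow>
     (\<forall>n. \<forall>\<gamma> \<in> objs_of_size C n.
        relabel C id \<gamma> = \<gamma> \<and>
        (\<forall>\<sigma>. \<sigma> permutes {1..n} \<longrightarrow> relabel C \<sigma> \<gamma> \<in> objs_of_size C n) \<and>
        (\<forall>\<sigma> \<tau>. \<sigma> permutes {1..n} \<longrightarrow> \<tau> permutes {1..n} \<longrightarrow>
           relabel C (\<sigma> \<circ> \<tau>) \<gamma> = relabel C \<sigma> (relabel C \<tau> \<gamma>)))"

definition comb_class :: "setting \<Rightarrow> 'a lclass \<Rightarrow> bool" where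
  "comb_class t C \<longleftrightarrow>
     (\<forall>n. finite (objs_of_size C n)) \<and> (t = Labeled \<longrightarrow> relabeling_action C)"

definition gf :: "setting \<Rightarrow> ('a, 'm) cclass_scheme \<Rightarrow> real fps" where
  "gf t C = Abs_fps (\<lambda>n. size_weight t n * real (card (objs_of_size C n)))"


section \<open>Composition\<close>

text \<open>
  A pair \<open>(f, \<gamma>)\<close> with \<open>f\<close> injective on \<open>{1..osize C \<gamma>}\<close> stands for the structure obtained from
  \<open>\<gamma>\<close> by replacing each label \<open>i\<close> by \<open>f i\<close>. Since \<open>(f \<circ> \<sigma>, \<gamma>)\<close> and \<open>(f, relabel C \<sigma> \<gamma>)\<close> stand for
  the same structure, a structure is an equivalence class of such pairs.
\<close>

definition placed :: "'a lclass \<Rightarrow> (nat \<Rightarrow> 'l) \<Rightarrow> 'a \<Rightarrow> ((nat \<Rightarrow> 'l) \<times> 'a) set" where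
  "placed C f \<gamma> =
     {(restrict (f \<circ> inv \<sigma>) {1..osize C \<gamma>}, relabel C \<sigma> \<gamma>) | \<sigma>. \<sigma> permutes {1..osize C \<gamma>}}"

definition structures_on :: "'a lclass \<Rightarrow> 'l set \<Rightarrow> ((nat \<Rightarrow> 'l) \<times> 'a) set set" where
  "structures_on C U = {placed C f \<gamma> | f \<gamma>. \<gamma> \<in> objs C \<and> bij_betw f {1..osize C \<gamma>} U}"

text \<open>
  An object of a labeled composition is a partition of the label set together with an inner
  structure on each block and an outer structure on the set of blocks.
\<close>

datatype ('a, 'b) composite =
    UComp 'a "'b list"
  | LComp "nat set set" "nat set \<Rightarrow> ((nat \<Rightarrow> nat) \<times> 'b) set" "((nat \<Rightarrow> nat set) \<times> 'a) set"

fun composite_size :: "'b lclass \<Rightarrow> ('a, 'b) composite \<Rightarrow> nat" where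
  "composite_size B (UComp \<alpha> \<beta>s) = sum_list (map (osize B) \<beta>s)"
| "composite_size B (LComp P b a) = (\<Sum>U\<in>P. card U)"

fun composite_objs ::
  "setting \<Rightarrow> 'a lclass \<Rightarrow> 'b lclass \<Rightarrow> ('a, 'b) composite set" where
  "composite_objs Unlabeled A B =
     {UComp \<alpha> \<beta>s | \<alpha> \<beta>s. \<alpha> \<in> objs A \<and> length \<beta>s = osize A \<alpha> \<and> set \<beta>s \<subseteq> objs B}"
| "composite_objs Labeled A B =
     {LComp P b a | P b a. (\<exists>n. partition_on {1..n} P) \<and>
        b \<in> (\<Pi>\<^sub>E U\<in>P. structures_on B U) \<and> a \<in> structures_on A P}"

definition composition :: "setting \<Rightarrow> 'a lclass \<Rightarrow> 'b lclass \<Rightarrow> ('a, 'b) composite cclass" where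
  "composition t A B = \<lparr>objs = composite_objs t A B, osize = composite_size B\<rparr>"


section \<open>Admissible schemes and singular exponents\<close>

definition conv_rad :: "real fps \<Rightarrow> real" where
  "conv_rad F = real_of_ereal (fps_conv_radius F)"

definition fps_support :: "real fps \<Rightarrow> nat set" where
  "fps_support F = {n. fps_nth F n \<noteq> 0}"

definition periodic :: "real fps \<Rightarrow> bool" where
  "periodic F \<longleftrightarrow> (\<exists>d c. d \<ge> 2 \<and> fps_support F \<subseteq> {c + d * k | k. True})"

definition supercritical :: "real fps \<Rightarrow> real fps \<Rightarrow> bool" where
  "supercritical FB FC \<longleftrightarrow> fps_conv_radius FB > fps_conv_radius FC"

definition admissible_scheme :: "setting \<Rightarrow> 'a lclass \<Rightarrow> 'b lclass \<Rightarrow> bool" where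
  "admissible_scheme t A B \<longleftrightarrow>
     comb_class t A \<and> comb_class t B \<and> objs_of_size B 0 = {} \<and>
     (let FA = gf t A; FB = gf t B; FC = gf t (composition t A B) in
        0 < fps_conv_radius FA \<and> fps_conv_radius FA < \<infinity> \<and>
        0 < fps_conv_radius FB \<and>
        0 < fps_conv_radius FC \<and> fps_conv_radius FC < \<infinity> \<and>
        supercritical FB FC \<and>
        \<not> periodic FA \<and> \<not> periodic FB \<and> \<not> periodic FC \<and>
        {1..} \<subseteq> fps_support FA)"

definition extends_series :: "real fps \<Rightarrow> (complex \<Rightarrow> complex) \<Rightarrow> complex set \<Rightarrow> bool" where
  "extends_series F f D \<longleftrightarrow> f holomorphic_on D \<and>
     (\<forall>z \<in> D \<inter> ball 0 (conv_rad F). (\<lambda>n. complex_of_real (fps_nth F n) * z ^ n) sums f z)"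

definition dominant_singularities :: "real fps \<Rightarrow> complex set" where
  "dominant_singularities F =
     {z. norm z = conv_rad F \<and> \<not> (\<exists>e>0. \<exists>f. extends_series F f (ball z e))}"

definition delta_domain :: "real \<Rightarrow> real \<Rightarrow> real \<Rightarrow> complex set" where
  "delta_domain \<rho> \<eta> \<theta> =
     {z. norm z < \<rho> * (1 + \<eta>) \<and> z \<noteq> of_real \<rho> \<and> \<bar>Arg (z / of_real \<rho> - 1)\<bar> > \<theta>}"

text \<open>The principal branch of \<open>powr\<close> is holomorphic here: \<open>1 - z / \<rho>\<close> avoids the nonpositive reals.\<close>

definition has_singular_exponent :: "real fps \<Rightarrow> real \<Rightarrow> bool" where
  "has_singular_exponent F s \<longleftrightarrow>
     - s \<notin> \<nat> \<and> 0 < fps_conv_radius F \<and> fps_conv_radius F < \<infinity> \<and>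
     (let \<rho> = conv_rad F in
        dominant_singularities F = {of_real \<rho>} \<and>
        (\<exists>\<eta> \<theta> f \<kappa> P. \<eta> > 0 \<and> 0 < \<theta> \<and> \<theta> < pi / 2 \<and> \<kappa> \<noteq> 0 \<and>
           extends_series F f (delta_domain \<rho> \<eta> \<theta>) \<and>
           (\<lambda>z. f z - (poly P z + \<kappa> * (1 - z / of_real \<rho>) powr of_real (- s)))
             \<in> O[at (of_real \<rho>) within delta_domain \<rho> \<eta> \<theta>](\<lambda>z.
                  (1 - z / of_real \<rho>) powr of_real (- s + 1))))"


section \<open>The leap generator\<close>

definition boltzmann :: "setting \<Rightarrow> 'b lclass \<Rightarrow> real \<Rightarrow> 'b pmf" where
  "boltzmann t B \<rho> = embed_pmf (\<lambda>\<beta>.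
     if \<beta> \<in> objs B then size_weight t (osize B \<beta>) * \<rho> ^ osize B \<beta> / eval_fps (gf t B) \<rho> else 0)"

text \<open>
  In \<open>labeled_subst\<close>, the concatenation of \<open>\<beta>s\<close> has \<open>n\<close> atoms, labeled \<open>1, \<dots>, n\<close> from left to
  right; label \<open>j\<close> of the \<open>i\<close>-th component gets position \<open>(sum of the earlier sizes) + j\<close>, and
  \<open>\<sigma>\<close> then permutes these labels.
\<close>

definition labeled_subst ::
  "'a lclass \<Rightarrow> 'b lclass \<Rightarrow> (nat \<Rightarrow> nat) \<Rightarrow> 'a \<Rightarrow> 'b list \<Rightarrow> ('a, 'b) composite" where
  "labeled_subst A B \<sigma> \<alpha> \<beta>s =
     (let I = {1..length \<beta>s};
          comp = (\<lambda>i. \<beta>s ! (i - 1));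
          emb = (\<lambda>i j. \<sigma> (sum_list (map (osize B) (take (i - 1) \<beta>s)) + j));
          block = (\<lambda>i. emb i ` {1..osize B (comp i)})
      in LComp (block ` I)
           (restrict (\<lambda>U. let i = inv_into I block U in placed B (emb i) (comp i)) (block ` I))
           (placed A block \<alpha>))"

fun substitute ::
  "setting \<Rightarrow> 'a lclass \<Rightarrow> 'b lclass \<Rightarrow> nat \<Rightarrow> 'a \<Rightarrow> 'b list \<Rightarrow> ('a, 'b) composite pmf" where
  "substitute Unlabeled A B n \<alpha> \<beta>s = return_pmf (UComp \<alpha> \<beta>s)"
| "substitute Labeled A B n \<alpha> \<beta>s =
     map_pmf (\<lambda>\<sigma>. labeled_subst A B \<sigma> \<alpha> \<beta>s) (pmf_of_set {\<sigma>. \<sigma> permutes {1..n}})"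

text \<open>
  One trial: independent draws from \<open>p\<close> are appended until the next one would make the total size
  exceed \<open>n\<close>.
\<close>

partial_function (spmf) leap_run ::
  "'b pmf \<Rightarrow> ('b \<Rightarrow> nat) \<Rightarrow> nat \<Rightarrow> 'b list \<Rightarrow> 'b list spmf" where
  "leap_run p sz n \<beta>s =
     bind_spmf (spmf_of_pmf p) (\<lambda>\<beta>.
       if sum_list (map sz \<beta>s) + sz \<beta> \<le> n then leap_run p sz n (\<beta>s @ [\<beta>])
       else return_spmf \<beta>s)"

partial_function (spmf) leap_generator ::
  "setting \<Rightarrow> 'a lclass \<Rightarrow> 'b lclass \<Rightarrow> real \<Rightarrow> nat \<Rightarrow> ('a, 'b) composite spmf" where
  "leap_generator t A B \<rho> n =
     bind_spmf (leap_run (boltzmann t B \<rho>) (osize B) n []) (\<lambda>\<beta>s.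
       if sum_list (map (osize B) \<beta>s) = n then
         bind_spmf (spmf_of_set (objs_of_size A (length \<beta>s))) (\<lambda>\<alpha>.
           spmf_of_pmf (substitute t A B n \<alpha> \<beta>s))
       else leap_generator t A B \<rho> n)"

definition tv_dist :: "'e set \<Rightarrow> 'e spmf \<Rightarrow> 'e spmf \<Rightarrow> real" where
  "tv_dist E p q = (\<Sum>x\<in>E. \<bar>spmf p x - spmf q x\<bar>) / 2"

end

theory Submission
  imports
    Defs
    "HOL-Real_Asymp.Real_Asymp"
    "HOL-Combinatorics.Multiset_Permutations"
begin

text \<open>
  Write \<open>\<phi>(z) = B(\<rho>z) / B(\<rho>)\<close>, \<open>q\<^sub>k(n) = [z\<^sup>n] \<phi>(z)\<^sup>k\<close>, \<open>u\<^sub>n = \<Sum>\<^sub>k q\<^sub>k(n)\<close> and \<open>w\<^sub>k = [y\<^sup>k] A(B(\<rho>) y)\<close>.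
  Under both distributions the object is uniform given its core-size \<open>k\<close>, and the core-size has law
  \<open>w\<^sub>k q\<^sub>k(n) / \<Sum>\<^sub>j w\<^sub>j q\<^sub>j(n)\<close> under \<open>\<pi>\<^sub>n\<close> and \<open>q\<^sub>k(n) / u\<^sub>n\<close> under \<open>\<pi>\<^sub>n'\<close>. Singularity analysis gives
  \<open>w\<^sub>k = D k\<^bsup>s-1\<^esup> (1 + O(1/k))\<close>. Under \<open>\<pi>\<^sub>n'\<close> the core-size \<open>K\<close> is the number of renewals up to \<open>n\<close>,
  conditioned on a renewal at \<open>n\<close>, so it is \<open>n/\<mu> + X \<surd>n\<close> with \<open>X\<close> asymptotically centred normal of standard
  deviation \<open>\<sigma>\<mu>\<^bsup>-3/2\<^esup>\<close>. The density of \<open>\<pi>\<^sub>n\<close> with respect to \<open>\<pi>\<^sub>n'\<close> is thus \<open>1 + (s - 1) \<mu> X / \<surd>n + o(1/\<surd>n)\<close>,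
  and the distance is asymptotic to half of \<open>\<bar>s - 1\<bar> \<mu> E\<bar>X\<bar> / \<surd>n\<close>.
\<close>

section \<open>Singularity analysis\<close>

text \<open>The distance is itself of order n^(-1/2), so the density must be known up to
  o(n^(-1/2)). This is why the relative error O(1/k) of w_k is required; an asymptotic equivalent
  alone would leave an error of unknown order. The core-size enters through its distribution
  function only. Given a renewal at n, the core-sizes k >= m have total weight sum_j q_m(j) u(n-j).
  Since u tends to 1/\<mu>, this is close to P(S_m <= n)/\<mu>, where S_m is the m-th renewal time,
  to which the ordinary central limit theorem applies. Convergence in law does not give convergence
  of E|X|. The uniform integrability comes from the exponential moments of the step law, which exist
  because \<rho> is smaller than the radius of B: the tails of X are O(exp(-\<mu> x)) uniformly in
  n. The same tails allow crude polynomial bounds on w_k for k far from n/\<mu>. Since E X tends to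
  0, the normalisation by sum_j w_j q_j(n) has no effect at order n^(-1/2). The constant then comes
  from E|X|, which tends to sqrt(2/pi) \<sigma> \<mu>^(-3/2).\<close>

lemma mem_delta_domain_1_iff:
  assumes "0 < \<theta>" "\<theta> < pi"
  shows "z \<in> delta_domain 1 \<eta> \<theta> \<longleftrightarrow>
    norm z < 1 + \<eta> \<and> z \<noteq> 1 \<and> Re (z - 1) < cos \<theta> * norm (z - 1)"
proof (cases "z = 1")
  case False
  define v where "v = z - 1"
  have "v \<noteq> 0" using False by (simp add: v_def)
  have re: "Re v = norm v * cos (Arg v)"
    using Arg_eq[OF \<open>v \<noteq> 0\<close>] by (metis Re_rcis rcis_cmod_Arg)
  have "\<bar>Arg v\<bar> \<le> pi"
    using Arg_bounded[of v] by (simp add: abs_le_iff)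
  \<comment> \<open>Cosine is even and decreasing on [0, pi], so the angular condition becomes a
    comparison of two continuous functions of z; openness and stability under small discs can be
    read off.\<close>
  hence "\<bar>Arg v\<bar> > \<theta> \<longleftrightarrow> cos \<bar>Arg v\<bar> < cos \<theta>"
    using assms by (subst cos_mono_less_eq) auto
  also have "cos \<bar>Arg v\<bar> = cos (Arg v)" by simp
  also have "cos (Arg v) < cos \<theta> \<longleftrightarrow> Re v < cos \<theta> * norm v"
    using \<open>v \<noteq> 0\<close> by (simp add: re mult.commute[of "cos \<theta>"])
  finally show ?thesis
    using False by (simp add: delta_domain_def v_def)
qed (simp add: delta_domain_def)

lemma open_delta_domain_1:
  assumes "0 < \<theta>" "\<theta> < pi"
  shows "open (delta_domain 1 \<eta> \<theta>)"
proof -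
  have "delta_domain 1 \<eta> \<theta> = {z. norm z < 1 + \<eta>} \<inter> ({z. z \<noteq> 1} \<inter> {z. Re (z - 1) < cos \<theta> * norm (z - 1)})"
    using mem_delta_domain_1_iff[OF assms] by auto
  also have "open \<dots>"
    by (intro open_Int open_Collect_less open_Collect_neq continuous_intros)
  finally show ?thesis .
qed

text \<open>On the closed unit disc Re (z - 1) <= 0, whereas the excluded cone with apex 1 opens to
  the right.\<close>

lemma in_delta_domain_1:
  assumes "0 < \<theta>" "\<theta> < pi / 2" "0 < \<eta>" "norm z \<le> 1" "z \<noteq> 1"
  shows "z \<in> delta_domain 1 \<eta> \<theta>"
proof -
  have "Re z \<le> 1" using complex_Re_le_cmod[of z] assms by linarith
  moreover have "cos \<theta> > 0" using assms by (intro cos_gt_zero) auto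
  ultimately have "Re (z - 1) < cos \<theta> * norm (z - 1)"
    using assms by (smt (verit) minus_complex.simps(1) mult_pos_pos one_complex.simps(1)
      right_minus_eq zero_less_norm_iff)
  thus ?thesis using assms by (subst mem_delta_domain_1_iff) auto
qed

text \<open>
  On the circle \<open>\<bar>u\<bar> = r\<close> one has \<open>\<bar>1 - u\<bar>\<^sup>2 = (1 - u) (u - r\<^sup>2) / u\<close>, so the mean of \<open>\<bar>1 - u\<bar>\<^bsup>-2\<^esup>\<close> is a
  Cauchy integral of \<open>1 / (1 - u)\<close> around \<open>r\<^sup>2\<close>.
\<close>

lemma has_integral_inverse_square_circlepath:
  fixes r :: real
  assumes "0 < r" "r < 1"
  shows "((\<lambda>t. 1 / (norm (1 - circlepath 0 r t))\<^sup>2) has_integral 1 / (1 - r\<^sup>2)) {0..1}"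
proof -
  have r2: "r * r < r" using assms by simp
  have "((\<lambda>u. (1 / (1 - u)) / (u - of_real (r\<^sup>2))) has_contour_integral
      (2 * of_real pi * \<i> * (1 / (1 - of_real (r\<^sup>2))))) (circlepath 0 r)"
    using assms r2
    by (intro Cauchy_integral_circlepath)
       (auto intro!: continuous_intros holomorphic_intros simp: power2_eq_square norm_mult)
  hence "((\<lambda>t. (1 / (1 - circlepath 0 r t)) / (circlepath 0 r t - of_real (r\<^sup>2)) *
      vector_derivative (circlepath 0 r) (at t within {0..1})) has_integral
      (2 * of_real pi * \<i> * (1 / (1 - of_real (r\<^sup>2))))) {0..1}"
    by (simp add: has_contour_integral_def)
  also have "?this \<longleftrightarrow> ((\<lambda>t. 2 * of_real pi * \<i> * of_real (1 / (norm (1 - circlepath 0 r t))\<^sup>2)) has_integral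
      (2 * of_real pi * \<i> * (1 / (1 - of_real (r\<^sup>2))))) {0..1}"
  proof (rule has_integral_cong)
    fix t :: real assume t: "t \<in> {0..1}"
    define u where "u = circlepath 0 r t"
    have nu: "norm u = r" using assms by (simp add: u_def circlepath_def part_circlepath_def norm_mult)
    have "u \<noteq> 0" using nu assms by auto
    have "vector_derivative (circlepath 0 r) (at t within {0..1}) = 2 * of_real pi * \<i> * u"
      using t by (subst vector_derivative_circlepath01) (simp_all add: u_def circlepath)
    moreover have "of_real (r\<^sup>2) = u * cnj u"
      using nu by (metis complex_norm_square of_real_power)
    hence "u - of_real (r\<^sup>2) = u * cnj (1 - u)" by (simp add: algebra_simps)
    moreover have "of_real ((norm (1 - u))\<^sup>2) = (1 - u) * cnj (1 - u)"
      by (metis complex_norm_square of_real_power)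
    ultimately show "(1 / (1 - circlepath 0 r t)) / (circlepath 0 r t - of_real (r\<^sup>2)) *
      vector_derivative (circlepath 0 r) (at t within {0..1}) =
      2 * of_real pi * \<i> * of_real (1 / (norm (1 - circlepath 0 r t))\<^sup>2)"
      unfolding u_def[symmetric] of_real_divide using \<open>u \<noteq> 0\<close>
      by (simp del: complex_cnj_diff)
  qed
  finally have "((\<lambda>t. inverse (2 * of_real pi * \<i>) * (2 * of_real pi * \<i> * of_real (1 / (norm (1 - circlepath 0 r t))\<^sup>2))) has_integral
      inverse (2 * of_real pi * \<i>) * (2 * of_real pi * \<i> * (1 / (1 - of_real (r\<^sup>2))))) {0..1}"
    by (rule has_integral_mult_right)
  hence "((\<lambda>t. complex_of_real (1 / (norm (1 - circlepath 0 r t))\<^sup>2)) has_integral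
      of_real (1 / (1 - r\<^sup>2))) {0..1}"
    by (simp add: field_simps)
  from has_integral_linear[OF this bounded_linear_Re] show ?thesis
    by (simp add: o_def)
qed

text \<open>Bounding Cauchy's integral by the mean of |1 - z|^(-2), which is of order 1/(1-r),
  instead of its maximum, of order 1/(1-r)^2, saves a factor 1-r. With r = 1 - 1/n this is the
  factor n that makes the transfer sharp.\<close>

lemma norm_higher_deriv_le_circle_mean:
  fixes h :: "complex \<Rightarrow> complex"
  assumes h: "h holomorphic_on ball 0 1" and r: "0 < r" "r < 1"
    and bound: "\<And>z. norm z = r \<Longrightarrow> norm (h z) \<le> K / (norm (1 - z))\<^sup>2"
  shows "norm ((deriv ^^ n) h 0) / fact n \<le> K / (1 - r\<^sup>2) / r ^ n"
proof -
  let ?c = "circlepath 0 r"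
  let ?f = "\<lambda>t. h (?c t) / (?c t) ^ Suc n * vector_derivative ?c (at t within {0..1})"
  let ?g = "\<lambda>t. 2 * pi * K / r ^ n * (1 / (norm (1 - ?c t))\<^sup>2)"
  have "((\<lambda>u. h u / (u - 0) ^ Suc n) has_contour_integral (2 * pi * \<i>) / fact n * (deriv ^^ n) h 0) ?c"
    using r by (intro Cauchy_has_contour_integral_higher_derivative_circlepath
        holomorphic_on_imp_continuous_on holomorphic_on_subset[OF h]) auto
  hence 1: "(?f has_integral (2 * pi * \<i>) / fact n * (deriv ^^ n) h 0) {0..1}"
    by (simp add: has_contour_integral_def)
  have 2: "(?g has_integral 2 * pi * K / r ^ n * (1 / (1 - r\<^sup>2))) {0..1}"
    by (intro has_integral_mult_right has_integral_inverse_square_circlepath r)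
  have "norm (integral {0..1} ?f) \<le> integral {0..1} ?g"
  proof (rule integral_norm_bound_integral)
    fix t :: real assume t: "t \<in> {0..1}"
    have n: "norm (?c t) = r" using r by (simp add: circlepath norm_mult)
    have v: "norm (vector_derivative ?c (at t within {0..1})) = 2 * pi * r"
      using t r by (simp add: vector_derivative_circlepath01 norm_mult)
    have "norm (?f t) = norm (h (?c t)) * (2 * pi / r ^ n)"
      using r by (simp add: norm_mult norm_divide norm_power n v)
    also have "\<dots> \<le> K / (norm (1 - ?c t))\<^sup>2 * (2 * pi / r ^ n)"
      using r by (intro mult_right_mono bound n) auto
    finally show "norm (?f t) \<le> ?g t" by (simp add: mult_ac)
  qed (use 1 2 in blast)+
  also have "integral {0..1} ?f = (2 * pi * \<i>) / fact n * (deriv ^^ n) h 0"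
    using 1 by (rule integral_unique)
  also have "integral {0..1} ?g = 2 * pi * K / r ^ n * (1 / (1 - r\<^sup>2))"
    using 2 by (rule integral_unique)
  finally have "2 * pi * (norm ((deriv ^^ n) h 0) / fact n) \<le> 2 * pi * (K / (1 - r\<^sup>2) / r ^ n)"
    by (simp add: norm_mult norm_divide mult_ac)
  thus ?thesis by (rule mult_left_le_imp_le) auto
qed

text \<open>The larger of the two end values serves exponents of either sign, since the sign of
  \<open>a\<close> decides whether \<open>powr\<close> increases or decreases in its base.\<close>

lemma powr_le_max_mult_powr:
  fixes x y a :: real
  assumes "0 < l" "l * x \<le> y" "y \<le> u * x" "0 < x"
  shows "y powr a \<le> max (l powr a) (u powr a) * x powr a"
proof (cases "a \<ge> 0")
  case True
  have "0 < y" using assms by (smt (verit) mult_pos_pos)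
  hence "0 < u" using assms by (smt (verit) mult_nonpos_nonneg)
  have "y powr a \<le> (u * x) powr a"
    using True assms \<open>0 < y\<close> by (intro powr_mono2) auto
  also have "\<dots> = u powr a * x powr a" using assms \<open>0 < u\<close> by (simp add: powr_mult)
  also have "\<dots> \<le> max (l powr a) (u powr a) * x powr a"
    by (intro mult_right_mono) auto
  finally show ?thesis .
next
  case False
  have "y powr a \<le> (l * x) powr a"
    using False assms by (intro powr_mono2') auto
  also have "\<dots> = l powr a * x powr a" using assms by (simp add: powr_mult)
  also have "\<dots> \<le> max (l powr a) (u powr a) * x powr a"
    by (intro mult_right_mono) auto
  finally show ?thesis .
qed

text \<open>Near 1, Cauchy's estimate applies on a disc about z of radius proportional to |z - 1|.
  Such a disc stays inside the domain even when z is close to the unit circle; this is where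
  continuation beyond that circle is used. Away from 1 compactness suffices.\<close>

lemma higher_deriv_bound_delta_domain:
  fixes g :: "complex \<Rightarrow> complex" and a :: real
  assumes \<theta>: "0 < \<theta>" "\<theta> < pi / 2" and \<eta>: "0 < \<eta>"
    and holo: "g holomorphic_on delta_domain 1 \<eta> \<theta>"
    and near: "\<epsilon> > 0" "\<And>z. z \<in> delta_domain 1 \<eta> \<theta> \<Longrightarrow> norm (z - 1) < \<epsilon> \<Longrightarrow>
                 norm (g z) \<le> C * norm (z - 1) powr a"
    and m: "a \<le> real m"
  obtains K where "K > 0"
    "\<And>z. norm z < 1 \<Longrightarrow> norm ((deriv ^^ m) g z) \<le> K * norm (z - 1) powr (a - real m)"
proof -
  let ?D = "delta_domain 1 \<eta> \<theta>"
  have opn: "open ?D" using \<theta> by (intro open_delta_domain_1) auto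
  \<comment> \<open>The solution of c = cos \<theta> (1 - c). For |w - z| <= c |z - 1| one has Re (w
    - 1) < c |z - 1| and |w - 1| >= (1 - c) |z - 1|, so this ratio keeps w out of the cone.\<close>
  define c where "c = cos \<theta> / (1 + cos \<theta>)"
  have cos: "cos \<theta> > 0" using \<theta> by (intro cos_gt_zero) auto
  have c: "0 < c" "c < 1" "c \<le> cos \<theta> * (1 - c)"
    using cos by (auto simp: c_def field_simps)
  define \<delta> where "\<delta> = min (\<epsilon> / 2) (\<eta> / 2)"
  have \<delta>: "\<delta> > 0" using near \<eta> by (simp add: \<delta>_def)
  have geo: "w \<in> ?D \<and> norm (w - 1) < \<epsilon> \<and> (1 - c) * norm (z - 1) \<le> norm (w - 1) \<and>
     norm (w - 1) \<le> (1 + c) * norm (z - 1)"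
    if z: "norm z < 1" "norm (z - 1) < \<delta>" and w: "norm (w - z) \<le> c * norm (z - 1)" for z w
  proof -
    have z1: "norm (z - 1) > 0" using z by auto
    have lo: "(1 - c) * norm (z - 1) \<le> norm (w - 1)"
      using w norm_triangle_ineq2[of "z - 1" "z - w"] by (simp add: algebra_simps norm_minus_commute)
    have up: "norm (w - 1) \<le> (1 + c) * norm (z - 1)"
      using w norm_triangle_ineq[of "w - z" "z - 1"] by (simp add: algebra_simps)
    have cz: "c * norm (z - 1) \<le> norm (z - 1)" using c z1 by simp
    have "norm (w - 1) < \<epsilon>" using up cz z by (simp add: \<delta>_def algebra_simps)
    moreover have "norm w < 1 + \<eta>"
      using norm_triangle_ineq[of "w - z" z] w z cz \<eta> by (simp add: \<delta>_def)
    moreover have "w \<noteq> 1" using lo c z1 by (smt (verit) mult_pos_pos norm_zero right_minus_eq)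
    moreover have "Re (w - 1) < cos \<theta> * norm (w - 1)"
    proof -
      have "Re (w - z) \<le> c * norm (z - 1)" using w complex_Re_le_cmod[of "w - z"] by linarith
      moreover have "Re z < 1" using z complex_Re_le_cmod[of z] by linarith
      ultimately have "Re (w - 1) < c * norm (z - 1)" by simp
      also have "\<dots> \<le> cos \<theta> * ((1 - c) * norm (z - 1))"
        using mult_right_mono[OF c(3), of "norm (z - 1)"] by (simp add: mult_ac)
      also have "\<dots> \<le> cos \<theta> * norm (w - 1)"
        using lo cos by (intro mult_left_mono) auto
      finally show ?thesis .
    qed
    ultimately show ?thesis using lo up \<theta> by (subst mem_delta_domain_1_iff) auto
  qed
  define L where "L = max ((1 - c) powr a) ((1 + c) powr a)"
  have "L > 0" using c by (simp add: L_def less_max_iff_disj)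
  define K1 where "K1 = fact m * (\<bar>C\<bar> * L) / c ^ m"
  have K1: "norm ((deriv ^^ m) g z) \<le> K1 * norm (z - 1) powr (a - real m)"
    if z: "norm z < 1" "norm (z - 1) < \<delta>" for z
  proof -
    have z1: "norm (z - 1) > 0" using z by auto
    define r where "r = c * norm (z - 1)"
    have r: "r > 0" using c z1 by (simp add: r_def)
    have sub: "cball z r \<subseteq> ?D"
      using geo[OF z] by (auto simp: r_def dist_norm norm_minus_commute)
    have "norm ((deriv ^^ m) g z) \<le> fact m * (\<bar>C\<bar> * L * norm (z - 1) powr a) / r ^ m"
    proof (rule Cauchy_inequality)
      show "g holomorphic_on ball z r"
        using holo sub by (meson ball_subset_cball holomorphic_on_subset)
      show "continuous_on (cball z r) g"
        using holo sub by (meson holomorphic_on_imp_continuous_on holomorphic_on_subset)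
      fix w assume w: "norm (z - w) = r"
      have g: "w \<in> ?D" "norm (w - 1) < \<epsilon>" "(1 - c) * norm (z - 1) \<le> norm (w - 1)"
         "norm (w - 1) \<le> (1 + c) * norm (z - 1)"
        using geo[OF z, of w] w by (auto simp: r_def norm_minus_commute)
      have "norm (g w) \<le> C * norm (w - 1) powr a" using g by (intro near)
      also have "\<dots> \<le> \<bar>C\<bar> * norm (w - 1) powr a" by (intro mult_right_mono) auto
      also have "norm (w - 1) powr a \<le> L * norm (z - 1) powr a"
        unfolding L_def using g c z1 by (intro powr_le_max_mult_powr) auto
      finally show "norm (g w) \<le> \<bar>C\<bar> * L * norm (z - 1) powr a"
        by (simp only: mult_left_mono abs_ge_zero mult.assoc)
    qed (use r in auto)
    also have "\<dots> = K1 * norm (z - 1) powr (a - real m)"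
      using z1 c by (simp add: K1_def r_def powr_diff powr_realpow power_mult_distrib field_simps)
    finally show ?thesis .
  qed
  \<comment> \<open>The part of the closed disc away from 1 is a compact subset of the domain, so
    the derivative is bounded there.\<close>
  define S where "S = cball 0 1 \<inter> {z::complex. norm (z - 1) \<ge> \<delta>}"
  have "closed {z::complex. norm (z - 1) \<ge> \<delta>}" by (intro closed_Collect_le continuous_intros)
  hence "compact S" unfolding S_def by (rule compact_Int_closed[OF compact_cball])
  have SD: "S \<subseteq> ?D"
    using \<delta> \<theta> \<eta> by (auto simp: S_def intro!: in_delta_domain_1)
  have "(deriv ^^ m) g holomorphic_on ?D" by (intro holomorphic_higher_deriv holo opn)
  hence "continuous_on S ((deriv ^^ m) g)"
    using SD by (meson holomorphic_on_imp_continuous_on holomorphic_on_subset)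
  hence "compact ((deriv ^^ m) g ` S)" using \<open>compact S\<close> by (rule compact_continuous_image)
  hence "bounded ((deriv ^^ m) g ` S)" by (rule compact_imp_bounded)
  then obtain K2 where K2: "K2 > 0" "\<And>z. z \<in> S \<Longrightarrow> norm ((deriv ^^ m) g z) \<le> K2"
    by (auto simp: bounded_pos)
  \<comment> \<open>As |z - 1| <= 2 and a - m <= 0, the power of |z - 1| is at least 2^(a-m);
    dividing by this value turns the bound \<open>K2\<close> into one of the required form.\<close>
  define K where "K = \<bar>K1\<bar> + K2 / 2 powr (a - real m)"
  have "K2 / 2 powr (a - real m) > 0" using K2 by simp
  hence "K1 \<le> K" unfolding K_def by linarith
  have "norm ((deriv ^^ m) g z) \<le> K * norm (z - 1) powr (a - real m)" if z: "norm z < 1" for z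
  proof (cases "norm (z - 1) < \<delta>")
    case True
    have "norm ((deriv ^^ m) g z) \<le> K1 * norm (z - 1) powr (a - real m)" using K1 True z by blast
    also have "\<dots> \<le> K * norm (z - 1) powr (a - real m)"
      using \<open>K1 \<le> K\<close> by (intro mult_right_mono) auto
    finally show ?thesis .
  next
    case False
    have z2: "0 < norm (z - 1)" "norm (z - 1) \<le> 2"
      using z norm_triangle_ineq4[of z 1] by auto
    have "norm ((deriv ^^ m) g z) \<le> K2" using False z by (intro K2) (auto simp: S_def)
    also have "K2 = K2 / 2 powr (a - real m) * 2 powr (a - real m)" by simp
    also have "\<dots> \<le> K * norm (z - 1) powr (a - real m)"
      using m K2 z2 unfolding K_def by (intro mult_mono powr_mono2') auto
    finally show ?thesis .
  qed
  moreover have "K > 0" using K2 by (simp add: K_def add_nonneg_pos)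
  ultimately show thesis using that by blast
qed

text \<open>
  No Hankel contour is needed: by Cauchy's estimates a derivative of order \<open>m \<ge> a + 2\<close> is
  \<open>O(\<bar>1 - z\<bar>\<^bsup>a-m\<^esup>)\<close> in the unit disc, and its coefficients are bounded by its mean over the circle of
  radius \<open>1 - 1/n\<close>, where \<open>\<bar>1 - z\<bar>\<^bsup>a-m\<^esup> \<le> n\<^bsup>m-a-2\<^esup> \<bar>1 - z\<bar>\<^bsup>-2\<^esup>\<close>.
\<close>

lemma transfer_bigo:
  fixes g :: "complex \<Rightarrow> complex" and a :: real and c :: "nat \<Rightarrow> complex"
  assumes \<theta>: "0 < \<theta>" "\<theta> < pi / 2" and \<eta>: "0 < \<eta>"
    and holo: "g holomorphic_on delta_domain 1 \<eta> \<theta>"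
    and near: "\<epsilon> > 0" "\<And>z. z \<in> delta_domain 1 \<eta> \<theta> \<Longrightarrow> norm (z - 1) < \<epsilon> \<Longrightarrow>
                 norm (g z) \<le> C * norm (z - 1) powr a"
    and sums: "\<And>z. norm z < 1 \<Longrightarrow> (\<lambda>n. c n * z ^ n) sums g z"
  shows "c \<in> O(\<lambda>n. real n powr (- a - 1))"
proof -
  define m where "m = nat \<lceil>a + 2\<rceil>"
  have m: "a + 2 \<le> real m" unfolding m_def by linarith
  define b where "b = real m - a"
  have b: "b \<ge> 2" using m by (simp add: b_def)
  obtain K where K: "K > 0"
    "\<And>z. norm z < 1 \<Longrightarrow> norm ((deriv ^^ m) g z) \<le> K * norm (z - 1) powr (a - real m)"
    using higher_deriv_bound_delta_domain[OF \<theta> \<eta> holo near, of m] m by auto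
  have ball: "ball 0 1 \<subseteq> delta_domain 1 \<eta> \<theta>"
    using \<theta> \<eta> by (auto intro!: in_delta_domain_1)
  have holo1: "g holomorphic_on ball 0 1" using holo ball by (rule holomorphic_on_subset)
  have coeff: "(deriv ^^ n) g 0 = fact n * c n" for n
  proof -
    have "eventually (\<lambda>z::complex. z \<in> ball 0 1) (nhds 0)"
      by (intro eventually_nhds_in_open) auto
    hence "eventually (\<lambda>z. (\<lambda>n. fps_nth (Abs_fps c) n * z ^ n) sums g z) (nhds 0)"
      by eventually_elim (use sums in auto)
    hence "g has_fps_expansion Abs_fps c" by (rule has_fps_expansionI)
    hence "(deriv ^^ n) g 0 / fact n = c n"
      using fps_nth_fps_expansion by fastforce
    thus ?thesis by (simp add: field_simps)
  qed
  \<comment> \<open>The circle has radius 1 - 1/n, so r^n tends to 1/e and eventually exceeds 1/4.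
    The index is n + m because m differentiations have already been spent.\<close>
  have key: "norm (c (n + m)) \<le> 4 * K * real n powr (- a - 1)"
    if n: "n \<ge> 2" "(1 - 1 / real n) ^ n \<ge> 1 / 4" for n
  proof -
    define r where "r = 1 - 1 / real n"
    have r: "0 < r" "r < 1" using n by (auto simp: r_def)
    have "norm ((deriv ^^ n) ((deriv ^^ m) g) 0) / fact n \<le> (K * real n powr (b - 2)) / (1 - r\<^sup>2) / r ^ n"
    proof (rule norm_higher_deriv_le_circle_mean)
      show "(deriv ^^ m) g holomorphic_on ball 0 1"
        by (intro holomorphic_higher_deriv holo1) auto
      fix z :: complex assume z: "norm z = r"
      have z1: "norm (z - 1) \<ge> 1 / real n" using z norm_triangle_ineq2[of 1 z]
        by (simp add: r_def norm_minus_commute)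
      have "1 / real n > 0" using n by simp
      have "norm ((deriv ^^ m) g z) \<le> K * norm (z - 1) powr (a - real m)"
        using z r by (intro K) auto
      also have "norm (z - 1) powr (a - real m) = norm (z - 1) powr (- (b - 2)) / (norm (z - 1))\<^sup>2"
      proof -
        have "norm (z - 1) > 0" using z1 \<open>1 / real n > 0\<close> by linarith
        hence "(norm (z - 1))\<^sup>2 = norm (z - 1) powr 2" by simp
        moreover have "a - real m = - (b - 2) - 2" by (simp add: b_def)
        ultimately show ?thesis by (simp only: powr_diff)
      qed
      also have "norm (z - 1) powr (- (b - 2)) \<le> (1 / real n) powr (- (b - 2))"
        using b z1 n by (intro powr_mono2') auto
      also have "(1 / real n) powr (- (b - 2)) = real n powr (b - 2)"
        using n by (simp only: powr_divide powr_minus) (simp add: powr_minus[symmetric])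
      finally show "norm ((deriv ^^ m) g z) \<le> K * real n powr (b - 2) / (norm (1 - z))\<^sup>2"
        using K(1) by (simp add: divide_right_mono norm_minus_commute)
    qed (use r in auto)
    also have "\<dots> \<le> (K * real n powr (b - 2)) / (1 / real n) / (1 / 4)"
    proof (intro frac_le)
      have "r\<^sup>2 \<le> r" using r by (simp add: power2_eq_square)
      thus "1 / real n \<le> 1 - r\<^sup>2" by (simp add: r_def)
      show "1 / 4 \<le> r ^ n" using n by (simp add: r_def)
    qed (use K n in auto)
    also have "\<dots> = 4 * K * real n powr (b - 1)"
      using n by (simp add: powr_diff field_simps power2_eq_square)
    finally have *: "norm ((deriv ^^ n) ((deriv ^^ m) g) 0) / fact n \<le> 4 * K * real n powr (b - 1)" .
    have "(deriv ^^ n) ((deriv ^^ m) g) 0 = fact (n + m) * c (n + m)"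
      by (simp add: coeff[symmetric] funpow_add)
    hence **: "norm (c (n + m)) * (fact (n + m) / fact n) \<le> 4 * K * real n powr (b - 1)"
      using * by (simp add: norm_mult mult_ac)
    \<comment> \<open>The quotient is the product of n+1, ..., n+m; dividing by it undoes the m
      differentiations.\<close>
    have "real n ^ m \<le> fact (n + m) / fact n"
    proof -
      have "fact n * n ^ m \<le> (fact (n + m) :: nat)"
      proof (induction m)
        case (Suc m)
        have "fact n * n ^ Suc m = (fact n * n ^ m) * n" by simp
        also have "\<dots> \<le> fact (n + m) * (n + Suc m)" by (intro mult_mono Suc) auto
        finally show ?case by (simp add: mult_ac)
      qed auto
      hence "real (fact n * n ^ m) \<le> real (fact (n + m))" by linarith
      thus ?thesis by (simp add: field_simps)
    qed
    hence "norm (c (n + m)) * real n ^ m \<le> norm (c (n + m)) * (fact (n + m) / fact n)"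
      by (intro mult_left_mono) auto
    also note **
    also have "4 * K * real n powr (b - 1) = 4 * K * real n powr (- a - 1) * real n ^ m"
      using n by (simp add: b_def powr_realpow[symmetric] powr_add[symmetric] algebra_simps)
    finally show ?thesis using n by (simp add: mult_right_le_imp_le)
  qed
  have "(\<lambda>n. (1 + (- 1) / real n) ^ n) \<longlonglongrightarrow> exp (- 1)"
    by (rule tendsto_exp_limit_sequentially)
  moreover have "(1 / 4 :: real) < exp (- 1)"
    using exp_le by (simp add: exp_minus field_simps)
  ultimately have "eventually (\<lambda>n::nat. (1 + (- 1) / real n) ^ n > 1 / 4) at_top"
    by (rule order_tendstoD(1))
  hence "eventually (\<lambda>n::nat. (1 - 1 / real n) ^ n \<ge> 1 / 4) at_top"
    by eventually_elim simp
  hence "eventually (\<lambda>n. norm (c (n + m)) \<le> 4 * K * norm (real n powr (- a - 1))) at_top"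
    using eventually_ge_at_top[of 2] by eventually_elim (use key in auto)
  hence "(\<lambda>n. c (n + m)) \<in> O(\<lambda>n. real n powr (- a - 1))"
    by (intro bigoI[where c = "4 * K"]) simp
  also have "(\<lambda>n. complex_of_real (real n powr (- a - 1))) \<in> O(\<lambda>n. complex_of_real (real (n + m) powr (- a - 1)))"
    by (subst landau_o.big.of_real_iff) real_asymp
  finally have "(\<lambda>n. c (n + m)) \<in> O(\<lambda>n. real (n + m) powr (- a - 1))" .
  then obtain K' where "eventually (\<lambda>n. norm (c (n + m)) \<le> K' * norm (complex_of_real (real (n + m) powr (- a - 1)))) at_top"
    by (auto elim!: landau_o.bigE)
  hence "eventually (\<lambda>n. norm (c n) \<le> K' * norm (real n powr (- a - 1))) at_top"
    using eventually_sequentially_seg[of "\<lambda>n. norm (c n) \<le> K' * norm (real n powr (- a - 1))" m] by simp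
  thus ?thesis by (intro bigoI[where c = K']) simp
qed

section \<open>Coefficients of (1-z)^(-s) with relative error O(1/n)\<close>

lemma tendsto_rate_of_increments:
  fixes v :: "nat \<Rightarrow> real"
  assumes "v \<longlonglongrightarrow> l" "(\<lambda>n. v (Suc n) - v n) \<in> O(\<lambda>n. 1 / real n ^ 2)"
  shows "(\<lambda>n. v n - l) \<in> O(\<lambda>n. 1 / real n)"
proof -
  obtain K0 where "eventually (\<lambda>n. norm (v (Suc n) - v n) \<le> K0 * norm (1 / real n ^ 2)) at_top"
    using assms(2) by (auto elim!: landau_o.bigE)
  then obtain N where N: "\<And>n. n \<ge> N \<Longrightarrow> norm (v (Suc n) - v n) \<le> K0 * (1 / real n ^ 2)"
    by (auto simp: eventually_at_top_linorder)
  define K where "K = max K0 0"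
  have K: "norm (v (Suc n) - v n) \<le> K * (1 / real n ^ 2)" if "n \<ge> N" for n
  proof -
    have "K0 * (1 / real n ^ 2) \<le> K * (1 / real n ^ 2)"
      by (intro mult_right_mono) (auto simp: K_def)
    with N[OF that] show ?thesis by linarith
  qed
  \<comment> \<open>Telescoping with 1/x^2 <= 1/(x-1) - 1/x; the bound n >= 2 keeps the first
    denominator positive.\<close>
  have step: "norm (v (n + j) - v n) \<le> K * (1 / real (n - 1) - 1 / real (n + j - 1))"
    if n: "n \<ge> max N 2" for n j
  proof (induction j)
    case (Suc j)
    have "norm (v (n + Suc j) - v n) \<le> norm (v (n + j) - v n) + norm (v (Suc (n + j)) - v (n + j))"
      using norm_triangle_ineq[of "v (n + j) - v n" "v (Suc (n + j)) - v (n + j)"] by simp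
    also have "norm (v (Suc (n + j)) - v (n + j)) \<le> K * (1 / real (n + j) ^ 2)"
      using n by (intro K) auto
    finally have 1: "norm (v (n + Suc j) - v n) \<le> norm (v (n + j) - v n) + K * (1 / real (n + j) ^ 2)" by simp
    have "1 / real (n + j) ^ 2 \<le> 1 / real (n + j - 1) - 1 / real (n + Suc j - 1)"
    proof -
      define x where "x = real (n + j)"
      have "real (n + j - 1) = x - 1" "real (n + Suc j - 1) = x" "x \<ge> 2"
        using n by (auto simp: x_def of_nat_diff)
      thus ?thesis unfolding x_def[symmetric] by (simp add: divide_simps power2_eq_square)
    qed
    hence "K * (1 / real (n + j) ^ 2) \<le> K * (1 / real (n + j - 1) - 1 / real (n + Suc j - 1))"
      by (intro mult_left_mono) (auto simp: K_def)
    with 1 Suc show ?case unfolding right_diff_distrib by argo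
  qed auto
  have "norm (v n - l) \<le> 2 * K * norm (1 / real n)" if n: "n \<ge> max N 2" for n
  proof -
    have "norm (v n - l) \<le> K * (1 / real (n - 1))"
    proof (rule tendsto_upperbound)
      show "(\<lambda>j. norm (v n - v (n + j))) \<longlonglongrightarrow> norm (v n - l)"
        using LIMSEQ_ignore_initial_segment[OF assms(1), of n]
        by (intro tendsto_intros) (simp add: add.commute)
      have "norm (v n - v (n + j)) \<le> K * (1 / real (n - 1))" for j
      proof -
        have "K * (1 / real (n - 1) - 1 / real (n + j - 1)) \<le> K * (1 / real (n - 1))"
          by (intro mult_left_mono) (auto simp: K_def)
        from order.trans[OF step[OF n] this] show ?thesis by (subst norm_minus_commute)
      qed
      thus "eventually (\<lambda>j. norm (v n - v (n + j)) \<le> K * (1 / real (n - 1))) sequentially" by simp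
    qed auto
    also have "\<dots> \<le> K * (2 / real n)"
      using n by (intro mult_left_mono) (auto simp: K_def field_simps of_nat_diff)
    finally show ?thesis by (simp add: mult.commute)
  qed
  thus ?thesis by (intro bigoI[where c = "2 * K"] eventually_at_top_linorderI[of "max N 2"]) auto
qed

text \<open>The sequence is the coefficient sequence of (1-z)^(-s), and L is 1/Gamma(s), nonzero
  since s is not a nonpositive integer. The limit alone carries no rate; the rate follows because
  consecutive normalised terms differ by O(1/n^2).\<close>

lemma pochhammer_over_fact_asymptotics:
  fixes s :: real
  assumes "- s \<notin> \<nat>"
  obtains L where "L \<noteq> 0"
    "(\<lambda>n. pochhammer s n / fact n - L * real n powr (s - 1)) \<in> O(\<lambda>n. real n powr (s - 2))"
proof -
  define v where "v = (\<lambda>n. pochhammer s n / fact n / real n powr (s - 1))"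
  define L where "L = inverse (Gamma s)"
  have s0: "s \<notin> \<int>\<^sub>\<le>\<^sub>0"
    using assms by (auto elim!: nonpos_Ints_cases' simp: Nats_def)
  have "L \<noteq> 0" using s0 by (simp add: L_def Gamma_eq_zero_iff)
  have "(\<lambda>n. (- s gchoose n) / ((-1) ^ n / exp ((- s + 1) * of_real (ln (real n))))) \<longlonglongrightarrow> L"
    unfolding L_def using gbinomial_asymptotic[of "- s"] by simp
  moreover have "eventually (\<lambda>n. (- s gchoose n) / ((-1) ^ n / exp ((- s + 1) * of_real (ln (real n)))) = v n) at_top"
    using eventually_gt_at_top[of 0]
  proof eventually_elim
    case (elim n)
    have "(- s gchoose n) = (-1) ^ n * pochhammer s n / fact n"
      by (simp add: gbinomial_pochhammer)
    moreover have "exp ((- s + 1) * of_real (ln (real n))) = inverse (real n powr (s - 1))"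
      using elim by (simp add: powr_def exp_minus[symmetric] algebra_simps)
    ultimately show ?case by (simp add: v_def divide_inverse)
  qed
  ultimately have lim: "v \<longlonglongrightarrow> L" by (rule Lim_transform_eventually)
  have "(\<lambda>n. v (Suc n) - v n) \<in> O(\<lambda>n. 1 / real n ^ 2)"
  proof -
    have "eventually (\<lambda>n. v (Suc n) - v n = v n * ((real n + s) / (real n + 1) * (real n / (real n + 1)) powr (s - 1) - 1)) at_top"
      using eventually_gt_at_top[of 0]
    proof eventually_elim
      case (elim n)
      have *: "P * x / (y * F) / M = P / F / N * (x / y * (N / M))" if "N \<noteq> 0" for P x y F M N :: real
        using that by simp
      have "v (Suc n) = v n * ((real n + s) / (real n + 1) * (real n powr (s - 1) / (real n + 1) powr (s - 1)))"
        unfolding v_def pochhammer_Suc fact_Suc of_nat_Suc of_nat_mult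
        using elim by (subst *[symmetric]) (simp_all add: add_ac)
      thus ?case using elim by (simp add: powr_divide right_diff_distrib)
    qed
    moreover have "(\<lambda>n. v n * ((real n + s) / (real n + 1) * (real n / (real n + 1)) powr (s - 1) - 1)) \<in> O(\<lambda>n. 1 * (1 / real n ^ 2))"
    proof (rule landau_o.big.mult)
      show "v \<in> O(\<lambda>_. 1)" using lim by (intro bigoI_tendsto[of _ _ L]) auto
      \<comment> \<open>The first factor is 1 + (s-1)/n and the power is 1 - (s-1)/n, each up to
        O(1/n^2), so the terms of order 1/n cancel.\<close>
      show "(\<lambda>n. (real n + s) / (real n + 1) * (real n / (real n + 1)) powr (s - 1) - 1) \<in> O(\<lambda>n. 1 / real n ^ 2)"
        by real_asymp
    qed
    ultimately show ?thesis by (subst landau_o.big.in_cong) auto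
  qed
  from tendsto_rate_of_increments[OF lim this] have "(\<lambda>n. v n - L) \<in> O(\<lambda>n. 1 / real n)" .
  hence "(\<lambda>n. (v n - L) * real n powr (s - 1)) \<in> O(\<lambda>n. 1 / real n * real n powr (s - 1))"
    by (intro landau_o.big.mult) auto
  also have "(\<lambda>n. 1 / real n * real n powr (s - 1)) \<in> O(\<lambda>n. real n powr (s - 2))" by real_asymp
  also have "(\<lambda>n. (v n - L) * real n powr (s - 1)) \<in> O(\<lambda>n. real n powr (s - 2)) \<longleftrightarrow> 
     (\<lambda>n. pochhammer s n / fact n - L * real n powr (s - 1)) \<in> O(\<lambda>n. real n powr (s - 2))"
    using eventually_gt_at_top[of 0]
    by (intro landau_o.big.in_cong) (auto elim!: eventually_mono simp: v_def algebra_simps)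
  finally show thesis using that \<open>L \<noteq> 0\<close> by blast
qed

text \<open>Rescaling moves the singularity to 1. Removing the polynomial and the pure power leaves
  a remainder O(|1-z|^(1-s)), whose coefficients are O(n^(s-2)) by \<open>transfer_bigo\<close>; the
  pure power contributes the main term.\<close>

lemma singular_exponent_coeff_asymptotics:
  assumes "has_singular_exponent F s"
  obtains D where "D \<noteq> 0"
    "(\<lambda>n. fps_nth F n * conv_rad F ^ n - D * real n powr (s - 1)) \<in> O(\<lambda>n. real n powr (s - 2))"
proof -
  define \<rho> where "\<rho> = conv_rad F"
  from assms obtain \<eta> \<theta> f \<kappa> P where s: "- s \<notin> \<nat>"
    and \<eta>: "\<eta> > 0" and \<theta>: "0 < \<theta>" "\<theta> < pi / 2" and \<kappa>: "\<kappa> \<noteq> 0"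
    and f: "extends_series F f (delta_domain \<rho> \<eta> \<theta>)"
    and O: "(\<lambda>z. f z - (poly P z + \<kappa> * (1 - z / of_real \<rho>) powr of_real (- s)))
             \<in> O[at (of_real \<rho>) within delta_domain \<rho> \<eta> \<theta>](\<lambda>z.
                  (1 - z / of_real \<rho>) powr of_real (- s + 1))"
    by (auto simp: has_singular_exponent_def Let_def \<rho>_def)
  have \<rho>: "\<rho> > 0" using assms
    by (cases "fps_conv_radius F") (auto simp: has_singular_exponent_def \<rho>_def conv_rad_def)
  let ?D = "delta_domain 1 \<eta> \<theta>"
  have scale: "of_real \<rho> * z \<in> delta_domain \<rho> \<eta> \<theta>" if "z \<in> ?D" for z
    using that \<rho> by (auto simp: delta_domain_def norm_mult)
  define g where "g = (\<lambda>z. f (of_real \<rho> * z) - (poly P (of_real \<rho> * z) + \<kappa> * (1 - z) powr of_real (- s)))"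
  define p where "p = (\<lambda>n. pochhammer s n / fact n)"
  define c where "c = (\<lambda>n. of_real (fps_nth F n * \<rho> ^ n) - (coeff P n * of_real \<rho> ^ n + \<kappa> * of_real (p n)))"
  \<comment> \<open>1 - z is a nonpositive real only when z - 1 points along the positive axis, the
    axis of the excluded cone; so the principal power is holomorphic.\<close>
  have slit: "1 - z \<notin> \<real>\<^sub>\<le>\<^sub>0" if "z \<in> ?D" for z
  proof
    assume "1 - z \<in> \<real>\<^sub>\<le>\<^sub>0"
    then obtain x where x: "x \<ge> 0" "z - 1 = of_real x"
      by (elim nonpos_Reals_cases) (metis minus_diff_eq neg_0_le_iff_le of_real_minus)
    hence "norm (z - 1) = x" "Re (z - 1) = x" by simp_all
    with that \<theta> have "x < cos \<theta> * x" by (simp add: mem_delta_domain_1_iff)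
    thus False using x mult_right_mono[of "cos \<theta>" 1 x] by simp
  qed
  have holo: "g holomorphic_on ?D"
  proof -
    have "f holomorphic_on delta_domain \<rho> \<eta> \<theta>" using f by (simp add: extends_series_def)
    hence "(f \<circ> (\<lambda>z. of_real \<rho> * z)) holomorphic_on ?D"
      using scale by (intro holomorphic_on_compose_gen[where t = "delta_domain \<rho> \<eta> \<theta>"] holomorphic_intros) auto
    moreover have "poly P holomorphic_on UNIV"
      using poly_DERIV[of P] by (meson holomorphic_on_open open_UNIV)
    hence "(poly P \<circ> (\<lambda>z. of_real \<rho> * z)) holomorphic_on ?D"
      by (intro holomorphic_on_compose_gen[where t = UNIV] holomorphic_intros) auto
    moreover have "(\<lambda>z. (1 - z) powr of_real (- s)) holomorphic_on ?D"
      using slit by (intro holomorphic_intros) auto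
    ultimately show ?thesis unfolding g_def o_def
      by (intro holomorphic_on_diff holomorphic_on_add holomorphic_on_mult holomorphic_on_const)
  qed
  obtain C where "eventually (\<lambda>z. norm (f z - (poly P z + \<kappa> * (1 - z / of_real \<rho>) powr of_real (- s))) \<le>
        C * norm ((1 - z / of_real \<rho>) powr of_real (- s + 1))) (at (of_real \<rho>) within delta_domain \<rho> \<eta> \<theta>)"
    using O by (auto elim!: landau_o.bigE)
  then obtain \<epsilon> where \<epsilon>: "\<epsilon> > 0" and bnd: "\<And>z. z \<in> delta_domain \<rho> \<eta> \<theta> \<Longrightarrow> z \<noteq> of_real \<rho> \<Longrightarrow> dist z (of_real \<rho>) < \<epsilon> \<Longrightarrow>
      norm (f z - (poly P z + \<kappa> * (1 - z / of_real \<rho>) powr of_real (- s))) \<le>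
        C * norm ((1 - z / of_real \<rho>) powr of_real (- s + 1))"
    by (auto simp: eventually_at)
  have near: "norm (g z) \<le> C * norm (z - 1) powr (1 - s)" if z: "z \<in> ?D" "norm (z - 1) < \<epsilon> / \<rho>" for z
  proof -
    have z1: "z \<noteq> 1" using z(1) by (auto simp: delta_domain_def)
    have "dist (of_real \<rho> * z) (of_real \<rho>) = norm (of_real \<rho> * (z - 1))" by (simp add: dist_norm algebra_simps)
    also have "\<dots> = \<rho> * norm (z - 1)" using \<rho> by (simp only: norm_mult norm_of_real)
    also have "\<dots> < \<epsilon>" using z(2) \<rho> by (simp add: field_simps)
    finally have "norm (g z) \<le> C * norm ((1 - z) powr of_real (- s + 1))"
      using bnd[OF scale[OF z(1)]] \<rho> z1 by (simp add: g_def)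
    also have "norm ((1 - z) powr of_real (- s + 1)) = norm (z - 1) powr (1 - s)"
      using z1 by (subst norm_powr_real_powr') (auto simp: norm_minus_commute)
    finally show ?thesis .
  qed
  have sums: "(\<lambda>n. c n * z ^ n) sums g z" if z: "norm z < 1" for z
  proof -
    have "z \<in> ?D" using z \<theta> \<eta> by (intro in_delta_domain_1) auto
    hence "(\<lambda>n. of_real (fps_nth F n) * (of_real \<rho> * z) ^ n) sums f (of_real \<rho> * z)"
      using f z \<rho> scale by (auto simp: extends_series_def \<rho>_def norm_mult)
    moreover have "(\<lambda>n. coeff P n * (of_real \<rho> * z) ^ n) sums poly P (of_real \<rho> * z)"
      unfolding poly_altdef by (rule sums_finite) (auto simp: coeff_eq_0)
    moreover have "(\<lambda>n. (of_real (- s) gchoose n) * (- z) ^ n) sums (1 + (- z)) powr of_real (- s)"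
      using z by (intro gen_binomial_complex) auto
    hence "(\<lambda>n. \<kappa> * ((of_real (- s) gchoose n) * (- z) ^ n)) sums (\<kappa> * (1 - z) powr of_real (- s))"
      by (intro sums_mult) simp
    ultimately have "(\<lambda>n. of_real (fps_nth F n) * (of_real \<rho> * z) ^ n -
        (coeff P n * (of_real \<rho> * z) ^ n + \<kappa> * ((of_real (- s) gchoose n) * (- z) ^ n))) sums g z"
      unfolding g_def by (intro sums_diff sums_add)
    moreover have "(of_real (- s) gchoose n) * (- z) ^ n = of_real (p n) * z ^ n" for n
      unfolding p_def gbinomial_pochhammer
      by (subst power_minus) (simp add: pochhammer_of_real power_mult_distrib[symmetric])
    ultimately show ?thesis by (simp add: c_def algebra_simps power_mult_distrib)
  qed
  have cO: "c \<in> O(\<lambda>n. complex_of_real (real n powr (s - 2)))"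
    using transfer_bigo[of \<theta> \<eta> g "\<epsilon> / \<rho>" C "1 - s" c, OF \<theta> \<eta> holo _ near sums] \<epsilon> \<rho>
    by simp
  obtain L where L: "L \<noteq> 0" "(\<lambda>n. p n - L * real n powr (s - 1)) \<in> O(\<lambda>n. real n powr (s - 2))"
    using pochhammer_over_fact_asymptotics[OF s] unfolding p_def by blast
  define e where "e = (\<lambda>n. complex_of_real (fps_nth F n * \<rho> ^ n) - \<kappa> * of_real (L * real n powr (s - 1)))"
  have eO: "e \<in> O(\<lambda>n. complex_of_real (real n powr (s - 2)))"
  proof -
    have "(\<lambda>n. complex_of_real (p n - L * real n powr (s - 1))) \<in> O(\<lambda>n. complex_of_real (real n powr (s - 2)))"
      using L(2) by (simp only: landau_o.big.of_real_iff)
    hence "(\<lambda>n. c n + \<kappa> * complex_of_real (p n - L * real n powr (s - 1))) \<in> O(\<lambda>n. complex_of_real (real n powr (s - 2)))"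
      by (intro sum_in_bigo cO) auto
    also have "?this \<longleftrightarrow> ?thesis"
    proof (rule landau_o.big.in_cong)
      \<comment> \<open>Beyond its degree the polynomial has no coefficients.\<close>
      show "eventually (\<lambda>n. c n + \<kappa> * complex_of_real (p n - L * real n powr (s - 1)) = e n) at_top"
        using eventually_gt_at_top[of "degree P"]
        by eventually_elim (simp add: e_def c_def coeff_eq_0 algebra_simps)
    qed
    finally show ?thesis .
  qed
  obtain K where K: "eventually (\<lambda>n. norm (e n) \<le> K * norm (complex_of_real (real n powr (s - 2)))) at_top"
    using eO by (auto elim!: landau_o.bigE)
  have Re: "(\<lambda>n. fps_nth F n * \<rho> ^ n - Re \<kappa> * L * real n powr (s - 1)) \<in> O(\<lambda>n. real n powr (s - 2))"
  proof (rule bigoI)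
    show "eventually (\<lambda>n. norm (fps_nth F n * \<rho> ^ n - Re \<kappa> * L * real n powr (s - 1)) \<le>
        K * norm (real n powr (s - 2))) at_top"
      using K
    proof eventually_elim
      case (elim n)
      have "Re (e n) = fps_nth F n * \<rho> ^ n - Re \<kappa> * L * real n powr (s - 1)" by (simp add: e_def)
      thus ?case using elim abs_Re_le_cmod[of "e n"] by simp
    qed
  qed
  have Im: "(\<lambda>n. Im \<kappa> * L * real n powr (s - 1)) \<in> O(\<lambda>n. real n powr (s - 2))"
  proof (rule bigoI)
    show "eventually (\<lambda>n. norm (Im \<kappa> * L * real n powr (s - 1)) \<le>
        K * norm (real n powr (s - 2))) at_top"
      using K
    proof eventually_elim
      case (elim n)
      have "Im (e n) = - (Im \<kappa> * L * real n powr (s - 1))" by (simp add: e_def)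
      thus ?case using elim abs_Im_le_cmod[of "e n"] by simp
    qed
  qed
  \<comment> \<open>\<kappa> is only given as a complex number. Since the coefficients of F are
    real, the imaginary part of the main term would have to be of the order of the error, which is
    smaller by a factor n.\<close>
  have "Im \<kappa> = 0"
  proof (rule ccontr)
    assume "Im \<kappa> \<noteq> 0"
    hence "(\<lambda>n. real n powr (s - 1)) \<in> O(\<lambda>n. real n powr (s - 2))" using Im L(1) by simp
    moreover have "(\<lambda>n. real n powr (s - 2)) \<in> o(\<lambda>n. real n powr (s - 1))" by real_asymp
    ultimately have "(\<lambda>n. real n powr (s - 1)) \<in> o(\<lambda>n. real n powr (s - 1))"
      by (rule landau_o.big_small_trans)
    hence "eventually (\<lambda>n. real n powr (s - 1) = 0) at_top" by (simp add: landau_o.small_refl_iff)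
    moreover have "eventually (\<lambda>n. real n powr (s - 1) \<noteq> 0) at_top"
      using eventually_gt_at_top[of 0] by eventually_elim auto
    ultimately have "eventually (\<lambda>n::nat. False) at_top" by eventually_elim simp
    thus False by simp
  qed
  hence "Re \<kappa> * L \<noteq> 0" using \<kappa> L(1) by (simp add: complex_eq_iff)
  with Re that show thesis unfolding \<rho>_def by blast
qed

section \<open>Renewal sequences\<close>

text \<open>Valid for both signs of y. The factor exp |y| is affordable because it will be
  integrated against a law with exponential moments.\<close>

lemma exp_le_quadratic:
  fixes y :: real
  shows "exp y \<le> 1 + y + y\<^sup>2 * exp \<bar>y\<bar>"
proof -
  obtain t where t: "\<bar>t\<bar> \<le> \<bar>y\<bar>" "exp y = (\<Sum>m<2. y ^ m / fact m) + exp t / fact 2 * y\<^sup>2"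
    using Maclaurin_exp_le[of y 2] by blast
  have "exp t / fact 2 * y\<^sup>2 \<le> exp \<bar>y\<bar> * y\<^sup>2"
  proof (intro mult_right_mono)
    have "exp t / fact 2 \<le> exp t" by simp
    also have "\<dots> \<le> exp \<bar>y\<bar>" using t(1) by simp
    finally show "exp t / fact 2 \<le> exp \<bar>y\<bar>" .
  qed auto
  thus ?thesis using t(2) by (simp add: eval_nat_numeral mult_ac)
qed

lemma integrable_pmf_nat_iff:
  fixes p :: "nat pmf" and f :: "nat \<Rightarrow> real"
  shows "integrable (measure_pmf p) f \<longleftrightarrow> summable (\<lambda>n. pmf p n * \<bar>f n\<bar>)"
  unfolding measure_pmf_eq_density
  by (subst integrable_density) (auto simp: integrable_count_space_nat_iff abs_mult)

lemma expectation_pmf_nat: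
  fixes p :: "nat pmf" and f :: "nat \<Rightarrow> real"
  assumes "summable (\<lambda>n. pmf p n * \<bar>f n\<bar>)"
  shows "measure_pmf.expectation p f = (\<Sum>n. pmf p n * f n)"
  unfolding measure_pmf_eq_density using assms
  by (subst integral_density) (auto simp: integral_count_space_nat integrable_count_space_nat_iff abs_mult)

lemma pmf_nat_sums_1:
  fixes p :: "nat pmf"
  shows "pmf p sums 1"
proof -
  have "summable (\<lambda>n. pmf p n * \<bar>1\<bar>)"
    unfolding integrable_pmf_nat_iff[symmetric] by simp
  moreover from expectation_pmf_nat[OF this] have "(\<Sum>n. pmf p n) = 1" by simp
  ultimately show ?thesis by (simp add: sums_iff)
qed

text \<open>In the application p is the law of the size of a Boltzmann object at \<rho>, and R =
  r/\<rho> for some r strictly between \<rho> and the radius of B.\<close>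

locale renewal_law =
  fixes p :: "nat pmf" and R :: real
  assumes R: "R > 1" and p0: "pmf p 0 = 0" and summable_R: "summable (\<lambda>n. pmf p n * R ^ n)"
    and aperiodic: "\<And>d. d \<ge> 2 \<Longrightarrow> \<exists>n. pmf p n \<noteq> 0 \<and> \<not> d dvd n"
    and variance_pos: "measure_pmf.variance p real > 0"
begin

definition \<mu> :: real where "\<mu> = measure_pmf.expectation p real"
definition \<sigma> :: real where "\<sigma> = sqrt (measure_pmf.variance p real)"
definition G :: "real \<Rightarrow> real" where "G x = (\<Sum>n. pmf p n * x ^ n)"
definition q :: "nat \<Rightarrow> nat \<Rightarrow> real" where "q k n = fps_nth (Abs_fps (pmf p) ^ k) n"
text \<open>Steps are at least 1, so no renewal of index above n can occur at n and the finite sum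
  is complete.\<close>

definition u :: "nat \<Rightarrow> real" where "u n = (\<Sum>k\<le>n. q k n)"

lemma q_0: "q 0 n = (if n = 0 then 1 else 0)"
  by (simp add: q_def)

lemma q_Suc: "q (Suc k) n = (\<Sum>j\<le>n. pmf p j * q k (n - j))"
  by (simp add: q_def fps_mult_nth atLeast0AtMost)

lemma q_nonneg: "q k n \<ge> 0"
  by (induction k arbitrary: n) (auto simp: q_0 q_Suc intro!: sum_nonneg mult_nonneg_nonneg)

lemma q_eq_0: "n < k \<Longrightarrow> q k n = 0"
proof (induction k arbitrary: n)
  case (Suc k)
  have "pmf p j * q k (n - j) = 0" if "j \<le> n" for j
  proof (cases "j = 0")
    case False
    thus ?thesis using Suc.prems that by (simp add: Suc.IH)
  qed (simp add: p0)
  hence "(\<Sum>j\<le>n. pmf p j * q k (n - j)) = 0" by (intro sum.neutral ballI) auto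
  thus ?case by (simp only: q_Suc)
qed auto

lemma q_add: "q (k + l) n = (\<Sum>j\<le>n. q k j * q l (n - j))"
  by (simp add: q_def power_add fps_mult_nth atLeast0AtMost)

lemma sum_q_Suc:
  assumes "finite K"
  shows "(\<Sum>k\<in>K. q (Suc k) n) = (\<Sum>j\<le>n. pmf p j * (\<Sum>k\<in>K. q k (n - j)))"
  unfolding q_Suc sum_distrib_left by (rule sum.swap)

lemma sum_pmf_le_1: "finite A \<Longrightarrow> (\<Sum>j\<in>A. pmf p j) \<le> 1"
  by (metis measure_measure_pmf_finite measure_pmf.prob_le_1)

text \<open>The summands are probabilities of disjoint events, as positive steps cannot visit n
  twice. In the induction this appears as the separate case n = 0, where \<open>p0\<close> leaves
  only the term of index 0.\<close>

lemma sum_q_le_1: "(\<Sum>k\<le>m. q k n) \<le> 1"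
proof (induction m arbitrary: n)
  case (Suc m)
  have "(\<Sum>k\<le>Suc m. q k n) = q 0 n + (\<Sum>k\<le>m. q (Suc k) n)"
    by (rule sum.atMost_Suc_shift)
  also have "(\<Sum>k\<le>m. q (Suc k) n) = (\<Sum>j\<le>n. pmf p j * (\<Sum>k\<le>m. q k (n - j)))"
    by (rule sum_q_Suc) auto
  also have "q 0 n + \<dots> \<le> 1"
  proof (cases "n = 0")
    case False
    have "(\<Sum>j\<le>n. pmf p j * (\<Sum>k\<le>m. q k (n - j))) \<le> (\<Sum>j\<le>n. pmf p j * 1)"
      by (intro sum_mono mult_left_mono Suc.IH) auto
    also have "\<dots> \<le> 1" using sum_pmf_le_1 by simp
    finally show ?thesis using False by (simp add: q_0)
  qed (simp add: q_0 p0)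
  finally show ?case .
qed (simp add: q_0)

lemma u_le_1: "u n \<le> 1"
  unfolding u_def by (rule sum_q_le_1)

lemma u_nonneg: "u n \<ge> 0"
  unfolding u_def by (intro sum_nonneg q_nonneg)

lemma u_altdef: "m \<ge> n \<Longrightarrow> u n = (\<Sum>k\<le>m. q k n)"
  unfolding u_def by (intro sum.mono_neutral_left) (auto simp: q_eq_0)

lemma summable_G: "0 \<le> x \<Longrightarrow> x \<le> R \<Longrightarrow> summable (\<lambda>n. pmf p n * x ^ n)"
  by (rule summable_comparison_test[OF _ summable_R])
     (auto intro!: exI[of _ 0] mult_left_mono power_mono simp: abs_mult)

lemma sum_le_G: "0 \<le> x \<Longrightarrow> x \<le> R \<Longrightarrow> (\<Sum>j\<le>n. pmf p j * x ^ j) \<le> G x"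
  unfolding G_def by (intro sum_le_suminf summable_G) auto

lemma G_nonneg: "0 \<le> x \<Longrightarrow> x \<le> R \<Longrightarrow> 0 \<le> G x"
  unfolding G_def by (intro suminf_nonneg summable_G) auto

lemma G_ge_1: "1 \<le> x \<Longrightarrow> x \<le> R \<Longrightarrow> 1 \<le> G x"
proof -
  assume x: "1 \<le> x" "x \<le> R"
  have "(\<Sum>n. pmf p n) \<le> G x"
    unfolding G_def using x pmf_nat_sums_1[of p]
    by (intro suminf_le summable_G) (auto simp: sums_iff mult_le_cancel_left1 not_less)
  thus ?thesis using pmf_nat_sums_1[of p] by (simp add: sums_iff)
qed

text \<open>The induction step common to both Chernoff bounds: splitting x^n as x^j x^(n-j) makes
  the convolution with p cost at most a factor G x.\<close>

lemma sum_pmf_mult_power_le_G_mult: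
  assumes "0 \<le> x" "x \<le> R" "\<And>j. j \<le> n \<Longrightarrow> V (n - j) * x ^ (n - j) \<le> M" "0 \<le> M"
  shows "(\<Sum>j\<le>n. pmf p j * V (n - j)) * x ^ n \<le> G x * M"
proof -
  have "(\<Sum>j\<le>n. pmf p j * V (n - j)) * x ^ n = (\<Sum>j\<le>n. pmf p j * x ^ j * (V (n - j) * x ^ (n - j)))"
    unfolding sum_distrib_right
  proof (intro sum.cong refl)
    fix j assume "j \<in> {..n}"
    hence "x ^ n = x ^ j * x ^ (n - j)" by (simp flip: power_add)
    thus "pmf p j * V (n - j) * x ^ n = pmf p j * x ^ j * (V (n - j) * x ^ (n - j))"
      by (simp add: mult_ac)
  qed
  also have "\<dots> \<le> (\<Sum>j\<le>n. pmf p j * x ^ j * M)"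
    using assms by (intro sum_mono mult_left_mono assms) auto
  also have "\<dots> \<le> G x * M"
    unfolding sum_distrib_right[symmetric] using assms by (intro mult_right_mono sum_le_G)
  finally show ?thesis .
qed

text \<open>Inducting on the whole sum, instead of bounding each term by G x ^ k, avoids a factor m
  + 1, which would spoil the bound in the range m of order n.\<close>

lemma sum_q_atMost_chernoff:
  assumes "1 \<le> x" "x \<le> R"
  shows "(\<Sum>k\<le>m. q k n) * x ^ n \<le> G x ^ m"
proof (induction m arbitrary: n)
  case (Suc m)
  have "(\<Sum>k\<le>Suc m. q k n) = q 0 n + (\<Sum>k\<le>m. q (Suc k) n)"
    by (rule sum.atMost_Suc_shift)
  also have "(\<Sum>k\<le>m. q (Suc k) n) = (\<Sum>j\<le>n. pmf p j * (\<Sum>k\<le>m. q k (n - j)))"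
    by (rule sum_q_Suc) auto
  finally have eq: "(\<Sum>k\<le>Suc m. q k n) = q 0 n + (\<Sum>j\<le>n. pmf p j * (\<Sum>k\<le>m. q k (n - j)))" .
  show ?case
  proof (cases "n = 0")
    case False
    have "(\<Sum>j\<le>n. pmf p j * (\<Sum>k\<le>m. q k (n - j))) * x ^ n \<le> G x * G x ^ m"
      using assms G_nonneg[of x] by (intro sum_pmf_mult_power_le_G_mult Suc.IH) auto
    thus ?thesis unfolding eq using False by (simp add: q_0)
  next
    case True
    have "1 \<le> G x ^ Suc m" using G_ge_1[of x] assms by (intro one_le_power) auto
    thus ?thesis unfolding eq using True by (simp add: q_0 p0)
  qed
qed (simp add: q_0)

lemma sum_q_atLeast_Suc:
  "(\<Sum>k=Suc m..n. q k n) = (\<Sum>j\<le>n. pmf p j * (\<Sum>k=m..n-j. q k (n - j)))"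
proof -
  have "(\<Sum>k=Suc m..n. q k n) = (\<Sum>k=Suc m..Suc n. q k n)"
    by (intro sum.mono_neutral_left) (auto simp: q_eq_0)
  also have "\<dots> = (\<Sum>k=m..n. q (Suc k) n)"
    by (rule sum.shift_bounds_cl_Suc_ivl)
  also have "\<dots> = (\<Sum>j\<le>n. pmf p j * (\<Sum>k=m..n. q k (n - j)))"
    by (rule sum_q_Suc) auto
  also have "\<dots> = (\<Sum>j\<le>n. pmf p j * (\<Sum>k=m..n-j. q k (n - j)))"
    by (intro sum.cong refl arg_cong2[of _ _ _ _ "(*)"] sum.mono_neutral_right) (auto simp: q_eq_0)
  finally show ?thesis .
qed

text \<open>The first m steps are peeled off one at a time, each for a factor G x; what remains is a
  renewal probability, at most 1.\<close>

lemma sum_q_atLeast_chernoff: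
  assumes "0 < x" "x \<le> 1"
  shows "(\<Sum>k=m..n. q k n) * x ^ n \<le> G x ^ m"
proof (induction m arbitrary: n)
  case 0
  have "u n * x ^ n \<le> 1 * 1"
    using assms u_le_1[of n] by (intro mult_mono power_le_one) auto
  thus ?case by (simp add: u_def atLeast0AtMost)
next
  case (Suc m)
  show ?case
    unfolding sum_q_atLeast_Suc power_Suc using assms R G_nonneg[of x]
    by (intro sum_pmf_mult_power_le_G_mult[where V = "\<lambda>i. \<Sum>k=m..i. q k i"] Suc.IH) auto
qed

text \<open>
  \<open>q k n\<close> is the probability that the \<open>k\<close>-th renewal occurs at \<open>n\<close>, and \<open>u n\<close> that of a renewal at \<open>n\<close>;
  the identity conditions on the position of the \<open>m\<close>-th renewal.
\<close>

lemma sum_q_atLeast_convolution: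
  "(\<Sum>k=m..n. q k n) = (\<Sum>j\<le>n. q m j * u (n - j))"
proof -
  have "(\<Sum>j\<le>n. q m j * u (n - j)) = (\<Sum>j\<le>n. q m j * (\<Sum>k\<le>n. q k (n - j)))"
    by (intro sum.cong refl arg_cong2[of _ _ _ _ "(*)"] u_altdef) auto
  also have "\<dots> = (\<Sum>k\<le>n. \<Sum>j\<le>n. q m j * q k (n - j))"
    unfolding sum_distrib_left by (rule sum.swap)
  also have "\<dots> = (\<Sum>k\<le>n. q (m + k) n)" by (simp add: q_add)
  also have "\<dots> = (\<Sum>k=m..n+m. q k n)"
    using sum.shift_bounds_cl_nat_ivl[of "\<lambda>k. q k n" 0 m n] by (simp add: atLeast0AtMost add.commute)
  also have "\<dots> = (\<Sum>k=m..n. q k n)"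
    by (intro sum.mono_neutral_right) (auto simp: q_eq_0)
  finally show ?thesis ..
qed

lemma summable_moment2:
  obtains l where "l > 0" "exp l \<le> R" "summable (\<lambda>n. pmf p n * ((real n)\<^sup>2 * exp (l * real n)))"
proof
  \<comment> \<open>Half of the available exponential rate; the other half absorbs the factor
    n^2.\<close>
  define l where "l = ln R / 2"
  show l: "l > 0" using R by (simp add: l_def)
  have R': "R = exp (2 * l)" using R by (simp add: l_def)
  show "exp l \<le> R" using l by (simp add: R')
  have "(\<lambda>n. (real n)\<^sup>2 * exp (l * real n)) \<in> O(\<lambda>n. exp (2 * l * real n))"
    using l by real_asymp
  also have "(\<lambda>n. exp (2 * l * real n)) = (\<lambda>n. R ^ n)"
    by (simp add: R' exp_of_nat_mult[symmetric] mult_ac)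
  finally have "(\<lambda>n. pmf p n * ((real n)\<^sup>2 * exp (l * real n))) \<in> O(\<lambda>n. pmf p n * R ^ n)"
    by (rule landau_o.big.mult_left)
  thus "summable (\<lambda>n. pmf p n * ((real n)\<^sup>2 * exp (l * real n)))"
    by (rule summable_comparison_test_bigo[rotated]) (use summable_R R in \<open>simp add: abs_mult\<close>)
qed

lemma summable_square: "summable (\<lambda>n. pmf p n * (real n)\<^sup>2)"
proof -
  obtain l where l: "l > 0" "summable (\<lambda>n. pmf p n * ((real n)\<^sup>2 * exp (l * real n)))"
    using summable_moment2 by blast
  show ?thesis
    by (rule summable_comparison_test[OF _ l(2)])
       (use l in \<open>auto intro!: exI[of _ 0] mult_left_mono simp: abs_mult mult_le_cancel_left1\<close>)
qed

lemma summable_id: "summable (\<lambda>n. pmf p n * real n)"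
  by (rule summable_comparison_test[OF _ summable_square])
     (auto intro!: exI[of _ 0] mult_left_mono simp: abs_mult power2_eq_square mult_le_cancel_left1)

lemma \<mu>_sums: "(\<lambda>n. pmf p n * real n) sums \<mu>"
  unfolding \<mu>_def by (subst expectation_pmf_nat) (use summable_id in \<open>auto simp: summable_sums\<close>)

lemma \<mu>_ge_1: "\<mu> \<ge> 1"
proof -
  have "1 = (\<Sum>n. pmf p n)" using pmf_nat_sums_1[of p] by (simp add: sums_iff)
  also have "\<dots> \<le> (\<Sum>n. pmf p n * real n)"
  proof (intro suminf_le summable_id)
    show "pmf p n \<le> pmf p n * real n" for n by (cases n) (auto simp: p0 mult_le_cancel_left1)
  qed (use pmf_nat_sums_1[of p] in \<open>auto simp: sums_iff\<close>)
  also have "\<dots> = \<mu>" using \<mu>_sums by (simp add: sums_iff)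
  finally show ?thesis .
qed

lemma \<sigma>_pos: "\<sigma> > 0"
  using variance_pos by (simp add: \<sigma>_def)

text \<open>A quadratic bound on the cumulant generating function on both sides of 0; C is the
  second moment weighted by exp (l n).\<close>

lemma G_exp_le:
  obtains C l where "C \<ge> 0" "l > 0" "exp l \<le> R" "\<And>t. \<bar>t\<bar> \<le> l \<Longrightarrow> G (exp t) \<le> exp (\<mu> * t + C * t\<^sup>2)"
proof -
  obtain l where l: "l > 0" "exp l \<le> R" "summable (\<lambda>n. pmf p n * ((real n)\<^sup>2 * exp (l * real n)))"
    using summable_moment2 by blast
  define C where "C = (\<Sum>n. pmf p n * ((real n)\<^sup>2 * exp (l * real n)))"
  have "C \<ge> 0" unfolding C_def by (intro suminf_nonneg l) auto
  moreover have "G (exp t) \<le> exp (\<mu> * t + C * t\<^sup>2)" if t: "\<bar>t\<bar> \<le> l" for t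
  proof -
    have "exp t \<le> R" using t l(2) by (meson abs_le_D1 exp_le_cancel_iff order_trans)
    have "(\<lambda>n. pmf p n + t * (pmf p n * real n) + t\<^sup>2 * (pmf p n * ((real n)\<^sup>2 * exp (l * real n))))
            sums (1 + t * \<mu> + t\<^sup>2 * C)"
      using pmf_nat_sums_1[of p] \<mu>_sums l(3) unfolding C_def
      by (intro sums_add sums_mult summable_sums) auto
    moreover have "G (exp t) \<le> (\<Sum>n. pmf p n + t * (pmf p n * real n) + t\<^sup>2 * (pmf p n * ((real n)\<^sup>2 * exp (l * real n))))"
      unfolding G_def
    proof (intro suminf_le summable_G)
      fix n
      have "exp t ^ n = exp (t * real n)" by (simp add: exp_of_nat_mult[symmetric] mult_ac)
      also have "\<dots> \<le> 1 + t * real n + (t * real n)\<^sup>2 * exp \<bar>t * real n\<bar>" by (rule exp_le_quadratic)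
      also have "exp \<bar>t * real n\<bar> \<le> exp (l * real n)" using t by (simp add: abs_mult mult_right_mono)
      finally have "exp t ^ n \<le> 1 + t * real n + (t * real n)\<^sup>2 * exp (l * real n)"
        by (simp add: mult_left_mono)
      hence "pmf p n * exp t ^ n \<le> pmf p n * (1 + t * real n + (t * real n)\<^sup>2 * exp (l * real n))"
        by (intro mult_left_mono) auto
      thus "pmf p n * exp t ^ n \<le> pmf p n + t * (pmf p n * real n) + t\<^sup>2 * (pmf p n * ((real n)\<^sup>2 * exp (l * real n)))"
        by (simp add: algebra_simps power_mult_distrib)
    qed (use \<open>exp t \<le> R\<close> calculation in \<open>auto simp: sums_iff\<close>)
    ultimately have "G (exp t) \<le> 1 + (\<mu> * t + C * t\<^sup>2)" by (simp add: sums_iff mult_ac)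
    also have "\<dots> \<le> exp (\<mu> * t + C * t\<^sup>2)" by (rule exp_ge_add_one_self)
    finally show ?thesis .
  qed
  ultimately show thesis using that l by blast
qed

end

section \<open>The renewal theorem by inversion of power series\<close>

lemma fps_conv_radius_one_minus_X: "fps_conv_radius (1 - fps_X :: complex fps) = \<infinity>"
  using fps_conv_radius_diff[of 1 "fps_X :: complex fps"] by simp

context renewal_law begin

text \<open>The coefficients of h are the tail probabilities of a step, and h is 1 - \<phi> with its
  zero at 1 divided out. Exponential moments let h converge beyond the unit circle.\<close>

lemma renewal_tail_fps:
  defines "h \<equiv> Abs_fps (\<lambda>j. complex_of_real (1 - (\<Sum>n\<le>j. pmf p n)))"
  shows "(1 - fps_X) * h = 1 - Abs_fps (\<lambda>n. complex_of_real (pmf p n))"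
    and "fps_conv_radius h > 1"
    and "eval_fps h 1 = of_real \<mu>"
    and "fps_conv_radius (Abs_fps (\<lambda>n. complex_of_real (pmf p n))) > 1"
proof -
  let ?P = "Abs_fps (\<lambda>n. complex_of_real (pmf p n))"
  show eq: "(1 - fps_X) * h = 1 - ?P"
  proof (rule fps_ext)
    fix n show "fps_nth ((1 - fps_X) * h) n = fps_nth (1 - ?P) n"
      by (cases n) (simp_all add: h_def algebra_simps p0)
  qed
  have "summable (\<lambda>n. fps_nth ?P n * of_real R ^ n)"
    using summable_of_real[OF summable_R, where 'a = complex] by simp
  hence "fps_conv_radius ?P \<ge> norm (complex_of_real R)"
    unfolding fps_conv_radius_def by (rule conv_radius_geI)
  thus rP: "fps_conv_radius ?P > 1" using R
    by (smt (verit) less_ereal.simps(1) norm_of_real one_ereal_def order_less_le_trans)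
  \<comment> \<open>The tails are at most G R / R^j, so multiplied by r^j they are dominated by a
    geometric series of ratio 1/r.\<close>
  define r where "r = sqrt R"
  have r: "r > 1" "r * r = R" using R by (auto simp: r_def)
  have "summable (\<lambda>j. (1 - (\<Sum>n\<le>j. pmf p n)) * r ^ j)"
  proof (rule summable_comparison_test)
    show "summable (\<lambda>j. G R * (1 / r) ^ j)" using r by (intro summable_mult summable_geometric) auto
    show "\<exists>N. \<forall>j\<ge>N. norm ((1 - (\<Sum>n\<le>j. pmf p n)) * r ^ j) \<le> G R * (1 / r) ^ j"
    proof (intro exI[of _ 0] allI impI)
      fix j
      have "1 - (\<Sum>n\<le>j. pmf p n) = (\<Sum>n. pmf p (n + Suc j))"
        using suminf_minus_initial_segment[of "pmf p" "Suc j"] pmf_nat_sums_1[of p]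
        by (simp add: sums_iff lessThan_Suc_atMost)
      hence "(1 - (\<Sum>n\<le>j. pmf p n)) * R ^ j = (\<Sum>n. pmf p (n + Suc j) * R ^ j)"
        using summable_ignore_initial_segment[of "pmf p" "Suc j"] pmf_nat_sums_1[of p]
        by (simp only: sums_iff suminf_mult2)
      also have "\<dots> \<le> (\<Sum>n. pmf p (n + Suc j) * R ^ (n + Suc j))"
        using R pmf_nat_sums_1[of p] summable_R
        by (intro suminf_le mult_left_mono power_increasing summable_mult2 summable_ignore_initial_segment)
           (auto simp: sums_iff)
      also have "\<dots> = G R - (\<Sum>n<Suc j. pmf p n * R ^ n)"
        unfolding G_def by (rule suminf_minus_initial_segment[OF summable_R])
      also have "\<dots> \<le> G R"
        using R sum_nonneg[of "{..<Suc j}" "\<lambda>n. pmf p n * R ^ n"] by simp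
      finally have *: "(1 - (\<Sum>n\<le>j. pmf p n)) * r ^ j * r ^ j \<le> G R"
        by (simp add: r(2)[symmetric] power_mult_distrib mult_ac)
      have "1 - (\<Sum>n\<le>j. pmf p n) \<ge> 0" using sum_pmf_le_1[of "{..j}"] by simp
      thus "norm ((1 - (\<Sum>n\<le>j. pmf p n)) * r ^ j) \<le> G R * (1 / r) ^ j"
        using * r by (simp add: field_simps power_divide)
    qed
  qed
  from summable_of_real[OF this, where 'a = complex]
  have "summable (\<lambda>n. fps_nth h n * of_real r ^ n)" by (simp add: h_def)
  hence "fps_conv_radius h \<ge> norm (complex_of_real r)"
    unfolding fps_conv_radius_def by (rule conv_radius_geI)
  thus rh: "fps_conv_radius h > 1" using r
    by (smt (verit) less_ereal.simps(1) norm_of_real one_ereal_def order_less_le_trans)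
  \<comment> \<open>At 1 the factor 1 - X vanishes, so differentiating the identity gives h(1) =
    \<phi>'(1), the mean of a step.\<close>
  have "fps_deriv ((1 - fps_X) * h) = fps_deriv (1 - ?P)" using eq by simp
  hence d: "fps_deriv ?P = h - (1 - fps_X) * fps_deriv h" by (simp add: algebra_simps)
  have rdh: "fps_conv_radius (fps_deriv h) > 1"
    using rh fps_conv_radius_deriv[of h] by (rule order_less_le_trans)
  have r1: "fps_conv_radius ((1 - fps_X) * fps_deriv h) > 1"
  proof -
    have "1 < min (fps_conv_radius (1 - fps_X :: complex fps)) (fps_conv_radius (fps_deriv h))"
      using rdh fps_conv_radius_one_minus_X by simp
    also have "\<dots> \<le> fps_conv_radius ((1 - fps_X) * fps_deriv h)" by (rule fps_conv_radius_mult)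
    finally show ?thesis .
  qed
  have "eval_fps (fps_deriv ?P) 1 = eval_fps h 1 - eval_fps ((1 - fps_X) * fps_deriv h) 1"
    unfolding d using rh r1 by (intro eval_fps_diff) (auto simp: one_ereal_def)
  also have "eval_fps ((1 - fps_X) * fps_deriv h) 1 = eval_fps (1 - fps_X) 1 * eval_fps (fps_deriv h) 1"
    using rdh fps_conv_radius_one_minus_X by (intro eval_fps_mult) (auto simp: one_ereal_def)
  also have "eval_fps (1 - fps_X) 1 = (0::complex)" by (simp add: eval_fps_diff)
  finally have 1: "eval_fps h 1 = eval_fps (fps_deriv ?P) 1" by simp
  have "(\<lambda>n. pmf p (Suc n) * real (Suc n)) sums \<mu>"
    using \<mu>_sums by (subst sums_Suc_iff) simp
  hence "(\<lambda>n. complex_of_real (pmf p (Suc n) * real (Suc n))) sums of_real \<mu>"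
    by (rule sums_of_real)
  moreover have "(\<lambda>n. complex_of_real (pmf p (Suc n) * real (Suc n))) = (\<lambda>n. fps_nth (fps_deriv ?P) n * 1 ^ n)"
    by (auto simp: mult_ac)
  ultimately have "(\<lambda>n. fps_nth (fps_deriv ?P) n * 1 ^ n) sums of_real \<mu>" by metis
  hence "eval_fps (fps_deriv ?P) 1 = of_real \<mu>" unfolding eval_fps_def by (rule sums_unique[symmetric])
  with 1 show "eval_fps h 1 = of_real \<mu>" by simp
qed

text \<open>The value 1 is an average of the numbers z^n of modulus at most 1, so z^n = 1 throughout
  the support. The multiplicative order of z then divides every element of the support, and
  aperiodicity makes it 1.\<close>

lemma pgf_eq_1_imp:
  fixes z :: complex
  assumes z: "norm z \<le> 1" and eq: "(\<lambda>n. of_real (pmf p n) * z ^ n) sums 1"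
  shows "z = 1"
proof (rule ccontr)
  assume "z \<noteq> 1"
  have "(\<lambda>n. Re (of_real (pmf p n) * z ^ n)) sums Re 1" by (rule sums_Re[OF eq])
  hence "(\<lambda>n. pmf p n - Re (of_real (pmf p n) * z ^ n)) sums (1 - 1)"
    using pmf_nat_sums_1[of p] by (intro sums_diff) auto
  hence 1: "(\<lambda>n. pmf p n * (1 - Re (z ^ n))) sums 0" by (simp add: algebra_simps)
  have Re1: "Re (z ^ n) \<le> 1" for n
    using complex_Re_le_cmod[of "z ^ n"] power_le_one[of "norm z" n] z by (simp add: norm_power)
  have "pmf p n * (1 - Re (z ^ n)) = 0" for n
    using 1 Re1 suminf_eq_zero_iff[of "\<lambda>n. pmf p n * (1 - Re (z ^ n))"]
    by (auto simp: sums_iff)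
  hence supp: "z ^ n = 1" if "pmf p n \<noteq> 0" for n
  proof -
    have re: "Re (z ^ n) = 1" using \<open>pmf p n * (1 - Re (z ^ n)) = 0\<close> that by simp
    have "norm (z ^ n) \<le> 1" using z by (simp add: norm_power power_le_one)
    hence "(Re (z ^ n))\<^sup>2 + (Im (z ^ n))\<^sup>2 \<le> 1" by (metis cmod_power2 abs_norm_cancel abs_square_le_1)
    thus ?thesis using re by (simp add: complex_eq_iff)
  qed
  obtain n0 where n0: "pmf p n0 \<noteq> 0" using aperiodic[of 2] by auto
  hence "n0 > 0" using p0 by (cases n0) auto
  \<comment> \<open>The multiplicative order of z, finite because the support has a positive
    element.\<close>
  define d where "d = (LEAST d. d > 0 \<and> z ^ d = 1)"
  have "n0 > 0 \<and> z ^ n0 = 1" using supp n0 \<open>n0 > 0\<close> by auto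
  hence d: "d > 0 \<and> z ^ d = 1" unfolding d_def by (rule LeastI)
  have least: "d \<le> k" if "k > 0" "z ^ k = 1" for k unfolding d_def using that by (intro Least_le) auto
  have "d \<noteq> 1" using d \<open>z \<noteq> 1\<close> by auto
  hence "d \<ge> 2" using d by linarith
  then obtain n where n: "pmf p n \<noteq> 0" "\<not> d dvd n" using aperiodic by blast
  have "z ^ n = (z ^ d) ^ (n div d) * z ^ (n mod d)"
    by (metis mult_div_mod_eq power_add power_mult)
  hence "z ^ (n mod d) = 1" using supp[OF n(1)] d by simp
  moreover have "n mod d > 0" using n(2) by (simp add: mod_greater_zero_iff_not_dvd)
  ultimately have "d \<le> n mod d" by (intro least)
  thus False using d mod_less_divisor[of d n] by linarith
qed

text \<open>
  If \<open>\<phi>\<close> is the generating function of \<open>p\<close>, then \<open>1 - \<phi> = (1 - X) h\<close> where \<open>h\<close> has no zero in the closed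
  unit disc and \<open>h(1) = \<mu>\<close>; so \<open>u n\<close> is a partial sum of the series of \<open>1 / h\<close> at \<open>1\<close>.
\<close>

lemma u_tendsto: "u \<longlonglongrightarrow> 1 / \<mu>"
proof -
  define h where "h = Abs_fps (\<lambda>j. complex_of_real (1 - (\<Sum>n\<le>j. pmf p n)))"
  let ?P = "Abs_fps (\<lambda>n. complex_of_real (pmf p n))"
  note h = renewal_tail_fps[folded h_def]
  have nz: "eval_fps h z \<noteq> 0" if z: "norm z \<le> 1" for z
  proof (cases "z = 1")
    case True thus ?thesis using h(3) \<mu>_ge_1 by simp
  next
    case False
    have z1: "ereal (norm z) \<le> 1" using z by (simp add: one_ereal_def)
    have zP: "ereal (norm z) < fps_conv_radius ?P" "ereal (norm z) < fps_conv_radius h"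
      using order_le_less_trans[OF z1] h(2,4) by auto
    show ?thesis
    proof
      assume "eval_fps h z = 0"
      hence "eval_fps ((1 - fps_X) * h) z = 0"
        using zP fps_conv_radius_one_minus_X by (subst eval_fps_mult) auto
      hence "eval_fps (1 - ?P) z = 0" using h(1) by simp
      hence "eval_fps ?P z = 1" using zP by (subst (asm) eval_fps_diff) auto
      moreover have "(\<lambda>n. fps_nth ?P n * z ^ n) sums eval_fps ?P z"
        using zP by (intro sums_eval_fps) auto
      ultimately show False using pgf_eq_1_imp[OF z] False by simp
    qed
  qed
  \<comment> \<open>The zeros of h in a slightly larger closed disc form a compact set that misses
    the closed unit disc, so their least modulus exceeds 1. Hence 1/h converges at 1.\<close>
  obtain r where r: "r > 1" "\<And>z. norm z < r \<Longrightarrow> eval_fps h z \<noteq> 0"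
  proof -
    obtain r1 where r1: "1 < ereal r1" "ereal r1 < fps_conv_radius h"
      using ereal_dense2[OF h(2)] by blast
    define S where "S = {z \<in> cball 0 r1. eval_fps h z = 0}"
    have cont: "continuous_on (cball 0 r1) (eval_fps h)"
    proof (rule continuous_on_subset[OF continuous_on_eval_fps])
      have "ereal (norm z) < fps_conv_radius h" if "norm z \<le> r1" for z :: complex
        using that r1(2) by (meson ereal_less_eq(3) order_le_less_trans)
      thus "cball (0 :: complex) r1 \<subseteq> eball 0 (fps_conv_radius h)" by auto
    qed
    have "closed S" unfolding S_def
      using cont by (intro continuous_closed_preimage_constant) auto
    moreover have "bounded S" by (rule bounded_subset[OF bounded_cball[of 0 r1]]) (auto simp: S_def)
    ultimately have "compact S" by (simp add: compact_eq_bounded_closed)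
    show thesis
    proof (cases "S = {}")
      case True
      thus ?thesis using r1 that[of r1] by (auto simp: S_def one_ereal_def)
    next
      case False
      obtain z0 where z0: "z0 \<in> S" "\<And>z. z \<in> S \<Longrightarrow> norm z0 \<le> norm z"
        using continuous_attains_inf[OF \<open>compact S\<close> False, of norm] by (auto intro: continuous_intros)
      have "\<not> norm z0 \<le> 1" using nz[of z0] z0(1) by (auto simp: S_def)
      hence "norm z0 > 1" by simp
      moreover have "eval_fps h z \<noteq> 0" if "norm z < norm z0" for z
      proof
        assume "eval_fps h z = 0"
        moreover have "norm z0 \<le> r1" using z0(1) by (simp add: S_def)
        ultimately have "z \<in> S" using that by (simp add: S_def)
        from z0(2)[OF this] that show False by simp
      qed
      ultimately show ?thesis using that by blast
    qed
  qed
  have nz': "eval_fps h z \<noteq> 0" if "ereal (norm z) < ereal r" for z using r(2) that by simp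
  have rad: "fps_conv_radius (inverse h) > 1"
  proof -
    have "1 < min (ereal r) (fps_conv_radius h)" using r(1) h(2) by (simp add: one_ereal_def)
    also have "\<dots> \<le> fps_conv_radius (inverse h)" by (rule fps_conv_radius_inverse[OF nz'])
    finally show ?thesis .
  qed
  have "eval_fps (inverse h) 1 = inverse (eval_fps h 1)"
    by (rule eval_fps_inverse[where r = "ereal r"])
       (use nz' h(2) r(1) in \<open>auto simp: one_ereal_def\<close>)
  hence ev: "eval_fps (inverse h) 1 = of_real (1 / \<mu>)" by (simp add: h(3) divide_inverse)
  have "(\<lambda>n. fps_nth (inverse h) n * 1 ^ n) sums eval_fps (inverse h) 1"
    using rad by (intro sums_eval_fps) (auto simp: one_ereal_def)
  hence lim: "(\<lambda>n. \<Sum>j\<le>n. fps_nth (inverse h) j) \<longlonglongrightarrow> of_real (1 / \<mu>)"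
    unfolding ev sums_def_le by simp
  define U where "U = Abs_fps (\<lambda>n. complex_of_real (u n))"
  \<comment> \<open>The renewal equation, obtained by conditioning on the first step; the summand
    for n = 0 is the renewal at the origin.\<close>
  have "U * (1 - ?P) = 1"
  proof (rule fps_ext)
    fix n
    have urec: "u n = (if n = 0 then 1 else 0) + (\<Sum>j\<le>n. pmf p j * u (n - j))"
    proof -
      have "u n = (\<Sum>k\<le>Suc n. q k n)" by (rule u_altdef) simp
      also have "\<dots> = q 0 n + (\<Sum>k\<le>n. q (Suc k) n)" by (rule sum.atMost_Suc_shift)
      also have "(\<Sum>k\<le>n. q (Suc k) n) = (\<Sum>j\<le>n. pmf p j * (\<Sum>k\<le>n. q k (n - j)))"
        by (rule sum_q_Suc) auto
      also have "\<dots> = (\<Sum>j\<le>n. pmf p j * u (n - j))"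
        by (intro sum.cong refl arg_cong2[of _ _ _ _ "(*)"] u_altdef[symmetric]) auto
      finally show ?thesis by (simp add: q_0)
    qed
    have "fps_nth (?P * U) n = of_real (\<Sum>j\<le>n. pmf p j * u (n - j))"
      by (simp add: fps_mult_nth U_def atLeast0AtMost)
    also have "\<dots> = of_real (u n) - (if n = 0 then 1 else 0)" by (subst urec) simp
    finally have 1: "fps_nth (?P * U) n = of_real (u n) - (if n = 0 then 1 else 0)" .
    have eq: "U * (1 - ?P) = U - ?P * U" by (simp add: algebra_simps)
    show "fps_nth (U * (1 - ?P)) n = fps_nth 1 n"
      unfolding eq fps_sub_nth 1 by (simp add: U_def)
  qed
  hence "(U * (1 - fps_X)) * h = 1" using h(1) by (simp add: mult_ac)
  hence inv: "inverse h = U * (1 - fps_X)"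
    by (metis fps_inverse_unique mult.commute)
  have part: "(\<Sum>j\<le>n. fps_nth (inverse h) j) = of_real (u n)" for n
  proof (induction n)
    case 0 show ?case unfolding inv by (simp add: U_def algebra_simps)
  next
    case (Suc n)
    have "fps_nth (inverse h) (Suc n) = of_real (u (Suc n)) - of_real (u n)"
      unfolding inv by (simp add: U_def algebra_simps)
    thus ?case using Suc by simp
  qed
  from lim have "(\<lambda>n. complex_of_real (u n)) \<longlonglongrightarrow> of_real (1 / \<mu>)" unfolding part .
  thus ?thesis by (simp only: tendsto_of_real_iff)
qed

end

section \<open>Central limit theorem for the number of renewals\<close>

lemma measure_std_normal_singleton: "measure std_normal_distribution {x} = 0"
proof -
  have "emeasure std_normal_distribution {x} = 0"
    by (subst emeasure_density) (auto simp: nn_integral_indicator_singleton)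
  thus ?thesis by (simp add: measure_def)
qed

text \<open>Weak convergence gives convergence of distribution functions at continuity points of the
  limit; here every point is one.\<close>

lemma isCont_cdf_std_normal: "isCont (cdf std_normal_distribution) x"
proof -
  interpret real_distribution std_normal_distribution by (rule real_dist_normal_dist)
  show ?thesis by (simp add: isCont_cdf measure_std_normal_singleton)
qed

context renewal_law begin

text \<open>P(S_m <= c) for the m-th renewal time S_m. The threshold is real so that centred and
  rescaled values can be inserted directly.\<close>

definition H :: "nat \<Rightarrow> real \<Rightarrow> real" where
  "H m c = (\<Sum>j\<in>{j. real j \<le> c}. q m j)"

lemma finite_real_le: "finite {j. real j \<le> c}"
proof (rule finite_subset)
  show "{j. real j \<le> c} \<subseteq> {..nat \<lceil>c\<rceil>}" by (auto simp: le_nat_iff) linarith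
qed auto

lemma H_mono: "c \<le> c' \<Longrightarrow> H m c \<le> H m c'"
  unfolding H_def by (intro sum_mono2 finite_real_le q_nonneg) auto

text \<open>The central limit theorem concerns independent random variables, whereas q is defined by
  coefficients of powers. The coordinates of an infinite product measure, whose partial sums have
  law q, connect the two.\<close>

lemma iid_sums:
  "\<exists>M :: (nat \<Rightarrow> nat) measure. prob_space M \<and>
    prob_space.indep_vars M (\<lambda>i. borel) (\<lambda>i \<omega>. real (\<omega> i)) UNIV \<and>
    (\<forall>i. distr M (measure_pmf p) (\<lambda>\<omega>. \<omega> i) = measure_pmf p) \<and>
    (\<forall>i. (\<lambda>\<omega>. \<omega> i) \<in> M \<rightarrow>\<^sub>M measure_pmf p) \<and>
    (\<forall>m j. measure M {\<omega> \<in> space M. (\<Sum>i<m. real (\<omega> i)) = real j} = q m j)"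
proof -
  define M where "M = PiM UNIV (\<lambda>_::nat. measure_pmf p)"
  interpret product_prob_space "\<lambda>_::nat. measure_pmf p" UNIV ..
  have M: "prob_space M" unfolding M_def by (rule prob_space_axioms)
  interpret M: prob_space M by (rule M)
  have meas: "(\<lambda>\<omega>. \<omega> i) \<in> M \<rightarrow>\<^sub>M measure_pmf p" for i
    unfolding M_def by (rule measurable_component_singleton) simp
  have distr: "distr M (measure_pmf p) (\<lambda>\<omega>. \<omega> i) = measure_pmf p" for i
    unfolding M_def by (rule PiM_component) simp
  have "M.indep_vars (\<lambda>i. measure_pmf p) (\<lambda>i \<omega>. \<omega> i) UNIV"
  proof (subst M.indep_vars_iff_distr_eq_PiM')
    show "distr M (\<Pi>\<^sub>M i\<in>UNIV. measure_pmf p) (\<lambda>x. \<lambda>i\<in>UNIV. x i) =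
      (\<Pi>\<^sub>M i\<in>UNIV. distr M (measure_pmf p) (\<lambda>\<omega>. \<omega> i))"
      by (simp add: distr restrict_UNIV) (simp add: M_def distr_id2)
  qed (use meas in auto)
  hence indep: "M.indep_vars (\<lambda>i. borel) (\<lambda>i \<omega>. real (\<omega> i)) UNIV"
    by (rule M.indep_vars_compose2) auto
  have [measurable]: "(\<lambda>\<omega>. real (\<omega> i)) \<in> borel_measurable M" for i
    using measurable_compose[OF meas, of real borel] by simp
  have X: "M.prob {\<omega> \<in> space M. real (\<omega> i) = real l} = pmf p l" for i l
  proof -
    have "pmf p l = measure (distr M (measure_pmf p) (\<lambda>\<omega>. \<omega> i)) {l}"
      by (simp add: distr measure_pmf_single)
    also have "\<dots> = M.prob ((\<lambda>\<omega>. \<omega> i) -` {l} \<inter> space M)"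
      using meas by (intro measure_distr) auto
    also have "(\<lambda>\<omega>. \<omega> i) -` {l} \<inter> space M = {\<omega> \<in> space M. real (\<omega> i) = real l}" by auto
    finally show ?thesis ..
  qed
  have "M.prob {\<omega> \<in> space M. (\<Sum>i<m. real (\<omega> i)) = real j} = q m j" for m j
  proof (induction m arbitrary: j)
    case 0 show ?case by (auto simp: q_0 M.prob_space)
  next
    case (Suc m)
    \<comment> \<open>The last step is independent of the sum of the earlier ones, which reproduces
      the convolution in \<open>q_Suc\<close>.\<close>
    have iv: "M.indep_var borel (\<lambda>\<omega>. real (\<omega> m)) borel (\<lambda>\<omega>. \<Sum>i<m. real (\<omega> i))"
      by (intro M.indep_vars_sum M.indep_vars_subset[OF indep]) auto
    have "{\<omega> \<in> space M. (\<Sum>i<Suc m. real (\<omega> i)) = real j} =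
      (\<Union>l\<le>j. {\<omega> \<in> space M. real (\<omega> m) = real l \<and> (\<Sum>i<m. real (\<omega> i)) = real (j - l)})" (is "?A = ?B")
    proof (intro equalityI subsetI)
      fix \<omega> assume \<omega>: "\<omega> \<in> ?A"
      hence "real (\<omega> m + (\<Sum>i<m. \<omega> i)) = real j" by (simp add: add.commute)
      hence "\<omega> m + (\<Sum>i<m. \<omega> i) = j" by (simp only: of_nat_eq_iff)
      thus "\<omega> \<in> ?B" using \<omega> by (auto intro!: bexI[of _ "\<omega> m"] simp flip: of_nat_sum)
    qed (auto simp: of_nat_diff)
    hence "M.prob ?A = M.prob ?B" by simp
    also have "\<dots> = (\<Sum>l\<le>j. M.prob {\<omega> \<in> space M. real (\<omega> m) = real l \<and> (\<Sum>i<m. real (\<omega> i)) = real (j - l)})"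
    proof (rule M.finite_measure_finite_Union)
      have "{\<omega> \<in> space M. real (\<omega> m) = real l \<and> (\<Sum>i<m. real (\<omega> i)) = real (j - l)} \<in> sets M" for l
        by measurable
      thus "(\<lambda>l. {\<omega> \<in> space M. real (\<omega> m) = real l \<and> (\<Sum>i<m. real (\<omega> i)) = real (j - l)}) ` {..j} \<subseteq> sets M"
        by blast
    qed (auto simp: disjoint_family_on_def)
    also have "\<dots> = (\<Sum>l\<le>j. pmf p l * q m (j - l))"
    proof (intro sum.cong refl)
      fix l
      have "M.prob ((\<lambda>\<omega>. (real (\<omega> m), \<Sum>i<m. real (\<omega> i))) -` ({real l} \<times> {real (j - l)}) \<inter> space M) =
         M.prob ((\<lambda>\<omega>. real (\<omega> m)) -` {real l} \<inter> space M) *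
         M.prob ((\<lambda>\<omega>. \<Sum>i<m. real (\<omega> i)) -` {real (j - l)} \<inter> space M)"
        by (intro M.indep_varD[OF iv]) auto
      moreover have "(\<lambda>\<omega>. (real (\<omega> m), \<Sum>i<m. real (\<omega> i))) -` ({real l} \<times> {real (j - l)}) \<inter> space M =
        {\<omega> \<in> space M. real (\<omega> m) = real l \<and> (\<Sum>i<m. real (\<omega> i)) = real (j - l)}" by auto
      moreover have "(\<lambda>\<omega>. real (\<omega> m)) -` {real l} \<inter> space M = {\<omega> \<in> space M. real (\<omega> m) = real l}" by auto
      moreover have "(\<lambda>\<omega>. \<Sum>i<m. real (\<omega> i)) -` {real (j - l)} \<inter> space M =
         {\<omega> \<in> space M. (\<Sum>i<m. real (\<omega> i)) = real (j - l)}" by auto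
      ultimately show "M.prob {\<omega> \<in> space M. real (\<omega> m) = real l \<and> (\<Sum>i<m. real (\<omega> i)) = real (j - l)} = pmf p l * q m (j - l)"
        by (simp only: X Suc)
    qed
    also have "\<dots> = q (Suc m) j" by (simp add: q_Suc)
    finally show ?case .
  qed
  with M indep distr meas show ?thesis by blast
qed

lemma H_eq_prob:
  assumes "prob_space M" "\<And>i. (\<lambda>\<omega>. \<omega> i) \<in> M \<rightarrow>\<^sub>M measure_pmf p"
    "\<And>m j. measure M {\<omega> \<in> space M. (\<Sum>i<m. real (\<omega> i)) = real j} = q m j"
  shows "H m c = measure M {\<omega> \<in> space M. (\<Sum>i<m. real (\<omega> i)) \<le> c}"
proof -
  interpret M: prob_space M by (rule assms)
  have [measurable]: "(\<lambda>\<omega>. real (\<omega> i)) \<in> borel_measurable M" for i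
    using measurable_compose[OF assms(2), of real borel] by simp
  have "{\<omega> \<in> space M. (\<Sum>i<m. real (\<omega> i)) \<le> c} =
    (\<Union>j\<in>{j. real j \<le> c}. {\<omega> \<in> space M. (\<Sum>i<m. real (\<omega> i)) = real j})" (is "?A = ?B")
  proof (intro equalityI subsetI)
    fix \<omega> assume "\<omega> \<in> ?A"
    thus "\<omega> \<in> ?B" by (auto intro!: exI[of _ "\<Sum>i<m. \<omega> i"])
  qed auto
  also have "M.prob \<dots> = (\<Sum>j\<in>{j. real j \<le> c}. M.prob {\<omega> \<in> space M. (\<Sum>i<m. real (\<omega> i)) = real j})"
    by (intro M.finite_measure_finite_Union finite_real_le) (auto simp: disjoint_family_on_def)
  finally show ?thesis using assms by (simp add: H_def)
qed

lemma H_le_1: "H m c \<le> 1"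
proof -
  obtain M :: "(nat \<Rightarrow> nat) measure" where M: "prob_space M"
    "prob_space.indep_vars M (\<lambda>i. borel) (\<lambda>i \<omega>. real (\<omega> i)) UNIV"
    "\<And>i. distr M (measure_pmf p) (\<lambda>\<omega>. \<omega> i) = measure_pmf p"
    "\<And>i. (\<lambda>\<omega>. \<omega> i) \<in> M \<rightarrow>\<^sub>M measure_pmf p"
    "\<And>m j. measure M {\<omega> \<in> space M. (\<Sum>i<m. real (\<omega> i)) = real j} = q m j"
    using iid_sums by blast
  show ?thesis unfolding H_eq_prob[OF M(1,4,5)] using prob_space.prob_le_1[OF M(1)] by blast
qed

lemma integrable_square: "integrable (measure_pmf p) (\<lambda>n. (real n)\<^sup>2)"
  unfolding integrable_pmf_nat_iff using summable_square by simp

lemma H_clt: "(\<lambda>m. H m (real m * \<mu> + y * \<sigma> * sqrt m)) \<longlonglongrightarrow> cdf std_normal_distribution y"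
proof -
  obtain M :: "(nat \<Rightarrow> nat) measure" where M: "prob_space M"
    "prob_space.indep_vars M (\<lambda>i. borel) (\<lambda>i \<omega>. real (\<omega> i)) UNIV"
    "\<And>i. distr M (measure_pmf p) (\<lambda>\<omega>. \<omega> i) = measure_pmf p"
    "\<And>i. (\<lambda>\<omega>. \<omega> i) \<in> M \<rightarrow>\<^sub>M measure_pmf p"
    "\<And>m j. measure M {\<omega> \<in> space M. (\<Sum>i<m. real (\<omega> i)) = real j} = q m j"
    using iid_sums by blast
  interpret M: prob_space M by (rule M)
  have [measurable]: "(\<lambda>\<omega>. real (\<omega> i)) \<in> borel_measurable M" for i
    using measurable_compose[OF M(4), of real borel] by simp
  have int: "(\<integral>\<omega>. f (\<omega> i) \<partial>M) = measure_pmf.expectation p f" for f :: "nat \<Rightarrow> real" and i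
    using integral_distr[OF M(4), of f i] by (simp add: M(3))
  have "weak_conv_m (\<lambda>n. distr M borel (\<lambda>x. (\<Sum>i<n. real (x i) - \<mu>) / sqrt (real n * \<sigma>\<^sup>2))) std_normal_distribution"
  proof (rule M.central_limit_theorem[where \<mu> = "distr (measure_pmf p) borel real"])
    show "M.expectation (\<lambda>\<omega>. real (\<omega> i)) = \<mu>" for i by (simp add: int \<mu>_def)
    show "M.variance (\<lambda>\<omega>. real (\<omega> i)) = \<sigma>\<^sup>2" for i
      using variance_pos by (simp add: int int[of "\<lambda>n. (real n - _)\<^sup>2"] \<sigma>_def)
    show "integrable M (\<lambda>\<omega>. (real (\<omega> i))\<^sup>2)" for i
      using integrable_distr_eq[OF M(4), of "\<lambda>n. (real n)\<^sup>2" i] integrable_square by (simp add: M(3))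
    show "distr M borel (\<lambda>\<omega>. real (\<omega> i)) = distr (measure_pmf p) borel real" for i
      by (subst M(3)[of i, symmetric], subst distr_distr) (use M(4) in \<open>auto simp: o_def\<close>)
  qed (use M \<sigma>_pos in auto)
  hence "(\<lambda>m. cdf (distr M borel (\<lambda>x. (\<Sum>i<m. real (x i) - \<mu>) / sqrt (real m * \<sigma>\<^sup>2))) y)
     \<longlonglongrightarrow> cdf std_normal_distribution y"
    unfolding weak_conv_m_def weak_conv_def using isCont_cdf_std_normal by blast
  moreover have "eventually (\<lambda>m. cdf (distr M borel (\<lambda>x. (\<Sum>i<m. real (x i) - \<mu>) / sqrt (real m * \<sigma>\<^sup>2))) y =
     H m (real m * \<mu> + y * \<sigma> * sqrt m)) at_top"
    using eventually_gt_at_top[of 0]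
  proof eventually_elim
    case (elim m)
    have "cdf (distr M borel (\<lambda>x. (\<Sum>i<m. real (x i) - \<mu>) / sqrt (real m * \<sigma>\<^sup>2))) y =
      M.prob ((\<lambda>x. (\<Sum>i<m. real (x i) - \<mu>) / sqrt (real m * \<sigma>\<^sup>2)) -` {..y} \<inter> space M)"
      unfolding cdf_def by (intro measure_distr) auto
    also have "(\<lambda>x. (\<Sum>i<m. real (x i) - \<mu>) / sqrt (real m * \<sigma>\<^sup>2)) -` {..y} \<inter> space M =
      {\<omega> \<in> space M. (\<Sum>i<m. real (\<omega> i)) \<le> real m * \<mu> + y * \<sigma> * sqrt m}"
      using elim \<sigma>_pos by (auto simp: real_sqrt_mult sum_subtractf field_simps)
    finally show ?case using H_eq_prob[OF M(1,4,5)] by simp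
  qed
  ultimately show ?thesis by (rule Lim_transform_eventually)
qed


text \<open>The reciprocal of \<sigma> \<mu>^(-3/2), the limiting standard deviation of the rescaled
  core-size.\<close>

definition \<tau> :: real where "\<tau> = \<mu> * sqrt \<mu> / \<sigma>"

lemma \<tau>_pos: "\<tau> > 0"
  using \<mu>_ge_1 \<sigma>_pos by (simp add: \<tau>_def)

text \<open>For m = n/\<mu> + x sqrt n the threshold n lies about x \<mu> sqrt n below the mean m
  \<mu>; divided by \<sigma> sqrt (n/\<mu>) this is -x \<tau>. The slack in c, of size o(sqrt n), is
  used later to discard a bounded window below n.\<close>

lemma H_tendsto:
  assumes m: "(\<lambda>n. (real (m n) - real n / \<mu>) / sqrt n) \<longlonglongrightarrow> x"
    and c: "(\<lambda>n. (c n - real n) / sqrt n) \<longlonglongrightarrow> 0"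
  shows "(\<lambda>n. H (m n) (c n)) \<longlonglongrightarrow> cdf std_normal_distribution (- x * \<tau>)"
proof -
  let ?\<Phi> = "cdf std_normal_distribution"
  have \<mu>: "\<mu> > 0" using \<mu>_ge_1 by simp
  have inv: "(\<lambda>n. 1 / sqrt (real n)) \<longlonglongrightarrow> 0" by real_asymp
  have "(\<lambda>n. 1 / \<mu> + (real (m n) - real n / \<mu>) / sqrt n * (1 / sqrt n)) \<longlonglongrightarrow> 1 / \<mu> + x * 0"
    by (intro tendsto_intros m inv)
  moreover have "eventually (\<lambda>n. 1 / \<mu> + (real (m n) - real n / \<mu>) / sqrt n * (1 / sqrt n) = real (m n) / real n) at_top"
    using eventually_gt_at_top[of 0] by eventually_elim (use \<mu> in \<open>simp add: field_simps\<close>)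
  ultimately have mn: "(\<lambda>n. real (m n) / real n) \<longlonglongrightarrow> 1 / \<mu>"
    by (simp add: Lim_transform_eventually)
  have "filterlim (\<lambda>n. real (m n) / real n * real n) at_top at_top"
    using \<mu> by (intro filterlim_tendsto_pos_mult_at_top[OF mn] filterlim_real_sequentially) auto
  moreover have "eventually (\<lambda>n. real (m n) / real n * real n = real (m n)) at_top"
    using eventually_gt_at_top[of 0] by eventually_elim simp
  ultimately have "filterlim (\<lambda>n. real (m n)) at_top at_top"
    by (simp cong: filterlim_cong)
  hence m_top: "filterlim m at_top at_top"
    by (simp add: filterlim_sequentially_iff_filterlim_real)
  define y where "y = (\<lambda>n. (c n - real (m n) * \<mu>) / (\<sigma> * sqrt (m n)))"
  define y0 where "y0 = - x * \<tau>"
  have "(\<lambda>n. ((c n - real n) / sqrt n - \<mu> * ((real (m n) - real n / \<mu>) / sqrt n)) * sqrt (inverse (real (m n) / real n)) / \<sigma>)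
     \<longlonglongrightarrow> (0 - \<mu> * x) * sqrt (inverse (1 / \<mu>)) / \<sigma>"
    using \<mu> \<sigma>_pos by (intro tendsto_intros m c mn) auto
  also have "(0 - \<mu> * x) * sqrt (inverse (1 / \<mu>)) / \<sigma> = y0" by (simp add: y0_def \<tau>_def)
  finally have "(\<lambda>n. ((c n - real n) / sqrt n - \<mu> * ((real (m n) - real n / \<mu>) / sqrt n)) * sqrt (inverse (real (m n) / real n)) / \<sigma>)
     \<longlonglongrightarrow> y0" .
  moreover have ev_pos: "eventually (\<lambda>n. n > 0 \<and> m n > 0) at_top"
    using eventually_gt_at_top[of 0] m_top[unfolded filterlim_at_top, rule_format, of 1]
    by eventually_elim simp
  hence "eventually (\<lambda>n. ((c n - real n) / sqrt n - \<mu> * ((real (m n) - real n / \<mu>) / sqrt n)) * sqrt (inverse (real (m n) / real n)) / \<sigma> = y n) at_top"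
  proof eventually_elim
    case (elim n)
    have "(c n - real n) / sqrt n - \<mu> * ((real (m n) - real n / \<mu>) / sqrt n) = (c n - real (m n) * \<mu>) / sqrt n"
      using \<mu> elim by (simp add: field_simps)
    moreover have "sqrt (inverse (real (m n) / real n)) = sqrt n / sqrt (m n)"
      by (simp add: real_sqrt_divide)
    ultimately show ?case using elim by (simp add: y_def mult_ac)
  qed
  ultimately have y: "y \<longlonglongrightarrow> y0" by (rule Lim_transform_eventually)
  have Hy: "eventually (\<lambda>n. c n = real (m n) * \<mu> + y n * \<sigma> * sqrt (m n)) at_top"
    using ev_pos by eventually_elim (use \<sigma>_pos in \<open>simp add: y_def\<close>)
  have lim: "(\<lambda>n. H (m n) (real (m n) * \<mu> + y' * \<sigma> * sqrt (m n))) \<longlonglongrightarrow> ?\<Phi> y'" for y'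
    by (rule filterlim_compose[OF H_clt m_top])
  have cmp: "real (m n) * \<mu> + a * \<sigma> * sqrt (m n) \<le> real (m n) * \<mu> + b * \<sigma> * sqrt (m n)" if "a \<le> b" for a b n
    using that \<sigma>_pos by (intro add_left_mono mult_right_mono) auto
  \<comment> \<open>The argument y n moves with n, while the central limit theorem is for a fixed
    one. Monotonicity of H and continuity of the limit allow squeezing between fixed arguments close
    to y0.\<close>
  have "(\<lambda>n. H (m n) (c n)) \<longlonglongrightarrow> ?\<Phi> y0"
  proof (rule order_tendstoI)
    fix a assume a: "a < ?\<Phi> y0"
    have "(?\<Phi> \<longlongrightarrow> ?\<Phi> y0) (at_left y0)"
      using isCont_cdf_std_normal[of y0] by (simp add: isCont_def filterlim_at_split)
    from order_tendstoD(1)[OF this a]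
    have "eventually (\<lambda>y'. ?\<Phi> y' > a \<and> y' < y0) (at_left y0)"
      by (rule eventually_conj) (auto simp: eventually_at_filter)
    then obtain y1 where y1: "?\<Phi> y1 > a" "y1 < y0"
      using eventually_happens'[OF trivial_limit_at_left_real] by blast
    have "eventually (\<lambda>n. H (m n) (real (m n) * \<mu> + y1 * \<sigma> * sqrt (m n)) > a) at_top"
      using lim y1 by (intro order_tendstoD)
    moreover have "eventually (\<lambda>n. y n > y1) at_top" using y y1 by (intro order_tendstoD)
    ultimately show "eventually (\<lambda>n. H (m n) (c n) > a) at_top" using Hy
    proof eventually_elim
      case (elim n)
      thus ?case using H_mono[OF cmp[of y1 "y n" n], of "m n"] by simp
    qed
  next
    fix a assume a: "a > ?\<Phi> y0"
    have "(?\<Phi> \<longlongrightarrow> ?\<Phi> y0) (at_right y0)"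
      using isCont_cdf_std_normal[of y0] by (simp add: isCont_def filterlim_at_split)
    from order_tendstoD(2)[OF this a]
    have "eventually (\<lambda>y'. ?\<Phi> y' < a \<and> y' > y0) (at_right y0)"
      by (rule eventually_conj) (auto simp: eventually_at_filter)
    then obtain y1 where y1: "?\<Phi> y1 < a" "y1 > y0"
      using eventually_happens'[OF trivial_limit_at_right_real] by blast
    have "eventually (\<lambda>n. H (m n) (real (m n) * \<mu> + y1 * \<sigma> * sqrt (m n)) < a) at_top"
      using lim y1 by (intro order_tendstoD)
    moreover have "eventually (\<lambda>n. y n < y1) at_top" using y y1 by (intro order_tendstoD)
    ultimately show "eventually (\<lambda>n. H (m n) (c n) < a) at_top" using Hy
    proof eventually_elim
      case (elim n)
      thus ?case using H_mono[OF cmp[of "y n" y1 n], of "m n"] by simp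
    qed
  qed
  thus ?thesis by (simp add: y0_def)
qed

text \<open>In the convolution identity u (n - j) may be replaced by 1/\<mu>: the error is small
  once n - j >= N, and the window of the last N values of j carries vanishing mass, because H has
  the same limit at n and at n - N.\<close>

lemma sum_q_atLeast_tendsto:
  assumes m: "(\<lambda>n. (real (m n) - real n / \<mu>) / sqrt n) \<longlonglongrightarrow> x"
  shows "(\<lambda>n. \<Sum>k=m n..n. q k n) \<longlonglongrightarrow> cdf std_normal_distribution (- x * \<tau>) / \<mu>"
proof -
  have \<mu>: "\<mu> > 0" using \<mu>_ge_1 by simp
  have H0: "(\<lambda>n. H (m n) (real n)) \<longlonglongrightarrow> cdf std_normal_distribution (- x * \<tau>)"
    by (rule H_tendsto[OF m]) simp
  have "(\<lambda>n. (\<Sum>k=m n..n. q k n) - H (m n) (real n) / \<mu>) \<longlonglongrightarrow> 0"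
  proof (rule LIMSEQ_I)
    fix \<epsilon> :: real assume \<epsilon>: "\<epsilon> > 0"
    obtain N where N: "\<And>i. i \<ge> N \<Longrightarrow> norm (u i - 1 / \<mu>) < \<epsilon> / 2"
      using LIMSEQ_D[OF u_tendsto, of "\<epsilon> / 2"] \<epsilon> by auto
    have "(\<lambda>n. ((real n - real N) - real n) / sqrt n) \<longlonglongrightarrow> 0" by real_asymp
    hence "(\<lambda>n. H (m n) (real n) - H (m n) (real n - real N)) \<longlonglongrightarrow>
       cdf std_normal_distribution (- x * \<tau>) - cdf std_normal_distribution (- x * \<tau>)"
      by (intro tendsto_diff H0 H_tendsto[OF m])
    hence "eventually (\<lambda>n. H (m n) (real n) - H (m n) (real n - real N) < \<epsilon> / 2) at_top"
      using \<epsilon> by (intro order_tendstoD) auto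
    hence "eventually (\<lambda>n. norm ((\<Sum>k=m n..n. q k n) - H (m n) (real n) / \<mu> - 0) < \<epsilon>) at_top"
    proof eventually_elim
      case (elim n)
      let ?J = "{j. real j \<le> real n - real N}"
      have Hn: "H (m n) (real n) = (\<Sum>j\<le>n. q (m n) j)"
        unfolding H_def by (intro sum.cong) auto
      have sub: "?J \<subseteq> {..n}" by auto
      have diff: "H (m n) (real n) - H (m n) (real n - real N) = (\<Sum>j\<in>{..n}-?J. q (m n) j)"
        unfolding Hn unfolding H_def using sub by (subst sum_diff) auto
      have "(\<Sum>k=m n..n. q k n) - H (m n) (real n) / \<mu> = (\<Sum>j\<le>n. q (m n) j * (u (n - j) - 1 / \<mu>))"
        unfolding sum_q_atLeast_convolution Hn sum_divide_distrib
        by (simp add: sum_subtractf right_diff_distrib)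
      also have "norm \<dots> \<le> (\<Sum>j\<le>n. q (m n) j * \<bar>u (n - j) - 1 / \<mu>\<bar>)"
        by (rule order.trans[OF norm_sum]) (simp add: abs_mult q_nonneg)
      also have "\<dots> = (\<Sum>j\<in>?J. q (m n) j * \<bar>u (n - j) - 1 / \<mu>\<bar>) + (\<Sum>j\<in>{..n}-?J. q (m n) j * \<bar>u (n - j) - 1 / \<mu>\<bar>)"
        using sum.subset_diff[OF sub, of "\<lambda>j. q (m n) j * \<bar>u (n - j) - 1 / \<mu>\<bar>"] by simp
      also have "(\<Sum>j\<in>?J. q (m n) j * \<bar>u (n - j) - 1 / \<mu>\<bar>) \<le> (\<Sum>j\<in>?J. q (m n) j * (\<epsilon> / 2))"
      proof (intro sum_mono mult_left_mono q_nonneg)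
        fix j assume "j \<in> ?J"
        hence "n - j \<ge> N" by simp
        from N[OF this] show "\<bar>u (n - j) - 1 / \<mu>\<bar> \<le> \<epsilon> / 2" by simp
      qed
      also have "\<dots> = H (m n) (real n - real N) * (\<epsilon> / 2)" by (simp add: H_def sum_distrib_right)
      also have "\<dots> \<le> \<epsilon> / 2" using \<epsilon> H_le_1 by (simp add: mult_left_le_one_le H_def q_nonneg sum_nonneg)
      also have "(\<Sum>j\<in>{..n}-?J. q (m n) j * \<bar>u (n - j) - 1 / \<mu>\<bar>) \<le> (\<Sum>j\<in>{..n}-?J. q (m n) j * 1)"
      proof (intro sum_mono mult_left_mono q_nonneg)
        fix j
        have "0 \<le> u (n - j)" "u (n - j) \<le> 1" by (rule u_nonneg u_le_1)+
        moreover have "0 \<le> 1 / \<mu>" "1 / \<mu> \<le> 1" using \<mu>_ge_1 by auto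
        ultimately show "\<bar>u (n - j) - 1 / \<mu>\<bar> \<le> 1" by linarith
      qed
      also have "\<dots> < \<epsilon> / 2" using elim diff by simp
      finally show ?case by simp
    qed
    thus "\<exists>no. \<forall>n\<ge>no. norm ((\<Sum>k=m n..n. q k n) - H (m n) (real n) / \<mu> - 0) < \<epsilon>"
      by (simp add: eventually_at_top_linorder)
  qed
  from tendsto_add[OF this tendsto_divide[OF H0 tendsto_const[of \<mu>]]] show ?thesis
    using \<mu> by simp
qed

text \<open>
  Chernoff's bound at \<open>exp (\<plusminus>1 / sqrt n)\<close>: the quadratic term of the exponent stays bounded because
  \<open>m \<le> n\<close>.
\<close>

lemma q_tail_bounds:
  obtains K n0 where "K > 0" "n0 > 0"
    "\<And>n m. n \<ge> n0 \<Longrightarrow> (\<Sum>k\<le>m. q k n) \<le> K * exp (- (real n - real m * \<mu>) / sqrt n)"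
    "\<And>n m. n \<ge> n0 \<Longrightarrow> (\<Sum>k=m..n. q k n) \<le> K * exp (- (real m * \<mu> - real n) / sqrt n)"
proof -
  obtain C l where C: "C \<ge> 0" "l > 0" "exp l \<le> R" "\<And>t. \<bar>t\<bar> \<le> l \<Longrightarrow> G (exp t) \<le> exp (\<mu> * t + C * t\<^sup>2)"
    using G_exp_le by blast
  have "eventually (\<lambda>n. 1 / sqrt (real n) < l) at_top"
    using \<open>l > 0\<close> by (intro order_tendstoD(2)[where y = 0]) real_asymp+
  then obtain n1 where n1: "\<And>n. n \<ge> n1 \<Longrightarrow> 1 / sqrt (real n) < l"
    by (auto simp: eventually_at_top_linorder)
  define n0 where "n0 = max n1 1"
  have pow: "G (exp t) ^ m \<le> exp C * exp (real m * \<mu> * t)" if "t = 1 / sqrt n \<or> t = - 1 / sqrt n" "n \<ge> n0" "m \<le> n" for n m t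
  proof -
    have n: "n > 0" using that by (simp add: n0_def)
    have t: "\<bar>t\<bar> \<le> l" using that(1) n1[of n] that(2) by (auto simp: n0_def)
    have t2: "t\<^sup>2 = 1 / real n" using that(1) n by (auto simp: power_divide)
    have "exp t \<le> exp l" using t by simp
    hence "exp t \<le> R" using C(3) by (rule order.trans)
    hence "0 \<le> G (exp t)" by (intro G_nonneg) auto
    hence "G (exp t) ^ m \<le> exp (\<mu> * t + C * t\<^sup>2) ^ m" using C(4)[OF t] by (intro power_mono)
    also have "\<dots> = exp (C * (real m / real n)) * exp (real m * \<mu> * t)"
      by (simp add: t2 exp_of_nat_mult[symmetric] exp_add[symmetric] algebra_simps)
    also have "\<dots> \<le> exp C * exp (real m * \<mu> * t)"
      using C(1) that(3) n by (intro mult_right_mono) (auto simp: divide_le_eq mult_left_mono)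
    finally show ?thesis .
  qed
  show thesis
  proof (rule that[of "exp C" n0])
    fix n m :: nat assume n: "n \<ge> n0"
    hence "n > 0" by (simp add: n0_def)
    define t where "t = 1 / sqrt n"
    have t: "0 < t" "t \<le> l" using n n1[of n] \<open>n > 0\<close> by (auto simp: t_def n0_def)
    have expR: "exp t \<le> R" using t(2) by (intro order.trans[OF _ C(3)]) simp
    show "(\<Sum>k\<le>m. q k n) \<le> exp C * exp (- (real n - real m * \<mu>) / sqrt n)"
    proof (cases "m \<le> n")
      case True
      have "(\<Sum>k\<le>m. q k n) * exp t ^ n \<le> G (exp t) ^ m"
        using t expR by (intro sum_q_atMost_chernoff) auto
      also have "\<dots> \<le> exp C * exp (real m * \<mu> * t)"
        using n True by (intro pow) (auto simp: t_def)
      finally have "(\<Sum>k\<le>m. q k n) \<le> exp C * exp (real m * \<mu> * t) / exp (real n * t)"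
        by (simp add: field_simps exp_of_nat_mult[symmetric])
      also have "exp (real m * \<mu> * t) = exp (- (real n - real m * \<mu>) / sqrt n) * exp (real n * t)"
        by (simp add: exp_add[symmetric] t_def diff_divide_distrib)
      finally show ?thesis by simp
    next
      case False
      \<comment> \<open>For m > n the exponent is nonnegative because \<mu> >= 1, so the trivial
        bound 1 suffices.\<close>
      have "real n * 1 \<le> real m * \<mu>" using False \<mu>_ge_1 by (intro mult_mono) auto
      hence "0 \<le> - (real n - real m * \<mu>) / sqrt n" by simp
      hence "1 * 1 \<le> exp C * exp (- (real n - real m * \<mu>) / sqrt n)"
        using C(1) by (intro mult_mono) auto
      thus ?thesis using sum_q_le_1[of n m] by linarith
    qed
    show "(\<Sum>k=m..n. q k n) \<le> exp C * exp (- (real m * \<mu> - real n) / sqrt n)"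
    proof (cases "m \<le> n")
      case True
      have "(\<Sum>k=m..n. q k n) * exp (- t) ^ n \<le> G (exp (- t)) ^ m"
        using t by (intro sum_q_atLeast_chernoff) auto
      also have "\<dots> \<le> exp C * exp (real m * \<mu> * (- t))"
        using n True by (intro pow) (auto simp: t_def)
      finally have "(\<Sum>k=m..n. q k n) \<le> exp C * exp (- (real m * \<mu> * t)) / exp (- (real n * t))"
        by (simp add: field_simps exp_of_nat_mult[symmetric])
      also have "exp (- (real m * \<mu> * t)) = exp (- (real m * \<mu> - real n) / sqrt n) * exp (- (real n * t))"
        by (simp add: exp_add[symmetric] t_def diff_divide_distrib)
      finally show ?thesis by simp
    qed auto
  qed (auto simp: n0_def)
qed

end

section \<open>First moments of the rescaled core-size, integrated from tail probabilities\<close>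

lemma layer_cake:
  fixes N :: "real measure" and f :: "real \<Rightarrow> real"
  assumes "prob_space N" "sets N = sets borel" and f: "integrable N f" "\<And>y. f y \<ge> 0"
  shows "(\<integral>x. indicator {0<..} x * measure N {y. x \<le> f y} \<partial>lborel) = (\<integral>y. f y \<partial>N)"
proof -
  interpret N: prob_space N by (rule assms)
  interpret pair_sigma_finite lborel N ..
  have sp: "space N = UNIV" using sets_eq_imp_space_eq[OF assms(2)] by simp
  have [measurable]: "f \<in> borel_measurable N" using f by simp
  have fb[measurable]: "f \<in> borel_measurable borel"
    using measurable_cong_sets[OF assms(2) refl, of borel] \<open>f \<in> borel_measurable N\<close> by blast
  have m: "emeasure N {y. x \<le> f y} = ennreal (measure N {y. x \<le> f y})" for x
    by (rule N.emeasure_eq_measure)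
  have meas: "(\<lambda>x. measure N {y. x \<le> f y}) \<in> borel_measurable lborel"
  proof -
    have "(\<lambda>x. emeasure N (Pair x -` {z. fst z \<le> f (snd z)})) \<in> borel_measurable lborel"
    proof (rule N.measurable_emeasure_Pair)
      have "{z \<in> space (lborel \<Otimes>\<^sub>M N). fst z \<le> f (snd z)} \<in> sets (lborel \<Otimes>\<^sub>M N)" by measurable
      thus "{z. fst z \<le> f (snd z)} \<in> sets (lborel \<Otimes>\<^sub>M N)" by (simp add: space_pair_measure sp)
    qed
    hence "(\<lambda>x. enn2real (emeasure N (Pair x -` {z. fst z \<le> f (snd z)}))) \<in> borel_measurable lborel"
      by measurable
    thus ?thesis by (simp add: vimage_def measure_def)
  qed
  have "(\<integral>\<^sup>+x. ennreal (indicator {0<..} x * measure N {y. x \<le> f y}) \<partial>lborel) =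
        (\<integral>\<^sup>+x. (\<integral>\<^sup>+y. indicator {0<..f y} x \<partial>N) \<partial>lborel)"
  proof (rule nn_integral_cong)
    fix x :: real
    have "(\<integral>\<^sup>+y. indicator {0<..f y} x \<partial>N) = (\<integral>\<^sup>+y. indicator {0<..} x * indicator {y. x \<le> f y} y \<partial>N)"
      by (intro nn_integral_cong) (auto simp: indicator_def)
    also have "\<dots> = indicator {0<..} x * emeasure N {y. x \<le> f y}"
    proof -
      have "{y \<in> space N. x \<le> f y} \<in> sets N" by measurable
      hence "{y. x \<le> f y} \<in> sets N" by (simp add: sp)
      thus ?thesis by (subst nn_integral_cmult) auto
    qed
    finally show "ennreal (indicator {0<..} x * measure N {y. x \<le> f y}) = (\<integral>\<^sup>+y. indicator {0<..f y} x \<partial>N)"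
      by (simp add: m indicator_def)
  qed
  also have "\<dots> = (\<integral>\<^sup>+y. (\<integral>\<^sup>+x. indicator {0<..f y} x \<partial>lborel) \<partial>N)"
  proof (rule Fubini'[symmetric])
    have "(\<lambda>(x, y). indicator {z. 0 < fst z \<and> fst z \<le> f (snd z)} (x, y) :: ennreal) \<in> borel_measurable (lborel \<Otimes>\<^sub>M N)"
    proof -
      have "{z \<in> space (lborel \<Otimes>\<^sub>M N). 0 < fst z \<and> fst z \<le> f (snd z)} \<in> sets (lborel \<Otimes>\<^sub>M N)" by measurable
      hence "{z. 0 < fst z \<and> fst z \<le> f (snd z)} \<in> sets (lborel \<Otimes>\<^sub>M N)" by (simp add: space_pair_measure sp)
      thus ?thesis by simp
    qed
    also have "(\<lambda>(x, y). indicator {z. 0 < fst z \<and> fst z \<le> f (snd z)} (x, y) :: ennreal) = (\<lambda>(x, y). indicator {0<..f y} x)"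
      by (auto simp: indicator_def)
    finally show "(\<lambda>(x, y). indicator {0<..f y} x :: ennreal) \<in> borel_measurable (lborel \<Otimes>\<^sub>M N)" .
  qed
  also have "\<dots> = (\<integral>\<^sup>+y. ennreal (f y) \<partial>N)"
    using f(2) by (intro nn_integral_cong) simp
  finally have eq: "(\<integral>\<^sup>+x. ennreal (indicator {0<..} x * measure N {y. x \<le> f y}) \<partial>lborel) = (\<integral>\<^sup>+y. ennreal (f y) \<partial>N)" .
  have "(\<integral>x. indicator {0<..} x * measure N {y. x \<le> f y} \<partial>lborel) =
     enn2real (\<integral>\<^sup>+x. ennreal (indicator {0<..} x * measure N {y. x \<le> f y}) \<partial>lborel)"
    using meas by (intro integral_eq_nn_integral) auto
  also have "\<dots> = enn2real (\<integral>\<^sup>+y. ennreal (f y) \<partial>N)" by (simp only: eq)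
  also have "\<dots> = (\<integral>y. f y \<partial>N)"
    using f by (intro integral_eq_nn_integral[symmetric]) auto
  finally show ?thesis .
qed

text \<open>Stated for a of either sign so that it serves both the positive and the negative part of
  X.\<close>

lemma std_normal_positive_part:
  shows "integrable std_normal_distribution (\<lambda>y. max 0 (a * y))"
    and "(\<integral>y. max 0 (a * y) \<partial>std_normal_distribution) = \<bar>a\<bar> / sqrt (2 * pi)"
proof -
  have 0: "has_bochner_integral lborel (\<lambda>x. std_normal_density x * x) 0"
    using std_normal_moment_odd[of 0] by simp
  have 1: "has_bochner_integral lborel (\<lambda>x. std_normal_density x * \<bar>x\<bar>) (sqrt (2 / pi))"
    using std_normal_moment_abs_odd[of 0] by simp
  have I: "integrable std_normal_distribution (\<lambda>y. y)"
    using 0 by (subst integrable_density) (auto simp: has_bochner_integral_iff)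
  have i0: "(\<integral>y. y \<partial>std_normal_distribution) = 0"
    using 0 by (subst integral_density) (auto simp: has_bochner_integral_iff)
  have i1: "(\<integral>y. \<bar>y\<bar> \<partial>std_normal_distribution) = sqrt (2 / pi)"
    using 1 by (subst integral_density) (auto simp: has_bochner_integral_iff)
  have eq: "max 0 (a * y) = \<bar>a\<bar> / 2 * \<bar>y\<bar> + a / 2 * y" for y
  proof -
    have "max 0 t = (\<bar>t\<bar> + t) / 2" for t :: real by auto
    thus ?thesis by (simp add: abs_mult add_divide_distrib)
  qed
  show "integrable std_normal_distribution (\<lambda>y. max 0 (a * y))"
    unfolding eq using I by auto
  have "(\<integral>y. max 0 (a * y) \<partial>std_normal_distribution) = \<bar>a\<bar> / 2 * (\<integral>y. \<bar>y\<bar> \<partial>std_normal_distribution) + a / 2 * (\<integral>y. y \<partial>std_normal_distribution)"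
    unfolding eq using I by (subst Bochner_Integration.integral_add) auto
  hence "(\<integral>y. max 0 (a * y) \<partial>std_normal_distribution) = \<bar>a\<bar> * (sqrt (2 / pi) / 2)"
    by (simp add: i0 i1)
  also have "sqrt (2 / pi) / 2 = 1 / sqrt (2 * pi)"
    by (simp add: real_sqrt_divide real_sqrt_mult field_simps)
  finally show "(\<integral>y. max 0 (a * y) \<partial>std_normal_distribution) = \<bar>a\<bar> / sqrt (2 * pi)"
    by simp
qed

lemma integral_indicator_greaterThanAtMost:
  "(\<integral>x. indicator {0<..a} x \<partial>lborel) = max 0 (a :: real)"
  by (cases "a \<ge> 0") auto

lemma integral_sum_indicator_greaterThanAtMost:
  "(\<integral>x. (\<Sum>k\<in>K. c k * indicator {0<..a k} x) \<partial>lborel) = (\<Sum>k\<in>K. c k * max 0 (a k :: real))"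
proof -
  have "integrable lborel (\<lambda>x. indicator {0<..a} x :: real)" for a :: real
    by (cases "a \<ge> 0") (auto simp: integrable_real_indicator)
  hence "(\<integral>x. (\<Sum>k\<in>K. c k * indicator {0<..a k} x) \<partial>lborel) = (\<Sum>k\<in>K. \<integral>x. c k * indicator {0<..a k} x \<partial>lborel)"
    by (intro Bochner_Integration.integral_sum integrable_mult_right)
  also have "\<dots> = (\<Sum>k\<in>K. c k * max 0 (a k))"
    by (simp only: integral_mult_right_zero integral_indicator_greaterThanAtMost)
  finally show ?thesis .
qed

lemma integrable_exp_neg_Ioi:
  assumes "c > 0"
  shows "integrable lborel (\<lambda>x::real. indicator {0<..} x * exp (- c * x))"
proof -
  have "((\<lambda>x. exp (- c * x)) has_integral (exp (- c * 0) / c)) {0..}"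
    using assms by (rule has_integral_exp_minus_to_infinity)
  hence "(\<lambda>x. exp (- c * x)) absolutely_integrable_on {0..}"
    by (intro nonnegative_absolutely_integrable_1) auto
  hence "set_integrable lebesgue {0<..} (\<lambda>x. exp (- c * x))"
    by (rule set_integrable_subset) auto
  hence "integrable lebesgue (\<lambda>x. indicator {0<..} x * exp (- c * x))"
    by (simp add: set_integrable_def)
  thus ?thesis by (subst (asm) integrable_completion) auto
qed

lemma measure_std_normal_atLeast: "measure std_normal_distribution {y..} = 1 - cdf std_normal_distribution y"
proof -
  interpret real_distribution std_normal_distribution by (rule real_dist_normal_dist)
  have "{..y} \<union> {y<..} = UNIV" by auto
  hence "1 = measure std_normal_distribution ({..y} \<union> {y<..})"
    using prob_space by simp
  also have "\<dots> = cdf std_normal_distribution y + measure std_normal_distribution {y<..}"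
    unfolding cdf_def by (rule finite_measure_Union) auto
  also have "{y..} = {y} \<union> {y<..}" by auto
  hence "measure std_normal_distribution {y..} = measure std_normal_distribution ({y} \<union> {y<..})"
    by simp
  hence "measure std_normal_distribution {y<..} = measure std_normal_distribution {y..}"
    by (subst (asm) finite_measure_Union) (auto simp: measure_std_normal_singleton)
  finally show ?thesis by simp
qed

context renewal_law begin

definition X :: "nat \<Rightarrow> nat \<Rightarrow> real" where "X n k = (real k - real n / \<mu>) / sqrt n"

text \<open>The mass at X >= x, for x > 0 only; the total mass is u n, not 1. In this form its
  integral over x is the sum of q k n times the positive part of X n k.\<close>

definition Q_above :: "nat \<Rightarrow> real \<Rightarrow> real" where
  "Q_above n x = (\<Sum>k\<le>n. q k n * indicator {0<..X n k} x)"

definition Q_below :: "nat \<Rightarrow> real \<Rightarrow> real" where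
  "Q_below n x = (\<Sum>k\<le>n. q k n * indicator {0<..- X n k} x)"

lemma borel_measurable_Q [measurable]:
  "Q_above n \<in> borel_measurable borel" "Q_below n \<in> borel_measurable borel"
  unfolding Q_above_def[abs_def] Q_below_def[abs_def] by measurable

lemma Q_above_eq:
  assumes "n > 0"
  shows "Q_above n x =
    indicator {0<..} x * (\<Sum>k=nat \<lceil>real n / \<mu> + x * sqrt n\<rceil>..n. q k n)"
proof (cases "x > 0")
  case True
  have "Q_above n x = (\<Sum>k\<in>{k\<in>{..n}. x \<le> X n k}. q k n)"
    unfolding Q_above_def sum.inter_filter[OF finite_atMost]
    using True by (intro sum.cong refl) (auto simp: indicator_def)
  also have "{k\<in>{..n}. x \<le> X n k} = {nat \<lceil>real n / \<mu> + x * sqrt n\<rceil>..n}"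
  proof -
    have "x \<le> X n k \<longleftrightarrow> nat \<lceil>real n / \<mu> + x * sqrt n\<rceil> \<le> k" for k
    proof -
      have "x \<le> X n k \<longleftrightarrow> real n / \<mu> + x * sqrt n \<le> real k"
        using assms by (simp add: X_def pos_le_divide_eq algebra_simps)
      thus ?thesis by linarith
    qed
    thus ?thesis by (intro set_eqI) (simp only: mem_Collect_eq atMost_iff atLeastAtMost_iff conj_commute)
  qed
  finally show ?thesis using True by simp
qed (auto simp: Q_above_def indicator_def intro!: sum.neutral)

lemma Q_below_eq:
  assumes "n > 0"
  shows "Q_below n x =
    (if x > 0 \<and> x * sqrt n \<le> real n / \<mu> then (\<Sum>k\<le>nat \<lfloor>real n / \<mu> - x * sqrt n\<rfloor>. q k n) else 0)"
proof (cases "x > 0")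
  case x: True
  define a where "a = real n / \<mu> - x * sqrt n"
  have "Q_below n x = (\<Sum>k\<in>{k\<in>{..n}. real k \<le> a}. q k n)"
  proof -
    have "x \<le> - X n k \<longleftrightarrow> real k \<le> a" for k
    proof -
      have "x \<le> - X n k \<longleftrightarrow> x \<le> (real n / \<mu> - real k) / sqrt n" by (simp add: X_def minus_divide_left)
      also have "\<dots> \<longleftrightarrow> real k \<le> a"
        using assms by (simp add: a_def pos_le_divide_eq algebra_simps)
      finally show ?thesis .
    qed
    thus ?thesis unfolding Q_below_def sum.inter_filter[OF finite_atMost]
      using x by (intro sum.cong refl) (auto simp: indicator_def)
  qed
  also have "\<dots> = (if a \<ge> 0 then (\<Sum>k\<le>nat \<lfloor>a\<rfloor>. q k n) else 0)"
  proof (cases "a \<ge> 0")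
    case True
    have le: "real k \<le> a \<longleftrightarrow> k \<le> nat \<lfloor>a\<rfloor>" for k using True by linarith
    have "real n / \<mu> \<le> real n" using \<mu>_ge_1 by (simp add: divide_le_eq mult_le_cancel_left1)
    moreover have "0 \<le> x * sqrt n" using x by simp
    ultimately have "a \<le> n" unfolding a_def by linarith
    hence "{k\<in>{..n}. real k \<le> a} = {..nat \<lfloor>a\<rfloor>}" by (auto simp: le) linarith
    thus ?thesis using True by simp
  next
    case False
    hence "{k\<in>{..n}. real k \<le> a} = {}" by auto
    thus ?thesis using False by simp
  qed
  finally show ?thesis using x by (simp add: a_def)
qed (auto simp: Q_below_def indicator_def intro!: sum.neutral)

text \<open>The dominating function for the passage to the limit under the integral. Rounding the
  threshold to an integer moves it away from the mean, so it never weakens the Chernoff exponent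
  \<mu> x.\<close>

lemma Q_bounds:
  obtains K n0 where "K > 0" "n0 > 0"
    "\<And>n x. n \<ge> n0 \<Longrightarrow> norm (Q_above n x) \<le> K * (indicator {0<..} x * exp (- \<mu> * x))"
    "\<And>n x. n \<ge> n0 \<Longrightarrow> norm (Q_below n x) \<le> K * (indicator {0<..} x * exp (- \<mu> * x))"
proof -
  obtain K n0 where K: "K > 0" "n0 > 0"
    "\<And>n m. n \<ge> n0 \<Longrightarrow> (\<Sum>k\<le>m. q k n) \<le> K * exp (- (real n - real m * \<mu>) / sqrt n)"
    "\<And>n m. n \<ge> n0 \<Longrightarrow> (\<Sum>k=m..n. q k n) \<le> K * exp (- (real m * \<mu> - real n) / sqrt n)"
    using q_tail_bounds by blast
  have \<mu>: "\<mu> > 0" using \<mu>_ge_1 by simp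
  have le: "K * exp (- y / sqrt n) \<le> K * exp (- \<mu> * x)" if "\<mu> * x * sqrt n \<le> y" "n > 0" for n :: nat and x y
  proof -
    have "\<mu> * x \<le> y / sqrt n" using that by (simp add: pos_le_divide_eq)
    thus ?thesis using K(1) unfolding minus_divide_left[symmetric] by simp
  qed
  show thesis
  proof (rule that[OF K(1,2)])
    fix n :: nat and x :: real assume n: "n \<ge> n0"
    have "n > 0" using n K(2) by simp
    have "Q_above n x \<ge> 0" "Q_below n x \<ge> 0" by (auto simp: Q_above_def Q_below_def sum_nonneg q_nonneg)
    show "norm (Q_above n x) \<le> K * (indicator {0<..} x * exp (- \<mu> * x))"
    proof (cases "x > 0")
      case True
      define m where "m = nat \<lceil>real n / \<mu> + x * sqrt n\<rceil>"
      have "Q_above n x = (\<Sum>k=m..n. q k n)" using True \<open>n > 0\<close> by (simp add: Q_above_eq m_def)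
      also have "\<dots> \<le> K * exp (- (real m * \<mu> - real n) / sqrt n)" using n by (intro K)
      also have "\<dots> \<le> K * exp (- \<mu> * x)"
      proof (rule le[OF _ \<open>n > 0\<close>])
        have "real n / \<mu> + x * sqrt n \<le> real m" unfolding m_def by linarith
        hence "(real n / \<mu> + x * sqrt n) * \<mu> \<le> real m * \<mu>" using \<mu> by (intro mult_right_mono) auto
        thus "\<mu> * x * sqrt n \<le> real m * \<mu> - real n" using \<mu> by (simp add: algebra_simps)
      qed
      finally show ?thesis using True \<open>Q_above n x \<ge> 0\<close> by simp
    qed (auto simp: Q_above_def indicator_def)
    show "norm (Q_below n x) \<le> K * (indicator {0<..} x * exp (- \<mu> * x))"
    proof (cases "x > 0 \<and> x * sqrt n \<le> real n / \<mu>")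
      case True
      define m where "m = nat \<lfloor>real n / \<mu> - x * sqrt n\<rfloor>"
      have "Q_below n x = (\<Sum>k\<le>m. q k n)" using True \<open>n > 0\<close> by (simp add: Q_below_eq m_def)
      also have "\<dots> \<le> K * exp (- (real n - real m * \<mu>) / sqrt n)" using n by (intro K)
      also have "\<dots> \<le> K * exp (- \<mu> * x)"
      proof (rule le[OF _ \<open>n > 0\<close>])
        have "real m \<le> real n / \<mu> - x * sqrt n" using True unfolding m_def by linarith
        hence "real m * \<mu> \<le> (real n / \<mu> - x * sqrt n) * \<mu>" using \<mu> by (intro mult_right_mono) auto
        thus "\<mu> * x * sqrt n \<le> real n - real m * \<mu>" using \<mu> by (simp add: algebra_simps)
      qed
      finally show ?thesis using True \<open>Q_below n x \<ge> 0\<close> by simp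
    next
      case False
      hence "Q_below n x = 0" using \<open>n > 0\<close> by (subst Q_below_eq) auto
      thus ?thesis using K(1) by (simp only: norm_zero) simp
    qed
  qed
qed

text \<open>Here c = 1/\<tau> or -1/\<tau>, and the limit is the mean of max 0 (c Y) divided by
  \<mu>, for a standard normal Y. The sequence is shifted by \<open>start\<close> because domination
  only holds from there on.\<close>

lemma dominated_normal_tail_integral_tendsto:
  fixes Q :: "nat \<Rightarrow> real \<Rightarrow> real"
  assumes meas: "\<And>n. Q n \<in> borel_measurable borel"
    and bound: "\<And>n x. n \<ge> start \<Longrightarrow> norm (Q n x) \<le> K * (indicator {0<..} x * exp (- \<mu> * x))"
    and lim: "\<And>x. x > 0 \<Longrightarrow> (\<lambda>n. Q n x) \<longlonglongrightarrow> measure std_normal_distribution {y. x \<le> max 0 (c * y)} / \<mu>"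
    and c: "\<bar>c\<bar> = 1 / \<tau>"
  shows "(\<lambda>n. \<integral>x. Q n x \<partial>lborel) \<longlonglongrightarrow> 1 / (\<mu> * \<tau> * sqrt (2 * pi))"
proof -
  let ?N = "std_normal_distribution"
  let ?g = "\<lambda>x. indicator {0<..} x * measure ?N {y. x \<le> max 0 (c * y)} / \<mu>"
  interpret real_distribution ?N by (rule real_dist_normal_dist)
  have pt: "(\<lambda>n. Q (n + start) x) \<longlonglongrightarrow> ?g x" for x
  proof (cases "x > 0")
    case True
    thus ?thesis using LIMSEQ_ignore_initial_segment[OF lim[OF True], of start] by simp
  next
    case False
    hence "Q (n + start) x = 0" for n using bound[of "n + start" x] by simp
    thus ?thesis using False by simp
  qed
  have "(\<lambda>n. \<integral>x. Q (n + start) x \<partial>lborel) \<longlonglongrightarrow> (\<integral>x. ?g x \<partial>lborel)"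
  proof (rule integral_dominated_convergence)
    have "\<mu> > 0" using \<mu>_ge_1 by simp
    from integrable_exp_neg_Ioi[OF this]
    show "integrable lborel (\<lambda>x. K * (indicator {0<..} x * exp (- \<mu> * x)))"
      by (rule integrable_mult_right)
    show "Q (n + start) \<in> borel_measurable lborel" for n using meas by simp
    thus "?g \<in> borel_measurable lborel" by (rule borel_measurable_LIMSEQ_real[OF pt])
    show "AE x in lborel. (\<lambda>n. Q (n + start) x) \<longlonglongrightarrow> ?g x" by (intro AE_I2 pt)
    show "AE x in lborel. norm (Q (n + start) x) \<le> K * (indicator {0<..} x * exp (- \<mu> * x))" for n
      by (intro AE_I2 bound) simp
  qed
  also have "(\<integral>x. ?g x \<partial>lborel) = (\<integral>x. indicator {0<..} x * measure ?N {y. x \<le> max 0 (c * y)} \<partial>lborel) / \<mu>"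
    by simp
  also have "\<dots> = (\<integral>y. max 0 (c * y) \<partial>?N) / \<mu>"
    using std_normal_positive_part(1)[of c] prob_space_axioms by (subst layer_cake) auto
  also have "\<dots> = 1 / (\<mu> * \<tau> * sqrt (2 * pi))"
    unfolding std_normal_positive_part(2) c by simp
  finally show ?thesis by (rule LIMSEQ_offset)
qed

lemma positive_part_X_tendsto:
  "(\<lambda>n. \<Sum>k\<le>n. q k n * max 0 (X n k)) \<longlonglongrightarrow> 1 / (\<mu> * \<tau> * sqrt (2 * pi))"
proof -
  obtain K n0 where K: "K > 0" "n0 > 0"
    "\<And>n x. n \<ge> n0 \<Longrightarrow> norm (Q_above n x) \<le> K * (indicator {0<..} x * exp (- \<mu> * x))"
    "\<And>n x. n \<ge> n0 \<Longrightarrow> norm (Q_below n x) \<le> K * (indicator {0<..} x * exp (- \<mu> * x))"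
    using Q_bounds by blast
  have \<mu>: "\<mu> > 0" using \<mu>_ge_1 by simp
  let ?N = "std_normal_distribution"
  \<comment> \<open>The slope is negative because the limit of the upper tail is the mass of y <= -x
    \<tau>, which for x > 0 is the event x <= -y/\<tau>.\<close>
  have "(\<lambda>n. Q_above n x) \<longlonglongrightarrow> measure ?N {y. x \<le> max 0 (- 1 / \<tau> * y)} / \<mu>" if True: "x > 0" for x
  proof -
    define m where "m = (\<lambda>n. nat \<lceil>real n / \<mu> + x * sqrt n\<rceil>)"
    have "(\<lambda>n. (real (m n) - real n / \<mu>) / sqrt n) \<longlonglongrightarrow> x"
    proof (rule tendsto_sandwich)
      have b: "real n / \<mu> + x * sqrt n \<le> real (m n) \<and> real (m n) \<le> real n / \<mu> + x * sqrt n + 1" for n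
      proof -
        have "0 \<le> real n / \<mu> + x * sqrt n" using True \<mu> by simp
        thus ?thesis unfolding m_def by linarith
      qed
      show "eventually (\<lambda>n. x \<le> (real (m n) - real n / \<mu>) / sqrt n) sequentially"
        using eventually_gt_at_top[of 0]
      proof eventually_elim
        case (elim n)
        thus ?case using b[of n] by (simp add: pos_le_divide_eq)
      qed
      show "eventually (\<lambda>n. (real (m n) - real n / \<mu>) / sqrt n \<le> x + 1 / sqrt n) sequentially"
        using eventually_gt_at_top[of 0]
      proof eventually_elim
        case (elim n)
        thus ?case using b[of n] by (simp add: divide_le_eq distrib_right)
      qed
    qed real_asymp+
    hence "(\<lambda>n. \<Sum>k=m n..n. q k n) \<longlonglongrightarrow> cdf ?N (- x * \<tau>) / \<mu>"
      by (rule sum_q_atLeast_tendsto)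
    moreover have "eventually (\<lambda>n. (\<Sum>k=m n..n. q k n) = Q_above n x) at_top"
      using eventually_gt_at_top[of 0] by eventually_elim (use True in \<open>simp add: Q_above_eq m_def\<close>)
    ultimately have "(\<lambda>n. Q_above n x) \<longlonglongrightarrow> cdf ?N (- x * \<tau>) / \<mu>"
      by (rule Lim_transform_eventually)
    moreover have "cdf ?N (- x * \<tau>) = measure ?N {y. x \<le> max 0 (- 1 / \<tau> * y)}"
      unfolding cdf_def using True \<tau>_pos by (intro arg_cong2[of _ _ _ _ measure]) (auto simp: field_simps le_max_iff_disj)
    ultimately show ?thesis by simp
  qed
  hence "(\<lambda>n. \<integral>x. Q_above n x \<partial>lborel) \<longlonglongrightarrow> 1 / (\<mu> * \<tau> * sqrt (2 * pi))"
    using K \<tau>_pos by (intro dominated_normal_tail_integral_tendsto[where start = n0 and K = K and c = "- 1 / \<tau>"]) auto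
  also have "(\<lambda>n. \<integral>x. Q_above n x \<partial>lborel) = (\<lambda>n. \<Sum>k\<le>n. q k n * max 0 (X n k))"
    unfolding Q_above_def by (intro ext integral_sum_indicator_greaterThanAtMost)
  finally show ?thesis .
qed

lemma negative_part_X_tendsto:
  "(\<lambda>n. \<Sum>k\<le>n. q k n * max 0 (- X n k)) \<longlonglongrightarrow> 1 / (\<mu> * \<tau> * sqrt (2 * pi))"
proof -
  obtain K n0 where K: "K > 0" "n0 > 0"
    "\<And>n x. n \<ge> n0 \<Longrightarrow> norm (Q_above n x) \<le> K * (indicator {0<..} x * exp (- \<mu> * x))"
    "\<And>n x. n \<ge> n0 \<Longrightarrow> norm (Q_below n x) \<le> K * (indicator {0<..} x * exp (- \<mu> * x))"
    using Q_bounds by blast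
  have \<mu>: "\<mu> > 0" using \<mu>_ge_1 by simp
  let ?N = "std_normal_distribution"
  have "(\<lambda>n. Q_below n x) \<longlonglongrightarrow> measure ?N {y. x \<le> max 0 (1 / \<tau> * y)} / \<mu>" if True: "x > 0" for x
  proof -
    define m where "m = (\<lambda>n. nat \<lfloor>real n / \<mu> - x * sqrt n\<rfloor>)"
    have ev: "eventually (\<lambda>n. x * sqrt n \<le> real n / \<mu>) at_top"
      using \<mu> by real_asymp
    have b: "real n / \<mu> - x * sqrt n \<le> real (m n) + 1 \<and> real (m n) \<le> real n / \<mu> - x * sqrt n"
      if "x * sqrt n \<le> real n / \<mu>" for n
      using that unfolding m_def by linarith
    \<comment> \<open>The lower tail ends at m n, so it equals u n minus the upper tail from
      \<open>Suc (m n)\<close> on; the shift by 1 disappears after division by sqrt n.\<close>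
    have "(\<lambda>n. (real (Suc (m n)) - real n / \<mu>) / sqrt n) \<longlonglongrightarrow> - x"
    proof (rule tendsto_sandwich)
      show "eventually (\<lambda>n. - x \<le> (real (Suc (m n)) - real n / \<mu>) / sqrt n) sequentially"
        using eventually_gt_at_top[of 0] ev
      proof eventually_elim
        case (elim n)
        thus ?case using b[of n] by (simp add: pos_le_divide_eq)
      qed
      show "eventually (\<lambda>n. (real (Suc (m n)) - real n / \<mu>) / sqrt n \<le> - x + 1 / sqrt n) sequentially"
        using eventually_gt_at_top[of 0] ev
      proof eventually_elim
        case (elim n)
        have "(real (Suc (m n)) - real n / \<mu>) / sqrt n \<le> (- x * sqrt n + 1) / sqrt n"
          using b[of n] elim by (intro divide_right_mono) auto
        thus ?case using elim by (simp add: add_divide_distrib diff_divide_distrib)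
      qed
    qed real_asymp+
    hence "(\<lambda>n. \<Sum>k=Suc (m n)..n. q k n) \<longlonglongrightarrow> cdf ?N (- (- x) * \<tau>) / \<mu>"
      by (rule sum_q_atLeast_tendsto)
    hence "(\<lambda>n. u n - (\<Sum>k=Suc (m n)..n. q k n)) \<longlonglongrightarrow> 1 / \<mu> - cdf ?N (- (- x) * \<tau>) / \<mu>"
      by (intro tendsto_diff u_tendsto)
    moreover have "eventually (\<lambda>n. u n - (\<Sum>k=Suc (m n)..n. q k n) = Q_below n x) at_top"
      using eventually_gt_at_top[of 0] ev
    proof eventually_elim
      case (elim n)
      have "real n / \<mu> \<le> real n" using \<mu>_ge_1 by (simp add: divide_le_eq mult_le_cancel_left1)
      hence "real (m n) \<le> real n - x * sqrt n" using b[OF elim(2)] by linarith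
      moreover have "0 \<le> x * sqrt n" using True by simp
      ultimately have "m n \<le> n" by linarith
      hence "{..n} = {..m n} \<union> {Suc (m n)..n}" by auto
      hence "u n = (\<Sum>k\<le>m n. q k n) + (\<Sum>k=Suc (m n)..n. q k n)"
        unfolding u_def by (simp add: sum.union_disjoint)
      thus ?case using elim True by (simp add: Q_below_eq m_def)
    qed
    ultimately have "(\<lambda>n. Q_below n x) \<longlonglongrightarrow> 1 / \<mu> - cdf ?N (- (- x) * \<tau>) / \<mu>"
      by (rule Lim_transform_eventually)
    moreover have "{y. x \<le> max 0 (1 / \<tau> * y)} = {x * \<tau>..}"
      using True \<tau>_pos by (auto simp: field_simps le_max_iff_disj)
    hence "measure ?N {y. x \<le> max 0 (1 / \<tau> * y)} = 1 - cdf ?N (- (- x) * \<tau>)"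
      by (simp add: measure_std_normal_atLeast)
    ultimately show ?thesis by (simp add: diff_divide_distrib)
  qed
  hence "(\<lambda>n. \<integral>x. Q_below n x \<partial>lborel) \<longlonglongrightarrow> 1 / (\<mu> * \<tau> * sqrt (2 * pi))"
    using K \<tau>_pos by (intro dominated_normal_tail_integral_tendsto[where start = n0 and K = K and c = "1 / \<tau>"]) auto
  also have "(\<lambda>n. \<integral>x. Q_below n x \<partial>lborel) = (\<lambda>n. \<Sum>k\<le>n. q k n * max 0 (- X n k))"
    unfolding Q_below_def by (intro ext integral_sum_indicator_greaterThanAtMost)
  finally show ?thesis .
qed

lemma abs_X_tendsto: "(\<lambda>n. \<Sum>k\<le>n. q k n * \<bar>X n k\<bar>) \<longlonglongrightarrow> 2 / (\<mu> * \<tau> * sqrt (2 * pi))"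
proof -
  have "(\<lambda>n. (\<Sum>k\<le>n. q k n * max 0 (X n k)) + (\<Sum>k\<le>n. q k n * max 0 (- X n k)))
     \<longlonglongrightarrow> 1 / (\<mu> * \<tau> * sqrt (2 * pi)) + 1 / (\<mu> * \<tau> * sqrt (2 * pi))"
    by (intro tendsto_add positive_part_X_tendsto negative_part_X_tendsto)
  also have "(\<lambda>n. (\<Sum>k\<le>n. q k n * max 0 (X n k)) + (\<Sum>k\<le>n. q k n * max 0 (- X n k))) = (\<lambda>n. \<Sum>k\<le>n. q k n * \<bar>X n k\<bar>)"
    unfolding sum.distrib[symmetric] distrib_left[symmetric]
    by (intro ext sum.cong refl arg_cong2[of _ _ _ _ "(*)"]) auto
  finally show ?thesis by (simp add: mult_ac)
qed

text \<open>The two halves have the same limit and cancel. This is what makes the normalising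
  constants of the two laws agree to order o(1/sqrt n).\<close>

lemma X_tendsto: "(\<lambda>n. \<Sum>k\<le>n. q k n * X n k) \<longlonglongrightarrow> 0"
proof -
  have "(\<lambda>n. (\<Sum>k\<le>n. q k n * max 0 (X n k)) - (\<Sum>k\<le>n. q k n * max 0 (- X n k)))
     \<longlonglongrightarrow> 1 / (\<mu> * \<tau> * sqrt (2 * pi)) - 1 / (\<mu> * \<tau> * sqrt (2 * pi))"
    by (intro tendsto_diff positive_part_X_tendsto negative_part_X_tendsto)
  also have "(\<lambda>n. (\<Sum>k\<le>n. q k n * max 0 (X n k)) - (\<Sum>k\<le>n. q k n * max 0 (- X n k))) = (\<lambda>n. \<Sum>k\<le>n. q k n * X n k)"
    unfolding sum_subtractf[symmetric] right_diff_distrib[symmetric]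
    by (intro ext sum.cong refl arg_cong2[of _ _ _ _ "(*)"]) auto
  finally show ?thesis by simp
qed

lemma X_tail_bound:
  obtains K n0 where "K > 0" "n0 > 0"
    "\<And>n y. n \<ge> n0 \<Longrightarrow> y > 0 \<Longrightarrow> (\<Sum>k\<in>{k\<in>{..n}. \<bar>X n k\<bar> \<ge> y}. q k n) \<le> K * exp (- \<mu> * y)"
proof -
  obtain K n0 where K: "K > 0" "n0 > 0"
    "\<And>n x. n \<ge> n0 \<Longrightarrow> norm (Q_above n x) \<le> K * (indicator {0<..} x * exp (- \<mu> * x))"
    "\<And>n x. n \<ge> n0 \<Longrightarrow> norm (Q_below n x) \<le> K * (indicator {0<..} x * exp (- \<mu> * x))"
    using Q_bounds by blast
  show thesis
  proof (rule that[of "2 * K" n0])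
    fix n :: nat and y :: real assume n: "n \<ge> n0" and y: "y > 0"
    have *: "q k n * indicator {0<..X n k} y + q k n * indicator {0<..- X n k} y =
       (if \<bar>X n k\<bar> \<ge> y then q k n else 0)" for k
      using y by (auto simp: indicator_def abs_if)
    have "(\<Sum>k\<in>{k\<in>{..n}. \<bar>X n k\<bar> \<ge> y}. q k n) = Q_above n y + Q_below n y"
      unfolding Q_above_def Q_below_def sum.distrib[symmetric] * by (rule sum.inter_filter) auto
    also have "\<dots> \<le> 2 * K * exp (- \<mu> * y)"
      using K(3)[OF n, of y] K(4)[OF n, of y] y by simp
    finally show "(\<Sum>k\<in>{k\<in>{..n}. \<bar>X n k\<bar> \<ge> y}. q k n) \<le> 2 * K * exp (- \<mu> * y)" .
  qed (use K in auto)
qed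

end

section \<open>Reweighting by a regularly varying sequence\<close>

text \<open>The bound is in powers of n, since at k = 0 the power \<open>0 powr a\<close> is 0 and
  controls nothing. The finitely many early values are absorbed into C.\<close>

lemma bigo_powr_global_bound:
  fixes w :: "nat \<Rightarrow> real"
  assumes "w \<in> O(\<lambda>k. real k powr a)" "a \<ge> 0"
  obtains C where "C > 0" "\<And>k n. k \<le> n \<Longrightarrow> n > 0 \<Longrightarrow> \<bar>w k\<bar> \<le> C * real n powr a"
proof -
  obtain c where c: "c > 0" "eventually (\<lambda>k. norm (w k) \<le> c * norm (real k powr a)) at_top"
    using assms(1) by (elim landau_o.bigE)
  then obtain N where N: "\<And>k. k \<ge> N \<Longrightarrow> norm (w k) \<le> c * norm (real k powr a)"
    by (auto simp: eventually_at_top_linorder)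
  define C where "C = c + (\<Sum>k<N. \<bar>w k\<bar>)"
  show thesis
  proof (rule that)
    show "C > 0" using c(1) by (simp add: C_def add_pos_nonneg sum_nonneg)
    fix k n :: nat assume kn: "k \<le> n" "n > 0"
    have n1: "1 \<le> real n powr a" using kn assms(2) by (intro ge_one_powr_ge_zero) auto
    show "\<bar>w k\<bar> \<le> C * real n powr a"
    proof (cases "k < N")
      case True
      have "\<bar>w k\<bar> \<le> (\<Sum>k<N. \<bar>w k\<bar>)" using True by (intro member_le_sum) auto
      also have "\<dots> \<le> C" using c(1) by (simp add: C_def)
      also have "C \<le> C * real n powr a" using n1 \<open>C > 0\<close> by simp
      finally show ?thesis .
    next
      case False
      hence "\<bar>w k\<bar> \<le> c * real k powr a" using N[of k] by simp
      also have "\<dots> \<le> C * real n powr a"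
        using kn assms(2) c(1) by (intro mult_mono powr_mono2) (auto simp: C_def sum_nonneg)
      finally show ?thesis .
    qed
  qed
qed

lemma powr_first_order:
  fixes b :: real
  obtains C \<delta> where "C > 0" "0 < \<delta>" "\<delta> \<le> 1 / 2"
    "\<And>z. \<bar>z\<bar> < \<delta> \<Longrightarrow> \<bar>(1 + z) powr b - 1 - b * z\<bar> \<le> C * z\<^sup>2"
proof -
  have "(\<lambda>z::real. (1 + z) powr b - 1 - b * z) \<in> O[at_right 0](\<lambda>z. z\<^sup>2)" by real_asymp
  moreover have "(\<lambda>z::real. (1 + z) powr b - 1 - b * z) \<in> O[at_left 0](\<lambda>z. z\<^sup>2)" by real_asymp
  ultimately obtain c1 c2 where c: "c1 > 0" "c2 > 0"
    "eventually (\<lambda>z. norm ((1 + z) powr b - 1 - b * z) \<le> c1 * norm (z\<^sup>2)) (at_right 0)"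
    "eventually (\<lambda>z. norm ((1 + z) powr b - 1 - b * z) \<le> c2 * norm (z\<^sup>2)) (at_left 0)"
    by (elim landau_o.bigE) blast
  define c where "c = max c1 c2"
  have "c > 0" using c(1) by (simp add: c_def)
  have le: "c1 * norm (z\<^sup>2) \<le> c * norm (z\<^sup>2)" "c2 * norm (z\<^sup>2) \<le> c * norm (z\<^sup>2)" for z :: real
    by (intro mult_right_mono; simp add: c_def)+
  have "eventually (\<lambda>z. norm ((1 + z) powr b - 1 - b * z) \<le> c * norm (z\<^sup>2)) (at_right 0)"
    using c(3) by eventually_elim (rule order.trans[OF _ le(1)])
  moreover have "eventually (\<lambda>z. norm ((1 + z) powr b - 1 - b * z) \<le> c * norm (z\<^sup>2)) (at_left 0)"
    using c(4) by eventually_elim (rule order.trans[OF _ le(2)])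
  ultimately have "eventually (\<lambda>z. norm ((1 + z) powr b - 1 - b * z) \<le> c * norm (z\<^sup>2)) (at 0)"
    by (simp add: eventually_at_split)
  then obtain d where d: "d > 0" "\<And>z. z \<noteq> 0 \<Longrightarrow> dist z 0 < d \<Longrightarrow> norm ((1 + z) powr b - 1 - b * z) \<le> c * norm (z\<^sup>2)"
    by (auto simp: eventually_at)
  show thesis
  proof (rule that[of c "min d (1 / 2)"])
    fix z :: real assume z: "\<bar>z\<bar> < min d (1 / 2)"
    show "\<bar>(1 + z) powr b - 1 - b * z\<bar> \<le> c * z\<^sup>2"
      using d(2)[of z] z \<open>c > 0\<close> by (cases "z = 0") auto
  qed (use \<open>c > 0\<close> d in auto)
qed

context renewal_law begin

text \<open>The relative deviation of w k from its value at the typical core-size n/\<mu>, magnified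
  by sqrt n so that its leading term (s - 1) \<mu> X is of order 1.\<close>

definition rel_dev :: "(nat \<Rightarrow> real) \<Rightarrow> real \<Rightarrow> real \<Rightarrow> nat \<Rightarrow> nat \<Rightarrow> real" where
  "rel_dev w D s n k = sqrt n * (w k / (D * (real n / \<mu>) powr (s - 1)) - 1)"

text \<open>Write k = (n/\<mu>)(1 + z) with z = \<mu> X / sqrt n. For |X| < n^(1/8) the quadratic
  Taylor term is O(n^(-3/4)), and the relative error of w is O(1/n); after the factor sqrt n both
  are O(n^(-1/4)). Any exponent strictly between 0 and 1/4 would serve instead of 1/8.\<close>

lemma rel_dev_core:
  assumes D: "D \<noteq> 0" and w: "(\<lambda>k. w k - D * real k powr (s - 1)) \<in> O(\<lambda>k. real k powr (s - 2))"
  obtains C n0 where "n0 > 0" "C > 0"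
    "\<And>n k. n \<ge> n0 \<Longrightarrow> \<bar>X n k\<bar> < real n powr (1/8) \<Longrightarrow>
       \<bar>rel_dev w D s n k - (s - 1) * \<mu> * X n k\<bar> \<le> C * real n powr (-1/4)"
proof -
  have \<mu>: "\<mu> > 0" using \<mu>_ge_1 by simp
  obtain C2 \<delta> where C2: "C2 > 0" "0 < \<delta>" "\<delta> \<le> 1 / 2"
    "\<And>z. \<bar>z\<bar> < \<delta> \<Longrightarrow> \<bar>(1 + z) powr (s - 1) - 1 - (s - 1) * z\<bar> \<le> C2 * z\<^sup>2"
    using powr_first_order by blast
  obtain C1 where C1: "C1 > 0" "eventually (\<lambda>k. norm (w k - D * real k powr (s - 1)) \<le> C1 * norm (real k powr (s - 2))) at_top"
    using w by (elim landau_o.bigE)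
  then obtain k0 where k0: "\<And>k. k \<ge> k0 \<Longrightarrow> \<bar>w k - D * real k powr (s - 1)\<bar> \<le> C1 * real k powr (s - 2)"
    by (auto simp: eventually_at_top_linorder)
  define C3 where "C3 = max ((1/2) powr (s - 2)) ((3/2) powr (s - 2))"
  have "C3 > 0" by (simp add: C3_def less_max_iff_disj)
  define C where "C = C2 * \<mu>\<^sup>2 + C1 * C3 * \<mu> / \<bar>D\<bar>"
  \<comment> \<open>The second condition places every k >= n/(2 \<mu>) beyond k0, where the estimate
    of w is valid; |z| < \<delta> <= 1/2 ensures k is that large.\<close>
  have "eventually (\<lambda>n. \<mu> * real n powr (1/8) / sqrt n < \<delta> \<and> real n / \<mu> / 2 > real k0) at_top"
  proof (rule eventually_conj)
    show "eventually (\<lambda>n. \<mu> * real n powr (1/8) / sqrt n < \<delta>) at_top"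
      using C2(2) by (intro order_tendstoD(2)[where y = 0]) real_asymp+
    show "eventually (\<lambda>n. real n / \<mu> / 2 > real k0) at_top"
      using \<mu> by real_asymp
  qed
  then obtain n1 where n1: "\<And>n. n \<ge> n1 \<Longrightarrow> \<mu> * real n powr (1/8) / sqrt n < \<delta>"
     "\<And>n. n \<ge> n1 \<Longrightarrow> real n / \<mu> / 2 > real k0"
    by (auto simp: eventually_at_top_linorder)
  show thesis
  proof (rule that[of "max n1 1" C])
    fix n k assume n: "n \<ge> max n1 1" and X: "\<bar>X n k\<bar> < real n powr (1/8)"
    have "n > 0" using n by simp
    define m where "m = real n / \<mu>"
    have m: "m > 0" using \<open>n > 0\<close> \<mu> by (simp add: m_def)
    define z where "z = \<mu> * X n k / sqrt n"
    have z_le: "\<bar>z\<bar> \<le> \<mu> * real n powr (1/8) / sqrt n"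
      using X \<mu> by (auto simp: z_def abs_mult intro!: divide_right_mono mult_left_mono)
    hence z: "\<bar>z\<bar> < \<delta>" using n1(1)[of n] n by simp
    have k: "real k = m * (1 + z)"
      using \<mu> \<open>n > 0\<close> by (simp add: z_def X_def m_def field_simps)
    have z2: "1 / 2 \<le> 1 + z" "1 + z \<le> 3 / 2" using z C2(3) by (auto simp: abs_less_iff)
    have "m * (1 / 2) \<le> real k" unfolding k using m z2 by (intro mult_left_mono) auto
    hence "k \<ge> k0" using n1(2)[of n] n by (simp add: m_def)
    have kp: "real k powr b = m powr b * (1 + z) powr b" for b
      unfolding k using m z2 by (simp add: powr_mult)
    define r where "r = w k - D * real k powr (s - 1)"
    have "rel_dev w D s n k = sqrt n * ((1 + z) powr (s - 1) + r / (D * m powr (s - 1)) - 1)"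
      using D m by (simp add: rel_dev_def r_def m_def[symmetric] kp field_simps)
    moreover have "(s - 1) * \<mu> * X n k = sqrt n * ((s - 1) * z)"
      using \<open>n > 0\<close> by (simp add: z_def)
    ultimately have eq: "rel_dev w D s n k - (s - 1) * \<mu> * X n k =
      sqrt n * (((1 + z) powr (s - 1) - 1 - (s - 1) * z) + r / (D * m powr (s - 1)))"
      by (simp only: right_diff_distrib distrib_left)
    have "\<bar>r / (D * m powr (s - 1))\<bar> \<le> C1 * C3 * \<mu> / \<bar>D\<bar> / real n"
    proof -
      have "\<bar>r\<bar> \<le> C1 * real k powr (s - 2)" unfolding r_def using \<open>k \<ge> k0\<close> by (rule k0)
      also have "real k powr (s - 2) \<le> m powr (s - 2) * C3"
        unfolding kp C3_def using powr_le_max_mult_powr[of "1/2" 1 "1 + z" "3/2" "s - 2"] z2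
        by (intro mult_left_mono) auto
      also have "m powr (s - 2) = m powr (s - 1) / m" using powr_diff[of m "s - 1" 1] m by simp
      finally have "\<bar>r\<bar> \<le> C1 * (m powr (s - 1) / m * C3)" using C1(1) by simp
      hence "\<bar>r\<bar> / (\<bar>D\<bar> * m powr (s - 1)) \<le> C1 * (m powr (s - 1) / m * C3) / (\<bar>D\<bar> * m powr (s - 1))"
        using D by (intro divide_right_mono) auto
      also have "\<dots> = C1 * C3 * \<mu> / \<bar>D\<bar> / real n"
        using D m by (simp add: m_def field_simps)
      finally show ?thesis by (simp add: abs_mult)
    qed
    moreover have "\<bar>(1 + z) powr (s - 1) - 1 - (s - 1) * z\<bar> \<le> C2 * \<mu>\<^sup>2 * real n powr (-3/4)"
    proof -
      have "\<bar>(1 + z) powr (s - 1) - 1 - (s - 1) * z\<bar> \<le> C2 * z\<^sup>2" by (rule C2(4)[OF z])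
      also have "z\<^sup>2 \<le> (\<mu> * real n powr (1/8) / sqrt n)\<^sup>2"
        using power_mono[OF z_le, of 2] by simp
      also have "\<dots> = \<mu>\<^sup>2 * real n powr (-3/4)"
      proof -
        have "(real n powr (1/8))\<^sup>2 = real n powr (1/4)"
          by (simp add: power2_eq_square powr_add[symmetric])
        moreover have "real n powr (1/4) / real n = real n powr (-3/4)"
          using \<open>n > 0\<close> powr_diff[of "real n" "1/4" 1] by simp
        moreover have "(\<mu> * real n powr (1/8) / sqrt n)\<^sup>2 = \<mu>\<^sup>2 * ((real n powr (1/8))\<^sup>2 / real n)"
          by (simp add: power_mult_distrib power_divide)
        ultimately show ?thesis by (simp only:)
      qed
      finally show ?thesis using C2(1) by (simp add: mult_ac)
    qed
    ultimately have "\<bar>((1 + z) powr (s - 1) - 1 - (s - 1) * z) + r / (D * m powr (s - 1))\<bar> \<le>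
       C2 * \<mu>\<^sup>2 * real n powr (-3/4) + C1 * C3 * \<mu> / \<bar>D\<bar> / real n" by linarith
    also have "1 / real n \<le> real n powr (-3/4)"
    proof -
      have "real n powr (-1) \<le> real n powr (-3/4)" using \<open>n > 0\<close> by (intro powr_mono) auto
      thus ?thesis using \<open>n > 0\<close> by (simp add: powr_minus_divide)
    qed
    hence "C1 * C3 * \<mu> / \<bar>D\<bar> / real n \<le> C1 * C3 * \<mu> / \<bar>D\<bar> * real n powr (-3/4)"
      using C1 \<open>C3 > 0\<close> \<mu> mult_left_mono[of "1 / real n" "real n powr (-3/4)" "C1 * C3 * \<mu> / \<bar>D\<bar>"] by simp
    finally have le: "\<bar>((1 + z) powr (s - 1) - 1 - (s - 1) * z) + r / (D * m powr (s - 1))\<bar> \<le> C * real n powr (-3/4)"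
      by (simp add: C_def distrib_right)
    have "\<bar>rel_dev w D s n k - (s - 1) * \<mu> * X n k\<bar> \<le> sqrt n * (C * real n powr (-3/4))"
      unfolding eq abs_mult using le by (simp add: mult_left_mono)
    also have "sqrt n * (C * real n powr (-3/4)) = C * (real n powr (1/2) * real n powr (-3/4))"
      by (simp add: powr_half_sqrt)
    also have "real n powr (1/2) * real n powr (-3/4) = real n powr (-1/4)"
      by (simp add: powr_add[symmetric])
    finally show "\<bar>rel_dev w D s n k - (s - 1) * \<mu> * X n k\<bar> \<le> C * real n powr (-1/4)" .
  qed (use C1 C2 \<open>C3 > 0\<close> \<mu> D in \<open>auto simp: C_def intro!: add_pos_pos mult_pos_pos divide_pos_pos\<close>)
qed

text \<open>For core-sizes far from n/\<mu> any polynomial bound will do, since their mass is at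
  most exp (-\<mu> n^(1/8)) up to a constant; the exponents are therefore generous.\<close>

lemma rel_dev_poly_bound:
  assumes D: "D \<noteq> 0" and w: "(\<lambda>k. w k - D * real k powr (s - 1)) \<in> O(\<lambda>k. real k powr (s - 2))"
  obtains C b where "C > 0"
    "\<And>n k. n > 0 \<Longrightarrow> k \<le> n \<Longrightarrow> \<bar>rel_dev w D s n k - (s - 1) * \<mu> * X n k\<bar> \<le> C * real n powr b"
proof -
  have \<mu>: "\<mu> > 0" using \<mu>_ge_1 by simp
  \<comment> \<open>Nonnegative, above s - 1 and s - 2, and large enough that 1/2 + a + (1 - s) <= 2
    a + 1.\<close>
  define a where "a = \<bar>s\<bar> + 2"
  have "(\<lambda>k. (w k - D * real k powr (s - 1)) + D * real k powr (s - 1)) \<in> O(\<lambda>k. real k powr a)"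
  proof (rule sum_in_bigo)
    have "s - 2 < a" "s - 1 < a" by (simp_all add: a_def)
    hence 1: "(\<lambda>k. real k powr (s - 2)) \<in> O(\<lambda>k. real k powr a)" "(\<lambda>k. real k powr (s - 1)) \<in> O(\<lambda>k. real k powr a)"
      by real_asymp+
    show "(\<lambda>k. w k - D * real k powr (s - 1)) \<in> O(\<lambda>k. real k powr a)"
      using w 1(1) by (rule landau_o.big_trans)
    show "(\<lambda>k. D * real k powr (s - 1)) \<in> O(\<lambda>k. real k powr a)" using 1(2) by simp
  qed
  hence "w \<in> O(\<lambda>k. real k powr a)" by simp
  then obtain C where C: "C > 0" "\<And>k n. k \<le> n \<Longrightarrow> n > 0 \<Longrightarrow> \<bar>w k\<bar> \<le> C * real n powr a"
    by (rule bigo_powr_global_bound) (auto simp: a_def)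
  define E where "E = C / \<bar>D\<bar> / (1 / \<mu>) powr (s - 1) + 1 + \<bar>s - 1\<bar> * \<mu>"
  have "E > 0" using C(1) D \<mu> by (simp add: E_def add_nonneg_pos add_pos_nonneg)
  show thesis
  proof (rule that[of E "2 * a + 1"])
    fix n k :: nat assume n: "n > 0" and k: "k \<le> n"
    have n1: "real n \<ge> 1" using n by simp
    have mono: "real n powr c \<le> real n powr (2 * a + 1)" if "c \<le> 2 * a + 1" for c
      using that n1 by (rule powr_mono)
    have 1: "sqrt n * \<bar>w k / (D * (real n / \<mu>) powr (s - 1))\<bar> \<le> C / \<bar>D\<bar> / (1 / \<mu>) powr (s - 1) * real n powr (2 * a + 1)"
    proof -
      have "\<bar>w k / (D * (real n / \<mu>) powr (s - 1))\<bar> = \<bar>w k\<bar> * (1 / \<bar>D\<bar> / (1 / \<mu>) powr (s - 1) * real n powr (1 - s))"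
      proof -
        have "(real n / \<mu>) powr (s - 1) = (1 / \<mu>) powr (s - 1) * real n powr (s - 1)"
          using \<mu> n1 powr_mult[of "1 / \<mu>" "real n" "s - 1"] by simp
        moreover have "real n powr (1 - s) = 1 / real n powr (s - 1)"
          using powr_minus_divide[of "real n" "s - 1"] by simp
        ultimately show ?thesis by (simp add: abs_mult)
      qed
      also have "\<dots> \<le> C * real n powr a * (1 / \<bar>D\<bar> / (1 / \<mu>) powr (s - 1) * real n powr (1 - s))"
        using C(2)[OF k n] by (intro mult_right_mono) auto
      finally have "sqrt n * \<bar>w k / (D * (real n / \<mu>) powr (s - 1))\<bar> \<le>
         sqrt n * (C * real n powr a * (1 / \<bar>D\<bar> / (1 / \<mu>) powr (s - 1) * real n powr (1 - s)))"
        by (intro mult_left_mono) auto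
      also have "\<dots> = C / \<bar>D\<bar> / (1 / \<mu>) powr (s - 1) * (real n powr (1/2) * real n powr a * real n powr (1 - s))"
        by (simp add: powr_half_sqrt)
      also have "real n powr (1/2) * real n powr a * real n powr (1 - s) = real n powr (1/2 + a + (1 - s))"
        by (simp only: powr_add)
      also have "C / \<bar>D\<bar> / (1 / \<mu>) powr (s - 1) * \<dots> \<le> C / \<bar>D\<bar> / (1 / \<mu>) powr (s - 1) * real n powr (2 * a + 1)"
        using C(1) by (intro mult_left_mono mono) (auto simp: a_def)
      finally show ?thesis .
    qed
    have 2: "sqrt n \<le> 1 * real n powr (2 * a + 1)"
      using mono[of "1/2"] n1 by (simp add: powr_half_sqrt a_def)
    have 3: "\<bar>(s - 1) * \<mu> * X n k\<bar> \<le> \<bar>s - 1\<bar> * \<mu> * real n powr (2 * a + 1)"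
    proof -
      have "\<bar>X n k\<bar> \<le> real n"
      proof -
        have "0 \<le> real n / \<mu>" "real n / \<mu> \<le> real n"
          using \<mu>_ge_1 by (auto simp: divide_le_eq mult_le_cancel_left1)
        hence "\<bar>real k - real n / \<mu>\<bar> \<le> real n" using k by linarith
        hence "\<bar>real k - real n / \<mu>\<bar> / sqrt n \<le> real n / 1"
          using n1 by (intro frac_le) auto
        thus ?thesis by (simp add: X_def)
      qed
      also have "real n = real n powr 1" using n1 by simp
      also have "\<dots> \<le> real n powr (2 * a + 1)" by (intro mono) (simp add: a_def)
      finally show ?thesis using \<mu> by (simp add: abs_mult mult_left_mono)
    qed
    have "rel_dev w D s n k = sqrt n * (w k / (D * (real n / \<mu>) powr (s - 1))) - sqrt n"
      by (simp add: rel_dev_def right_diff_distrib)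
    hence "\<bar>rel_dev w D s n k\<bar> \<le> sqrt n * \<bar>w k / (D * (real n / \<mu>) powr (s - 1))\<bar> + sqrt n"
      using abs_triangle_ineq4[of "sqrt n * (w k / (D * (real n / \<mu>) powr (s - 1)))" "sqrt n"]
      by (simp add: abs_mult)
    hence "\<bar>rel_dev w D s n k - (s - 1) * \<mu> * X n k\<bar> \<le>
      sqrt n * \<bar>w k / (D * (real n / \<mu>) powr (s - 1))\<bar> + sqrt n + \<bar>(s - 1) * \<mu> * X n k\<bar>" by linarith
    also have "\<dots> \<le> E * real n powr (2 * a + 1)"
      using add_mono[OF add_mono[OF 1 2] 3] by (simp add: E_def distrib_right)
    finally show "\<bar>rel_dev w D s n k - (s - 1) * \<mu> * X n k\<bar> \<le> E * real n powr (2 * a + 1)" .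
  qed fact
qed

text \<open>Split at |X| = n^(1/8): below it the uniform estimate times total mass at most 1, above
  it the polynomial bound times an exponentially small mass.\<close>

lemma rel_dev_error_tendsto:
  assumes D: "D \<noteq> 0" and w: "(\<lambda>k. w k - D * real k powr (s - 1)) \<in> O(\<lambda>k. real k powr (s - 2))"
  shows "(\<lambda>n. \<Sum>k\<le>n. q k n * \<bar>rel_dev w D s n k - (s - 1) * \<mu> * X n k\<bar>) \<longlonglongrightarrow> 0"
proof -
  have \<mu>: "\<mu> > 0" using \<mu>_ge_1 by simp
  obtain C1 n1 where 1: "n1 > 0" "C1 > 0"
    "\<And>n k. n \<ge> n1 \<Longrightarrow> \<bar>X n k\<bar> < real n powr (1/8) \<Longrightarrow>
       \<bar>rel_dev w D s n k - (s - 1) * \<mu> * X n k\<bar> \<le> C1 * real n powr (-1/4)"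
    using rel_dev_core[OF D w] by metis
  obtain C2 b where 2: "C2 > 0"
    "\<And>n k. n > 0 \<Longrightarrow> k \<le> n \<Longrightarrow> \<bar>rel_dev w D s n k - (s - 1) * \<mu> * X n k\<bar> \<le> C2 * real n powr b"
    using rel_dev_poly_bound[OF D w] by metis
  obtain K n2 where 3: "K > 0" "n2 > 0"
    "\<And>n y. n \<ge> n2 \<Longrightarrow> y > 0 \<Longrightarrow> (\<Sum>k\<in>{k\<in>{..n}. \<bar>X n k\<bar> \<ge> y}. q k n) \<le> K * exp (- \<mu> * y)"
    using X_tail_bound by blast
  have "eventually (\<lambda>n. norm (\<Sum>k\<le>n. q k n * \<bar>rel_dev w D s n k - (s - 1) * \<mu> * X n k\<bar>) \<le>
     C1 * real n powr (-1/4) + C2 * real n powr b * (K * exp (- \<mu> * real n powr (1/8)))) at_top"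
    using eventually_ge_at_top[of "max n1 n2"]
  proof eventually_elim
    case (elim n)
    have n: "n > 0" "n \<ge> n1" "n \<ge> n2" using elim 1 by auto
    let ?e = "\<lambda>k. \<bar>rel_dev w D s n k - (s - 1) * \<mu> * X n k\<bar>"
    let ?y = "real n powr (1/8)"
    let ?T = "{k\<in>{..n}. \<bar>X n k\<bar> \<ge> ?y}"
    have sub: "?T \<subseteq> {..n}" by auto
    have A: "(\<Sum>k\<in>{..n}-?T. q k n * ?e k) \<le> C1 * real n powr (-1/4)"
    proof -
      have "(\<Sum>k\<in>{..n}-?T. q k n * ?e k) \<le> (\<Sum>k\<in>{..n}-?T. q k n * (C1 * real n powr (-1/4)))"
        using n by (intro sum_mono mult_left_mono 1 q_nonneg) auto
      also have "\<dots> \<le> (\<Sum>k\<le>n. q k n * (C1 * real n powr (-1/4)))"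
        using 1(2) by (intro sum_mono2 mult_nonneg_nonneg q_nonneg) auto
      also have "\<dots> = u n * (C1 * real n powr (-1/4))" by (simp only: u_def sum_distrib_right)
      also have "\<dots> \<le> 1 * (C1 * real n powr (-1/4))"
        using 1(2) u_le_1 by (intro mult_right_mono) auto
      finally show ?thesis by simp
    qed
    have B: "(\<Sum>k\<in>?T. q k n * ?e k) \<le> C2 * real n powr b * (K * exp (- \<mu> * ?y))"
    proof -
      have "(\<Sum>k\<in>?T. q k n * ?e k) \<le> (\<Sum>k\<in>?T. q k n * (C2 * real n powr b))"
        using n by (intro sum_mono mult_left_mono 2 q_nonneg) auto
      also have "\<dots> = (C2 * real n powr b) * (\<Sum>k\<in>?T. q k n)"
        unfolding sum_distrib_left by (simp only: mult_ac)
      also have "\<dots> \<le> (C2 * real n powr b) * (K * exp (- \<mu> * ?y))"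
        using n 2(1) by (intro mult_left_mono 3) auto
      finally show ?thesis .
    qed
    have "(\<Sum>k\<le>n. q k n * ?e k) = (\<Sum>k\<in>{..n}-?T. q k n * ?e k) + (\<Sum>k\<in>?T. q k n * ?e k)"
      by (rule sum.subset_diff[OF sub]) simp
    with A B have "(\<Sum>k\<le>n. q k n * ?e k) \<le> C1 * real n powr (-1/4) + C2 * real n powr b * (K * exp (- \<mu> * ?y))"
      by linarith
    moreover have "(\<Sum>k\<le>n. q k n * ?e k) \<ge> 0" by (intro sum_nonneg mult_nonneg_nonneg q_nonneg) auto
    ultimately show ?case by simp
  qed
  moreover have "(\<lambda>n. C1 * real n powr (-1/4) + C2 * real n powr b * (K * exp (- \<mu> * real n powr (1/8)))) \<longlonglongrightarrow> 0"
    using \<mu> by real_asymp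
  ultimately show ?thesis by (rule Lim_null_comparison)
qed

text \<open>With w k = c (1 + y k / sqrt n) and Y the mean of y under r = q/u, the two laws differ
  at k by exactly r k (y k - Y) / (sqrt n (1 + Y / sqrt n)). The factor c cancels, so D matters only
  through being nonzero. Since Y tends to 0 and y is close to (s - 1) \<mu> X in mean, the sum of
  absolute values reduces to the mean of |X|.\<close>

theorem weighted_law_tv_distance:
  assumes D: "D \<noteq> 0" and w: "(\<lambda>k. w k - D * real k powr (s - 1)) \<in> O(\<lambda>k. real k powr (s - 2))"
  shows "(\<lambda>n. sqrt n * ((\<Sum>k\<le>n. \<bar>w k * q k n / (\<Sum>k\<le>n. w k * q k n) - q k n / u n\<bar>) / 2))
           \<longlonglongrightarrow> \<bar>s - 1\<bar> * \<sigma> / sqrt (2 * pi * \<mu>)"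
proof -
  have \<mu>: "\<mu> > 0" using \<mu>_ge_1 by simp
  define r where "r = (\<lambda>n k. q k n / u n)"
  define y where "y = rel_dev w D s"
  define e where "e = (\<lambda>n k. y n k - (s - 1) * \<mu> * X n k)"
  define Y where "Y = (\<lambda>n. \<Sum>k\<le>n. r n k * y n k)"
  have u_inv: "(\<lambda>n. inverse (u n)) \<longlonglongrightarrow> \<mu>"
    using tendsto_inverse[OF u_tendsto] \<mu> by simp
  have r_lim: "(\<lambda>n. \<Sum>k\<le>n. r n k * f n k) \<longlonglongrightarrow> c * \<mu>" if "(\<lambda>n. \<Sum>k\<le>n. q k n * f n k) \<longlonglongrightarrow> c" for f c
  proof -
    have "(\<lambda>n. (\<Sum>k\<le>n. q k n * f n k) * inverse (u n)) \<longlonglongrightarrow> c * \<mu>"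
      by (intro tendsto_mult that u_inv)
    also have "(\<lambda>n. (\<Sum>k\<le>n. q k n * f n k) * inverse (u n)) = (\<lambda>n. \<Sum>k\<le>n. r n k * f n k)"
      by (simp add: r_def sum_divide_distrib field_simps)
    finally show ?thesis .
  qed
  have e_lim: "(\<lambda>n. \<Sum>k\<le>n. r n k * \<bar>e n k\<bar>) \<longlonglongrightarrow> 0"
    using r_lim[OF rel_dev_error_tendsto[OF D w]] by (simp add: e_def y_def)
  have X_lim: "(\<lambda>n. \<Sum>k\<le>n. r n k * X n k) \<longlonglongrightarrow> 0" using r_lim[OF X_tendsto] by simp
  have aX_lim: "(\<lambda>n. \<Sum>k\<le>n. r n k * \<bar>X n k\<bar>) \<longlonglongrightarrow> 2 / (\<tau> * sqrt (2 * pi))"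
    using r_lim[OF abs_X_tendsto] \<mu> by simp
  have r_nonneg: "r n k \<ge> 0" for n k unfolding r_def by (intro divide_nonneg_nonneg q_nonneg u_nonneg)
  have Y_lim: "Y \<longlonglongrightarrow> 0"
  proof -
    have "(\<lambda>n. \<Sum>k\<le>n. r n k * e n k) \<longlonglongrightarrow> 0"
    proof (rule Lim_null_comparison[OF _ e_lim])
      show "eventually (\<lambda>n. norm (\<Sum>k\<le>n. r n k * e n k) \<le> (\<Sum>k\<le>n. r n k * \<bar>e n k\<bar>)) sequentially"
        by (intro always_eventually allI order.trans[OF norm_sum] sum_mono) (simp add: abs_mult r_nonneg)
    qed
    hence "(\<lambda>n. (\<Sum>k\<le>n. r n k * e n k) + (s - 1) * \<mu> * (\<Sum>k\<le>n. r n k * X n k)) \<longlonglongrightarrow> 0 + (s - 1) * \<mu> * 0"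
      by (intro tendsto_intros X_lim)
    also have "(\<lambda>n. (\<Sum>k\<le>n. r n k * e n k) + (s - 1) * \<mu> * (\<Sum>k\<le>n. r n k * X n k)) = Y"
      unfolding Y_def sum_distrib_left sum.distrib[symmetric]
      by (intro ext sum.cong refl) (simp add: e_def algebra_simps)
    finally show ?thesis by simp
  qed
  have ev_u: "eventually (\<lambda>n. u n > 0) at_top"
    using \<mu> by (intro order_tendstoD(1)[OF u_tendsto]) simp
  have dev_lim: "(\<lambda>n. \<Sum>k\<le>n. r n k * \<bar>y n k - Y n\<bar>) \<longlonglongrightarrow> \<bar>s - 1\<bar> * \<mu> * (2 / (\<tau> * sqrt (2 * pi)))"
  proof -
    have "(\<lambda>n. (\<Sum>k\<le>n. r n k * \<bar>y n k - Y n\<bar>) - \<bar>s - 1\<bar> * \<mu> * (\<Sum>k\<le>n. r n k * \<bar>X n k\<bar>)) \<longlonglongrightarrow> 0"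
    proof (rule Lim_null_comparison)
      show "(\<lambda>n. (\<Sum>k\<le>n. r n k * \<bar>e n k\<bar>) + \<bar>Y n\<bar>) \<longlonglongrightarrow> 0"
        using tendsto_add[OF e_lim tendsto_rabs[OF Y_lim]] by simp
      show "eventually (\<lambda>n. norm ((\<Sum>k\<le>n. r n k * \<bar>y n k - Y n\<bar>) - \<bar>s - 1\<bar> * \<mu> * (\<Sum>k\<le>n. r n k * \<bar>X n k\<bar>))
          \<le> (\<Sum>k\<le>n. r n k * \<bar>e n k\<bar>) + \<bar>Y n\<bar>) sequentially"
        using ev_u
      proof eventually_elim
        case (elim n)
        have sum_r: "(\<Sum>k\<le>n. r n k) = 1" using elim by (simp add: r_def u_def sum_divide_distrib[symmetric])
        have "(\<Sum>k\<le>n. r n k * \<bar>y n k - Y n\<bar>) - \<bar>s - 1\<bar> * \<mu> * (\<Sum>k\<le>n. r n k * \<bar>X n k\<bar>) =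
          (\<Sum>k\<le>n. r n k * (\<bar>y n k - Y n\<bar> - \<bar>(s - 1) * \<mu> * X n k\<bar>))"
          unfolding sum_distrib_left sum_subtractf[symmetric]
        proof (intro sum.cong refl)
          fix k
          have "\<bar>(s - 1) * \<mu> * X n k\<bar> = \<bar>s - 1\<bar> * \<mu> * \<bar>X n k\<bar>" using \<mu> by (simp add: abs_mult)
          thus "r n k * \<bar>y n k - Y n\<bar> - \<bar>s - 1\<bar> * \<mu> * (r n k * \<bar>X n k\<bar>) =
             r n k * (\<bar>y n k - Y n\<bar> - \<bar>(s - 1) * \<mu> * X n k\<bar>)"
            by (simp only: right_diff_distrib mult_ac)
        qed
        also have "norm \<dots> \<le> (\<Sum>k\<le>n. r n k * (\<bar>e n k\<bar> + \<bar>Y n\<bar>))"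
        proof (rule order.trans[OF norm_sum sum_mono])
          fix k
          have "\<bar>\<bar>y n k - Y n\<bar> - \<bar>(s - 1) * \<mu> * X n k\<bar>\<bar> \<le> \<bar>e n k\<bar> + \<bar>Y n\<bar>"
            unfolding e_def by linarith
          thus "norm (r n k * (\<bar>y n k - Y n\<bar> - \<bar>(s - 1) * \<mu> * X n k\<bar>)) \<le> r n k * (\<bar>e n k\<bar> + \<bar>Y n\<bar>)"
            using r_nonneg by (simp add: abs_mult mult_left_mono)
        qed
        also have "\<dots> = (\<Sum>k\<le>n. r n k * \<bar>e n k\<bar>) + (\<Sum>k\<le>n. r n k) * \<bar>Y n\<bar>"
          by (simp add: distrib_left sum.distrib sum_distrib_right)
        finally show ?case by (simp add: sum_r)
      qed
    qed
    from tendsto_add[OF this tendsto_mult[OF tendsto_const[of "\<bar>s - 1\<bar> * \<mu>"] aX_lim]]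
    show ?thesis by simp
  qed
  have Yn: "(\<lambda>n. 1 + Y n / sqrt n) \<longlonglongrightarrow> 1"
  proof -
    have "(\<lambda>n. 1 / sqrt (real n)) \<longlonglongrightarrow> 0" by real_asymp
    from tendsto_add[OF tendsto_const[of 1] tendsto_mult[OF Y_lim this]] show ?thesis by simp
  qed
  have "(\<lambda>n. (\<Sum>k\<le>n. r n k * \<bar>y n k - Y n\<bar>) / (1 + Y n / sqrt n) / 2)
     \<longlonglongrightarrow> \<bar>s - 1\<bar> * \<mu> * (2 / (\<tau> * sqrt (2 * pi))) / 1 / 2"
    by (intro tendsto_intros dev_lim Yn) auto
  \<comment> \<open>Inserting \<tau> = \<mu>^(3/2)/\<sigma> leaves one factor sqrt \<mu> in the
    denominator.\<close>
  also have "\<bar>s - 1\<bar> * \<mu> * (2 / (\<tau> * sqrt (2 * pi))) / 1 / 2 = \<bar>s - 1\<bar> * \<sigma> / sqrt (2 * pi * \<mu>)"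
    using \<mu> \<sigma>_pos by (simp add: \<tau>_def real_sqrt_mult field_simps)
  finally have lim: "(\<lambda>n. (\<Sum>k\<le>n. r n k * \<bar>y n k - Y n\<bar>) / (1 + Y n / sqrt n) / 2)
     \<longlonglongrightarrow> \<bar>s - 1\<bar> * \<sigma> / sqrt (2 * pi * \<mu>)" .
  have "eventually (\<lambda>n. 1 + Y n / sqrt n > 0) at_top" by (intro order_tendstoD(1)[OF Yn]) simp
  hence "eventually (\<lambda>n. (\<Sum>k\<le>n. r n k * \<bar>y n k - Y n\<bar>) / (1 + Y n / sqrt n) / 2 =
     sqrt n * ((\<Sum>k\<le>n. \<bar>w k * q k n / (\<Sum>k\<le>n. w k * q k n) - q k n / u n\<bar>) / 2)) at_top"
    using ev_u eventually_gt_at_top[of 0]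
  proof eventually_elim
    case (elim n)
    define c where "c = D * (real n / \<mu>) powr (s - 1)"
    have c: "c \<noteq> 0" using D elim \<mu> by (simp add: c_def)
    have sn: "sqrt n > 0" using elim by simp
    define Z where "Z = 1 + Y n / sqrt n"
    have Z: "Z > 0" using elim by (simp add: Z_def)
    have wy: "w k = c * (1 + y n k / sqrt n)" for k
      using c sn by (simp add: y_def rel_dev_def c_def[symmetric])
    have qr: "q k n = r n k * u n" for k using elim by (simp add: r_def)
    have sum_r: "(\<Sum>k\<le>n. r n k) = 1" using elim by (simp add: r_def u_def sum_divide_distrib[symmetric])
    have "(\<Sum>k\<le>n. w k * q k n) = (\<Sum>k\<le>n. c * u n * (r n k + r n k * y n k / sqrt n))"
      by (intro sum.cong refl) (simp add: wy qr algebra_simps)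
    also have "\<dots> = c * u n * ((\<Sum>k\<le>n. r n k) + Y n / sqrt n)"
      by (simp add: sum_distrib_left[symmetric] sum.distrib Y_def sum_divide_distrib)
    also have "\<dots> = c * u n * Z" by (simp add: sum_r Z_def)
    finally have W: "(\<Sum>k\<le>n. w k * q k n) = c * u n * Z" .
    have summand: "\<bar>w k * q k n / (\<Sum>k\<le>n. w k * q k n) - q k n / u n\<bar> = r n k * \<bar>y n k - Y n\<bar> / Z / sqrt n" for k
    proof -
      have "w k * q k n / (\<Sum>k\<le>n. w k * q k n) = r n k * (1 + y n k / sqrt n) / Z"
        unfolding W unfolding wy qr using c elim by simp
      moreover have "q k n / u n = r n k * Z / Z" using Z by (simp add: r_def)
      ultimately have "w k * q k n / (\<Sum>k\<le>n. w k * q k n) - q k n / u n = r n k * (y n k - Y n) / sqrt n / Z"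
        unfolding Z_def by (simp add: diff_divide_distrib[symmetric] algebra_simps)
      thus ?thesis using Z r_nonneg by (simp add: abs_mult)
    qed
    have "(\<Sum>k\<le>n. \<bar>w k * q k n / (\<Sum>k\<le>n. w k * q k n) - q k n / u n\<bar>) = (\<Sum>k\<le>n. r n k * \<bar>y n k - Y n\<bar>) / Z / sqrt n"
      unfolding summand sum_divide_distrib ..
    thus ?case using sn by (simp add: Z_def)
  qed
  with lim show ?thesis by (rule Lim_transform_eventually)
qed

end

section \<open>Counting labeled compositions\<close>

lemma relabel_id: "relabeling_action C \<Longrightarrow> \<gamma> \<in> objs_of_size C n \<Longrightarrow> relabel C id \<gamma> = \<gamma>"
  by (auto simp: relabeling_action_def)

lemma relabel_closed:
  "relabeling_action C \<Longrightarrow> \<gamma> \<in> objs_of_size C n \<Longrightarrow> \<sigma> permutes {1..n} \<Longrightarrow> relabel C \<sigma> \<gamma> \<in> objs_of_size C n"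
  by (auto simp: relabeling_action_def)

lemma relabel_comp:
  "relabeling_action C \<Longrightarrow> \<gamma> \<in> objs_of_size C n \<Longrightarrow> \<sigma> permutes {1..n} \<Longrightarrow> \<tau> permutes {1..n} \<Longrightarrow>
    relabel C (\<sigma> \<circ> \<tau>) \<gamma> = relabel C \<sigma> (relabel C \<tau> \<gamma>)"
  by (simp add: relabeling_action_def)

lemma osize_objs_of_size: "\<gamma> \<in> objs_of_size C n \<Longrightarrow> osize C \<gamma> = n"
  by (simp add: objs_of_size_def)

lemma placed_cong:
  assumes "\<And>i. i \<in> {1..osize C \<gamma>} \<Longrightarrow> f i = g i"
  shows "placed C f \<gamma> = placed C g \<gamma>"
proof -
  have "restrict (f \<circ> inv \<sigma>) {1..osize C \<gamma>} = restrict (g \<circ> inv \<sigma>) {1..osize C \<gamma>}"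
    if "\<sigma> permutes {1..osize C \<gamma>}" for \<sigma>
    using permutes_in_image[OF permutes_inv[OF that]] assms by (intro restrict_ext) auto
  thus ?thesis unfolding placed_def by (intro Collect_cong ex_cong1) auto
qed

text \<open>A class contains only one pair with a prescribed injective first component: f composed
  with \<open>inv \<sigma>\<close> agrees with f on the labels only if \<sigma> is the
  identity.\<close>

lemma placed_inj:
  assumes C: "relabeling_action C" and \<gamma>: "\<gamma> \<in> objs_of_size C n" "\<gamma>' \<in> objs_of_size C n"
    and f: "inj_on f {1..n}" and eq: "placed C f \<gamma> = placed C f \<gamma>'"
  shows "\<gamma> = \<gamma>'"
proof -
  have "(restrict (f \<circ> inv id) {1..n}, relabel C id \<gamma>) \<in> placed C f \<gamma>"
    unfolding placed_def osize_objs_of_size[OF \<gamma>(1)] using permutes_id by blast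
  hence "(restrict f {1..n}, \<gamma>) \<in> placed C f \<gamma>'"
    using relabel_id[OF C \<gamma>(1)] eq by simp
  then obtain \<sigma> where \<sigma>: "\<sigma> permutes {1..n}" "restrict f {1..n} = restrict (f \<circ> inv \<sigma>) {1..n}"
    "\<gamma> = relabel C \<sigma> \<gamma>'"
    unfolding placed_def osize_objs_of_size[OF \<gamma>(2)] by auto
  have inv: "inv \<sigma> permutes {1..n}" using \<sigma>(1) by (rule permutes_inv)
  have "inv \<sigma> i = i" for i
  proof (cases "i \<in> {1..n}")
    case True
    have "f i = f (inv \<sigma> i)" using fun_cong[OF \<sigma>(2), of i] True by simp
    thus ?thesis using inj_onD[OF f] True permutes_in_image[OF inv] by metis
  qed (use inv in \<open>simp add: permutes_def\<close>)
  hence "inv \<sigma> = id" by auto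
  hence "\<sigma> = id" using permutes_inv_inv[OF \<sigma>(1)] by simp
  thus ?thesis using \<sigma>(3) relabel_id[OF C \<gamma>(2)] by simp
qed

text \<open>The new object is \<gamma> relabeled by the inverse of g composed with f. Together with
  \<open>placed_inj\<close>, a fixed numbering g of U makes the structures on U correspond one to
  one to the objects of size card U.\<close>

lemma placed_change:
  assumes C: "relabeling_action C" and \<gamma>: "\<gamma> \<in> objs_of_size C n"
    and f: "bij_betw f {1..n} U" and g: "bij_betw g {1..n} U"
  obtains \<gamma>' where "\<gamma>' \<in> objs_of_size C n" "placed C g \<gamma>' = placed C f \<gamma>"
proof -
  define \<tau>' where "\<tau>' = (\<lambda>i. if i \<in> {1..n} then inv_into {1..n} f (g i) else i)"
  have "bij_betw (inv_into {1..n} f \<circ> g) {1..n} {1..n}"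
    using g bij_betw_inv_into[OF f] by (rule bij_betw_trans)
  hence "bij_betw \<tau>' {1..n} {1..n}"
    by (rule bij_betw_cong[THEN iffD1, rotated]) (simp add: \<tau>'_def)
  hence \<tau>': "\<tau>' permutes {1..n}" by (rule bij_imp_permutes) (auto simp: \<tau>'_def)
  have f\<tau>': "f (\<tau>' i) = g i" if "i \<in> {1..n}" for i
    using that bij_betw_inv_into_right[OF f, of "g i"] bij_betwE[OF g] by (simp add: \<tau>'_def)
  define \<tau> where "\<tau> = inv \<tau>'"
  have \<tau>: "\<tau> permutes {1..n}" unfolding \<tau>_def using \<tau>' by (rule permutes_inv)
  have inv\<tau>: "inv \<tau> = \<tau>'" unfolding \<tau>_def using \<tau>' by (rule permutes_inv_inv)
  define \<gamma>' where "\<gamma>' = relabel C \<tau> \<gamma>"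
  have \<gamma>': "\<gamma>' \<in> objs_of_size C n" unfolding \<gamma>'_def using C \<gamma> \<tau> by (rule relabel_closed)
  \<comment> \<open>Replacing \<sigma> by \<sigma> \<circ> \<tau> matches the pairs of the two
    classes one by one.\<close>
  have key: "(restrict (g \<circ> inv \<sigma>) {1..n}, relabel C \<sigma> \<gamma>') =
     (restrict (f \<circ> inv (\<sigma> \<circ> \<tau>)) {1..n}, relabel C (\<sigma> \<circ> \<tau>) \<gamma>)" if \<sigma>: "\<sigma> permutes {1..n}" for \<sigma>
  proof -
    have "inv (\<sigma> \<circ> \<tau>) = \<tau>' \<circ> inv \<sigma>"
      using o_inv_distrib[OF permutes_bij[OF \<sigma>] permutes_bij[OF \<tau>]] by (simp add: inv\<tau>)
    hence "restrict (f \<circ> inv (\<sigma> \<circ> \<tau>)) {1..n} = restrict (g \<circ> inv \<sigma>) {1..n}"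
      using f\<tau>' permutes_in_image[OF permutes_inv[OF \<sigma>]] by (intro restrict_ext) auto
    thus ?thesis using relabel_comp[OF C \<gamma> \<sigma> \<tau>] by (simp add: \<gamma>'_def)
  qed
  have "placed C g \<gamma>' = placed C f \<gamma>"
  proof (intro equalityI subsetI)
    fix x assume "x \<in> placed C g \<gamma>'"
    then obtain \<sigma> where "\<sigma> permutes {1..n}" "x = (restrict (g \<circ> inv \<sigma>) {1..n}, relabel C \<sigma> \<gamma>')"
      unfolding placed_def osize_objs_of_size[OF \<gamma>'] by auto
    thus "x \<in> placed C f \<gamma>"
      unfolding placed_def osize_objs_of_size[OF \<gamma>] using key permutes_compose[OF \<tau>] by auto
  next
    fix x assume "x \<in> placed C f \<gamma>"
    then obtain \<sigma> where \<sigma>: "\<sigma> permutes {1..n}" "x = (restrict (f \<circ> inv \<sigma>) {1..n}, relabel C \<sigma> \<gamma>)"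
      unfolding placed_def osize_objs_of_size[OF \<gamma>] by auto
    have "\<sigma> \<circ> \<tau>' permutes {1..n}" using \<tau>' \<sigma>(1) by (rule permutes_compose)
    moreover have "(\<sigma> \<circ> \<tau>') \<circ> \<tau> = \<sigma>"
      using permutes_inv_o(1)[OF \<tau>'] by (simp add: o_assoc[symmetric] \<tau>_def)
    ultimately show "x \<in> placed C g \<gamma>'"
      unfolding placed_def osize_objs_of_size[OF \<gamma>'] using key[of "\<sigma> \<circ> \<tau>'"] \<sigma>(2)
      by (intro CollectI exI[of _ "\<sigma> \<circ> \<tau>'"]) auto
  qed
  with \<gamma>' that show thesis by blast
qed

lemma placed_in_structures_on:
  assumes "\<gamma> \<in> objs_of_size C n" "bij_betw f {1..n} U"
  shows "placed C f \<gamma> \<in> structures_on C U"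
  using assms unfolding structures_on_def objs_of_size_def by auto

lemma structures_on_placed:
  assumes C: "relabeling_action C" and x: "x \<in> structures_on C U" and g: "bij_betw g {1..card U} U"
  obtains \<gamma> where "\<gamma> \<in> objs_of_size C (card U)" "placed C g \<gamma> = x"
proof -
  obtain f \<gamma> where \<gamma>: "\<gamma> \<in> objs C" "bij_betw f {1..osize C \<gamma>} U" "x = placed C f \<gamma>"
    using x by (auto simp: structures_on_def)
  have "osize C \<gamma> = card U" using bij_betw_same_card[OF \<gamma>(2)] by simp
  hence "\<gamma> \<in> objs_of_size C (card U)" "bij_betw f {1..card U} U" using \<gamma> by (auto simp: objs_of_size_def)
  from placed_change[OF C this g] show thesis using that \<gamma>(3) by metis
qed

section \<open>Blocks cut out of a permuted label set\<close>

fun intervals :: "nat \<Rightarrow> nat list \<Rightarrow> nat list list" where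
  "intervals off [] = []"
| "intervals off (c # cs) = [off + 1..<off + c + 1] # intervals (off + c) cs"

lemma length_intervals [simp]: "length (intervals off cs) = length cs"
  by (induction cs arbitrary: off) auto

lemma concat_intervals: "concat (intervals off cs) = [off + 1..<off + sum_list cs + 1]"
proof (induction cs arbitrary: off)
  case (Cons c cs)
  have "[off + 1..<off + c + 1] @ [off + c + 1..<off + c + sum_list cs + 1] = [off + 1..<off + c + sum_list cs + 1]"
    using upt_add_eq_append[of "off + 1" "off + c + 1" "sum_list cs"] by (simp add: add_ac)
  thus ?case using Cons[of "off + c"] by (simp add: add_ac)
qed auto

lemma nth_intervals:
  "i < length cs \<Longrightarrow> intervals off cs ! i = [off + sum_list (take i cs) + 1..<off + sum_list (take i cs) + cs ! i + 1]"
proof (induction cs arbitrary: off i)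
  case (Cons c cs)
  thus ?case by (cases i) (auto simp: add_ac)
qed auto

lemma map_length_intervals: "map length (intervals off cs) = cs"
  by (induction cs arbitrary: off) auto

lemma distinct_concat_disjoint:
  assumes "distinct (concat xss)" "i < length xss" "j < length xss" "i \<noteq> j"
  shows "set (xss ! i) \<inter> set (xss ! j) = {}"
  using assms
proof (induction xss arbitrary: i j)
  case (Cons xs xss)
  thus ?case
    by (cases i; cases j) (auto simp: Int_commute dest!: nth_mem)
qed auto

text \<open>The blocks produced by \<open>labeled_subst\<close> from components of sizes cs, listed
  in the order of the components.\<close>

definition blocks :: "(nat \<Rightarrow> nat) \<Rightarrow> nat list \<Rightarrow> nat set list" where
  "blocks \<sigma> cs = map (\<lambda>I. \<sigma> ` set I) (intervals 0 cs)"

lemma length_blocks [simp]: "length (blocks \<sigma> cs) = length cs"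
  by (simp add: blocks_def)

lemma blocks_disjoint:
  assumes "\<sigma> permutes {1..sum_list cs}" "i < length cs" "j < length cs" "i \<noteq> j"
  shows "blocks \<sigma> cs ! i \<inter> blocks \<sigma> cs ! j = {}"
proof -
  have "set (intervals 0 cs ! i) \<inter> set (intervals 0 cs ! j) = {}"
    using assms by (intro distinct_concat_disjoint) (auto simp: concat_intervals)
  thus ?thesis using assms permutes_inj[OF assms(1)]
    by (simp add: blocks_def image_Int[symmetric])
qed

lemma card_blocks:
  assumes "\<sigma> permutes {1..n}"
  shows "map card (blocks \<sigma> cs) = cs"
proof -
  have "card (\<sigma> ` set I) = length I" if "I \<in> set (intervals 0 cs)" for I
  proof -
    have "distinct (concat (intervals 0 cs))" by (simp add: concat_intervals)
    hence "distinct I" using that by (simp add: distinct_concat_iff)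
    thus ?thesis using permutes_inj[OF assms] by (simp add: card_image inj_on_subset distinct_card)
  qed
  hence "map card (blocks \<sigma> cs) = map length (intervals 0 cs)" by (simp add: blocks_def)
  thus ?thesis by (simp add: map_length_intervals)
qed

lemma Union_blocks:
  assumes "\<sigma> permutes {1..sum_list cs}"
  shows "\<Union> (set (blocks \<sigma> cs)) = {1..sum_list cs}"
proof -
  have "\<Union> (set (blocks \<sigma> cs)) = \<sigma> ` set (concat (intervals 0 cs))"
    by (auto simp: blocks_def)
  also have "set (concat (intervals 0 cs)) = {1..sum_list cs}" by (auto simp: concat_intervals)
  also have "\<sigma> ` {1..sum_list cs} = {1..sum_list cs}" using assms by (rule permutes_image)
  finally show ?thesis .
qed

text \<open>Two empty blocks would coincide, so positive sizes are essential; this is where the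
  absence of inner objects of size 0 enters.\<close>

lemma distinct_blocks:
  assumes "\<sigma> permutes {1..sum_list cs}" "0 \<notin> set cs"
  shows "distinct (blocks \<sigma> cs)" "{} \<notin> set (blocks \<sigma> cs)"
proof -
  have ne: "blocks \<sigma> cs ! i \<noteq> {}" if "i < length cs" for i
  proof -
    have "cs ! i \<noteq> 0" using that assms(2) nth_mem by metis
    thus ?thesis using that by (simp add: blocks_def nth_intervals)
  qed
  thus "{} \<notin> set (blocks \<sigma> cs)" by (auto simp: in_set_conv_nth)
  show "distinct (blocks \<sigma> cs)"
    unfolding distinct_conv_nth using blocks_disjoint[OF assms(1)] ne by (metis inf.idem length_blocks)
qed

lemma listset_conv: "listset As = {xs. list_all2 (\<in>) xs As}"
  by (induction As) (auto simp: set_Cons_def list_all2_Cons2)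

lemma card_listset: "(\<And>A. A \<in> set As \<Longrightarrow> finite A) \<Longrightarrow> finite (listset As) \<and> card (listset As) = prod_list (map card As)"
proof (induction As)
  case (Cons A As)
  have "set_Cons A (listset As) = (\<lambda>(x, xs). x # xs) ` (A \<times> listset As)" by (auto simp: set_Cons_def)
  moreover have "inj_on (\<lambda>(x, xs). x # xs) (A \<times> listset As)" by (auto simp: inj_on_def)
  ultimately show ?case using Cons by (simp add: card_image card_cartesian_product)
qed auto

text \<open>A permutation with prescribed blocks is encoded by the list of its words on the intervals.\<close>

lemma card_permutes_with_blocks:
  assumes Us: "distinct Us" "\<Union> (set Us) = {1..n}" "\<And>i j. i < length Us \<Longrightarrow> j < length Us \<Longrightarrow> i \<noteq> j \<Longrightarrow> Us ! i \<inter> Us ! j = {}"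
  shows "finite {\<sigma>. \<sigma> permutes {1..n} \<and> blocks \<sigma> (map card Us) = Us}"
    and "card {\<sigma>. \<sigma> permutes {1..n} \<and> blocks \<sigma> (map card Us) = Us} = (\<Prod>U\<in>set Us. fact (card U))"
proof -
  let ?S = "{\<sigma>. \<sigma> permutes {1..n} \<and> blocks \<sigma> (map card Us) = Us}"
  let ?iv = "intervals 0 (map card Us)"
  show fin: "finite ?S" by (rule finite_subset[OF _ finite_permutations[of "{1..n}"]]) auto
  have finU: "finite U" if "U \<in> set Us" for U
    using that Us(2) by (metis Union_upper finite_atLeastAtMost finite_subset)
  have sum: "sum_list (map card Us) = n"
  proof -
    have "card (\<Union> (set Us)) = sum card (set Us)"
    proof (rule card_Union_disjoint)
      show "disjoint (set Us)"
        unfolding disjoint_def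
      proof (intro ballI impI)
        fix U V assume "U \<in> set Us" "V \<in> set Us" "U \<noteq> V"
        thus "U \<inter> V = {}" using Us(3) by (metis in_set_conv_nth)
      qed
    qed (use finU in auto)
    thus ?thesis using Us(1,2) by (simp add: sum_list_distinct_conv_sum_set)
  qed
  have cc: "concat ?iv = [1..<n + 1]" by (simp add: concat_intervals sum)
  have "bij_betw (\<lambda>\<sigma>. map (map \<sigma>) ?iv) ?S (listset (map permutations_of_set Us))"
    unfolding bij_betw_def
  proof (intro conjI equalityI subsetI)
    show "inj_on (\<lambda>\<sigma>. map (map \<sigma>) ?iv) ?S"
    proof (rule inj_onI)
      fix \<sigma> \<tau> assume \<sigma>: "\<sigma> \<in> ?S" and \<tau>: "\<tau> \<in> ?S" and eq: "map (map \<sigma>) ?iv = map (map \<tau>) ?iv"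
      have "concat (map (map \<sigma>) ?iv) = concat (map (map \<tau>) ?iv)" by (rule arg_cong[OF eq])
      hence "map \<sigma> [1..<n + 1] = map \<tau> [1..<n + 1]" by (simp only: map_concat[symmetric] cc)
      hence "\<forall>i\<in>set [1..<n + 1]. \<sigma> i = \<tau> i" by (simp only: map_eq_conv)
      hence "\<sigma> i = \<tau> i" if "i \<in> {1..n}" for i using that by (simp del: upt_Suc)
      moreover have "\<sigma> i = \<tau> i" if "i \<notin> {1..n}" for i
        using that \<sigma> \<tau> by (simp add: permutes_def)
      ultimately show "\<sigma> = \<tau>" by (metis ext)
    qed
    fix ws assume "ws \<in> (\<lambda>\<sigma>. map (map \<sigma>) ?iv) ` ?S"
    then obtain \<sigma> where \<sigma>: "\<sigma> permutes {1..n}" "blocks \<sigma> (map card Us) = Us" "ws = map (map \<sigma>) ?iv" by auto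
    have "distinct (concat ?iv)" by (simp add: cc)
    hence "map \<sigma> I \<in> permutations_of_set (\<sigma> ` set I)" if "I \<in> set ?iv" for I
      using that permutes_inj[OF \<sigma>(1)]
      by (intro permutations_of_setI) (auto simp: distinct_map distinct_concat_iff intro: inj_on_subset)
    hence "list_all2 (\<in>) (map (map \<sigma>) ?iv) (map permutations_of_set (blocks \<sigma> (map card Us)))"
      by (auto simp: blocks_def list_all2_conv_all_nth)
    thus "ws \<in> listset (map permutations_of_set Us)"
      by (simp add: listset_conv \<sigma>)
  next
    fix ws assume "ws \<in> listset (map permutations_of_set Us)"
    hence ws: "length ws = length Us" "\<And>i. i < length Us \<Longrightarrow> ws ! i \<in> permutations_of_set (Us ! i)"
      by (auto simp: listset_conv list_all2_conv_all_nth)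
    have setw: "set (ws ! i) = Us ! i" and lenw: "length (ws ! i) = card (Us ! i)" if "i < length Us" for i
      using permutations_of_setD[OF ws(2)[OF that]] by (auto simp: distinct_card[symmetric])
    have lens: "map length ws = map card Us" using ws(1) lenw by (intro nth_equalityI) auto
    define xs where "xs = concat ws"
    have len: "length xs = n" using sum lens by (simp add: xs_def length_concat)
    have setx: "set xs = {1..n}"
    proof -
      have "set xs = \<Union> (set (map set ws))" by (simp add: xs_def)
      also have "map set ws = Us" using ws(1) setw by (intro nth_equalityI) auto
      finally show ?thesis using Us(2) by simp
    qed
    have dist: "distinct xs" by (rule card_distinct) (simp add: len setx)
    \<comment> \<open>The concatenated words are the one-line notation of \<sigma>; labels start at
      1 and list positions at 0.\<close>
    define \<sigma> where "\<sigma> = (\<lambda>j. if j \<in> {1..n} then xs ! (j - 1) else j)"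
    have "map \<sigma> [1..<n + 1] = xs"
      using len by (intro nth_equalityI) (auto simp: \<sigma>_def simp del: upt_Suc)
    have bij: "bij_betw \<sigma> {1..n} {1..n}"
    proof -
      have "inj_on \<sigma> {1..n}"
        using dist len by (auto simp: inj_on_def \<sigma>_def nth_eq_iff_index_eq)
      moreover have "set [1..<n + 1] = {1..n}" by auto
      hence "set (map \<sigma> [1..<n + 1]) = \<sigma> ` {1..n}" by (simp only: set_map)
      hence "\<sigma> ` {1..n} = {1..n}" unfolding \<open>map \<sigma> [1..<n + 1] = xs\<close> setx by (rule sym)
      ultimately show ?thesis by (simp add: bij_betw_def)
    qed
    have perm: "\<sigma> permutes {1..n}" using bij by (rule bij_imp_permutes) (auto simp: \<sigma>_def)
    have eq: "map (map \<sigma>) ?iv = ws"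
    proof (rule concat_injective)
      show "concat (map (map \<sigma>) ?iv) = concat ws"
        unfolding map_concat[symmetric] cc \<open>map \<sigma> [1..<n + 1] = xs\<close> xs_def ..
      show "length (map (map \<sigma>) ?iv) = length ws" by (simp add: ws(1))
      have "length (?iv ! i) = card (Us ! i)" if "i < length Us" for i
        using arg_cong[OF map_length_intervals[of 0 "map card Us"], of "\<lambda>l. l ! i"] that by simp
      thus "\<forall>(x, y)\<in>set (zip (map (map \<sigma>) ?iv) ws). length x = length y"
        using ws(1) lenw by (auto simp: set_zip)
    qed
    have "blocks \<sigma> (map card Us) = Us"
    proof (rule nth_equalityI)
      fix i assume i: "i < length (blocks \<sigma> (map card Us))"
      have "blocks \<sigma> (map card Us) ! i = set (map (map \<sigma>) ?iv ! i)" using i by (simp add: blocks_def)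
      thus "blocks \<sigma> (map card Us) ! i = Us ! i" using eq setw i by simp
    qed simp
    thus "ws \<in> (\<lambda>\<sigma>. map (map \<sigma>) ?iv) ` ?S" using perm eq by blast
  qed
  hence "card ?S = card (listset (map permutations_of_set Us))" by (rule bij_betw_same_card)
  also have "\<dots> = prod_list (map card (map permutations_of_set Us))"
    by (intro card_listset[THEN conjunct2]) (use finU in auto)
  also have "\<dots> = prod_list (map (\<lambda>U. fact (card U)) Us)"
    unfolding map_map o_def using finU by (intro arg_cong[of _ _ prod_list] map_cong) auto
  also have "\<dots> = (\<Prod>U\<in>set Us. fact (card U))"
    using Us(1) by (simp add: prod.distinct_set_conv_list)
  finally show "card ?S = (\<Prod>U\<in>set Us. fact (card U))" .
qed

definition obj_lists :: "('b, 'm) cclass_scheme \<Rightarrow> nat \<Rightarrow> nat \<Rightarrow> 'b list set" where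
  "obj_lists B k n = {\<beta>s. length \<beta>s = k \<and> set \<beta>s \<subseteq> objs B \<and> sum_list (map (osize B) \<beta>s) = n}"

section \<open>Fibers of the labeled substitution\<close>

locale labeled_composition =
  fixes A :: "'a lclass" and B :: "'b lclass"
  assumes A: "relabeling_action A" and B: "relabeling_action B" and B0: "objs_of_size B 0 = {}"
begin

abbreviation sizes :: "'b list \<Rightarrow> nat list" where
  "sizes \<beta>s \<equiv> map (osize B) \<beta>s"

abbreviation embedding :: "(nat \<Rightarrow> nat) \<Rightarrow> nat list \<Rightarrow> nat \<Rightarrow> nat \<Rightarrow> nat" where
  "embedding \<sigma> cs i \<equiv> \<lambda>j. \<sigma> (sum_list (take i cs) + j)"

lemma sizes_pos: "\<beta>s \<in> obj_lists B k n \<Longrightarrow> 0 \<notin> set (sizes \<beta>s)"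
  using B0 by (auto simp: obj_lists_def objs_of_size_def)

lemma nth_blocks_image:
  assumes "i < length cs"
  shows "blocks \<sigma> cs ! i = embedding \<sigma> cs i ` {1..cs ! i}"
proof -
  have "set (intervals 0 cs ! i) = (\<lambda>j. sum_list (take i cs) + j) ` {1..cs ! i}"
    using assms by (auto simp: nth_intervals image_iff Suc_le_eq intro!: bexI[of _ "_ - sum_list (take i cs)"])
  thus ?thesis using assms by (simp only: blocks_def nth_map length_intervals image_image)
qed

lemma bij_betw_embedding:
  assumes "\<sigma> permutes {1..n}" "i < length cs"
  shows "bij_betw (embedding \<sigma> cs i) {1..cs ! i} (blocks \<sigma> cs ! i)"
  unfolding bij_betw_def nth_blocks_image[OF assms(2)]
  by (simp add: inj_on_def inj_eq[OF permutes_inj[OF assms(1)]])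

text \<open>Passes from components numbered from 1 and recovered through \<open>inv_into\<close> to
  list positions from 0. The recovery is unambiguous because the blocks are distinct.\<close>

lemma labeled_subst_eq:
  fixes \<sigma> \<beta>s defines "Us \<equiv> blocks \<sigma> (sizes \<beta>s)"
  assumes \<beta>s: "\<beta>s \<in> obj_lists B k n" and \<sigma>: "\<sigma> permutes {1..n}" and \<alpha>: "\<alpha> \<in> objs_of_size A k"
  obtains b where "labeled_subst A B \<sigma> \<alpha> \<beta>s = LComp (set Us) b (placed A (\<lambda>i. Us ! (i - 1)) \<alpha>)"
    "b \<in> extensional (set Us)"
    "\<And>i. i < k \<Longrightarrow> b (Us ! i) = placed B (embedding \<sigma> (sizes \<beta>s) i) (\<beta>s ! i)"
proof -
  have len: "length \<beta>s = k" and sum: "sum_list (sizes \<beta>s) = n" using \<beta>s by (auto simp: obj_lists_def)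
  define emb where "emb = (\<lambda>i j. \<sigma> (sum_list (map (osize B) (take (i - 1) \<beta>s)) + j))"
  define block where "block = (\<lambda>i. emb i ` {1..osize B (\<beta>s ! (i - 1))})"
  define b where "b = restrict (\<lambda>U. let i = inv_into {1..k} block U in placed B (emb i) (\<beta>s ! (i - 1))) (block ` {1..k})"
  have emb: "emb (Suc i) = embedding \<sigma> (sizes \<beta>s) i" for i by (simp add: emb_def take_map)
  have block: "block (Suc i) = Us ! i" if "i < k" for i
    using that len by (simp add: block_def emb Us_def nth_blocks_image)
  have block': "block i = Us ! (i - 1)" if "i \<in> {1..k}" for i
    
  proof -
    have "i - 1 < k" "Suc (i - 1) = i" using that by auto
    thus ?thesis using block[of "i - 1"] by metis
  qed
  have lenU: "length Us = k" by (simp add: Us_def len)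
  have dist: "distinct Us"
    unfolding Us_def using sizes_pos[OF \<beta>s] \<sigma> sum by (intro distinct_blocks) auto
  have inj: "inj_on block {1..k}"
  proof (rule inj_onI)
    fix i j assume "i \<in> {1..k}" "j \<in> {1..k}" "block i = block j"
    thus "i = j" using block' dist lenU by (auto simp: nth_eq_iff_index_eq)
  qed
  have img: "block ` {1..k} = set Us"
  proof -
    have "block ` {1..k} = (\<lambda>i. Us ! i) ` {0..<k}"
    proof (intro equalityI subsetI)
      fix x assume "x \<in> block ` {1..k}"
      then obtain i where "i \<in> {1..k}" "x = Us ! (i - 1)" using block' by auto
      thus "x \<in> (\<lambda>i. Us ! i) ` {0..<k}" by (intro image_eqI[of _ _ "i - 1"]) auto
    next
      fix x assume "x \<in> (\<lambda>i. Us ! i) ` {0..<k}"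
      then obtain i where "i < k" "x = Us ! i" by auto
      thus "x \<in> block ` {1..k}" using block by (intro image_eqI[of _ _ "Suc i"]) auto
    qed
    thus ?thesis using lenU by (metis list.set_map map_nth set_upt)
  qed
  have "labeled_subst A B \<sigma> \<alpha> \<beta>s = LComp (block ` {1..k}) b (placed A block \<alpha>)"
    unfolding labeled_subst_def Let_def len b_def block_def emb_def ..
  also have "placed A block \<alpha> = placed A (\<lambda>i. Us ! (i - 1)) \<alpha>"
    using block' osize_objs_of_size[OF \<alpha>] by (intro placed_cong) auto
  finally have 1: "labeled_subst A B \<sigma> \<alpha> \<beta>s = LComp (set Us) b (placed A (\<lambda>i. Us ! (i - 1)) \<alpha>)"
    unfolding img .
  have "b (Us ! i) = placed B (embedding \<sigma> (sizes \<beta>s) i) (\<beta>s ! i)" if "i < k" for i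
  proof -
    have "inv_into {1..k} block (Us ! i) = Suc i"
      using that by (subst block[OF that, symmetric]) (intro inv_into_f_f[OF inj], auto)
    moreover have "Us ! i \<in> block ` {1..k}" using img that lenU by simp
    ultimately show ?thesis by (simp add: b_def Let_def emb)
  qed
  moreover have "b \<in> extensional (set Us)" unfolding b_def img by simp
  ultimately show thesis using that 1 by blast
qed

lemma labeled_subst_in_objs:
  assumes \<beta>s: "\<beta>s \<in> obj_lists B k n" and \<sigma>: "\<sigma> permutes {1..n}" and \<alpha>: "\<alpha> \<in> objs_of_size A k"
  obtains P b a where "labeled_subst A B \<sigma> \<alpha> \<beta>s = LComp P b a" "partition_on {1..n} P" "card P = k"
    "b \<in> (\<Pi>\<^sub>E U\<in>P. structures_on B U)" "a \<in> structures_on A P"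
proof -
  define Us where "Us = blocks \<sigma> (sizes \<beta>s)"
  have len: "length \<beta>s = k" and sum: "sum_list (sizes \<beta>s) = n" using \<beta>s by (auto simp: obj_lists_def)
  have \<sigma>': "\<sigma> permutes {1..sum_list (sizes \<beta>s)}" using \<sigma> sum by simp
  have lenU: "length Us = k" by (simp add: Us_def len)
  have dist: "distinct Us" "{} \<notin> set Us"
    unfolding Us_def using distinct_blocks[OF \<sigma>' sizes_pos[OF \<beta>s]] by auto
  obtain b where b: "labeled_subst A B \<sigma> \<alpha> \<beta>s = LComp (set Us) b (placed A (\<lambda>i. Us ! (i - 1)) \<alpha>)"
    "b \<in> extensional (set Us)"
    "\<And>i. i < k \<Longrightarrow> b (Us ! i) = placed B (embedding \<sigma> (sizes \<beta>s) i) (\<beta>s ! i)"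
    using labeled_subst_eq[OF \<beta>s \<sigma> \<alpha>] unfolding Us_def by blast
  show thesis
  proof (rule that[OF b(1)])
    show "partition_on {1..n} (set Us)"
    proof (rule partition_onI)
      show "\<Union> (set Us) = {1..n}" unfolding Us_def using Union_blocks[OF \<sigma>'] sum by simp
      fix p p' assume "p \<in> set Us" "p' \<in> set Us" "p \<noteq> p'"
      thus "disjnt p p'" using blocks_disjoint[OF \<sigma>'] lenU len
        unfolding in_set_conv_nth Us_def disjnt_def by (metis length_map)
    qed (use dist in auto)
    show "card (set Us) = k" using dist lenU by (simp add: distinct_card)
    show "b \<in> (\<Pi>\<^sub>E U\<in>set Us. structures_on B U)"
    proof (rule PiE_I)
      fix U assume "U \<in> set Us"
      then obtain i where i: "i < k" "U = Us ! i" using lenU by (auto simp: in_set_conv_nth)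
      have "\<beta>s ! i \<in> objs_of_size B (sizes \<beta>s ! i)"
        using \<beta>s i(1) len nth_mem[of i \<beta>s] by (auto simp: obj_lists_def objs_of_size_def)
      thus "b U \<in> structures_on B U"
        unfolding i(2) b(3)[OF i(1)] unfolding Us_def
        by (rule placed_in_structures_on[OF _ bij_betw_embedding[OF \<sigma>]]) (use i(1) len in simp)
    qed (use b(2) in \<open>auto simp: extensional_def\<close>)
    have "bij_betw (\<lambda>i. Us ! (i - 1)) {1..k} (set Us)"
    proof -
      have "bij_betw (\<lambda>i. i - 1) {1..k} {..<k}"
        by (rule bij_betw_byWitness[of _ Suc]) auto
      moreover have "bij_betw ((!) Us) {..<k} (set Us)" using dist lenU by (intro bij_betw_nth) auto
      ultimately show ?thesis using bij_betw_trans by (fastforce simp: o_def)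
    qed
    thus "placed A (\<lambda>i. Us ! (i - 1)) \<alpha> \<in> structures_on A (set Us)"
      using \<alpha> by (rule placed_in_structures_on[rotated])
  qed
qed

text \<open>
  A triple \<open>(\<beta>s, \<alpha>, \<sigma>)\<close> in the fiber is determined by \<open>\<sigma>\<close> and by the order in which it produces the
  blocks of \<open>P\<close>, and every ordering of \<open>P\<close> together with a compatible \<open>\<sigma>\<close> arises.
\<close>

lemma card_labeled_subst_fiber:
  assumes P: "partition_on {1..n} P" and b: "b \<in> (\<Pi>\<^sub>E U\<in>P. structures_on B U)" and a: "a \<in> structures_on A P"
  shows "card {(\<beta>s, \<alpha>, \<sigma>). \<beta>s \<in> obj_lists B (card P) n \<and> \<alpha> \<in> objs_of_size A (card P) \<and>
           \<sigma> permutes {1..n} \<and> labeled_subst A B \<sigma> \<alpha> \<beta>s = LComp P b a} =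
         fact (card P) * (\<Prod>U\<in>P. fact (card U))"
proof -
  define k where "k = card P"
  have finP: "finite P" by (rule finite_elements[OF _ P]) simp
  let ?T = "{(\<beta>s, \<alpha>, \<sigma>). \<beta>s \<in> obj_lists B k n \<and> \<alpha> \<in> objs_of_size A k \<and>
           \<sigma> permutes {1..n} \<and> labeled_subst A B \<sigma> \<alpha> \<beta>s = LComp P b a}"
  let ?S = "SIGMA Us:permutations_of_set P. {\<sigma>. \<sigma> permutes {1..n} \<and> blocks \<sigma> (map card Us) = Us}"
  let ?h = "\<lambda>(\<beta>s, \<alpha>, \<sigma>). (blocks \<sigma> (sizes \<beta>s), \<sigma>)"
  have T: "set (blocks \<sigma> (sizes \<beta>s)) = P" "distinct (blocks \<sigma> (sizes \<beta>s))" "map card (blocks \<sigma> (sizes \<beta>s)) = sizes \<beta>s"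
    "length \<beta>s = k"
    "a = placed A (\<lambda>i. blocks \<sigma> (sizes \<beta>s) ! (i - 1)) \<alpha>"
    "\<And>i. i < k \<Longrightarrow> b (blocks \<sigma> (sizes \<beta>s) ! i) = placed B (embedding \<sigma> (sizes \<beta>s) i) (\<beta>s ! i)"
    if "(\<beta>s, \<alpha>, \<sigma>) \<in> ?T" for \<beta>s \<alpha> \<sigma>
  proof -
    have t: "\<beta>s \<in> obj_lists B k n" "\<alpha> \<in> objs_of_size A k" "\<sigma> permutes {1..n}"
      "labeled_subst A B \<sigma> \<alpha> \<beta>s = LComp P b a" using that by auto
    obtain b' where b': "labeled_subst A B \<sigma> \<alpha> \<beta>s = LComp (set (blocks \<sigma> (sizes \<beta>s))) b' (placed A (\<lambda>i. blocks \<sigma> (sizes \<beta>s) ! (i - 1)) \<alpha>)"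
      "\<And>i. i < k \<Longrightarrow> b' (blocks \<sigma> (sizes \<beta>s) ! i) = placed B (embedding \<sigma> (sizes \<beta>s) i) (\<beta>s ! i)"
      using labeled_subst_eq[OF t(1,3,2)] by blast
    show "set (blocks \<sigma> (sizes \<beta>s)) = P" "a = placed A (\<lambda>i. blocks \<sigma> (sizes \<beta>s) ! (i - 1)) \<alpha>"
      "\<And>i. i < k \<Longrightarrow> b (blocks \<sigma> (sizes \<beta>s) ! i) = placed B (embedding \<sigma> (sizes \<beta>s) i) (\<beta>s ! i)"
      using b' t(4) by auto
    show "map card (blocks \<sigma> (sizes \<beta>s)) = sizes \<beta>s" using t(3) by (rule card_blocks)
    show "length \<beta>s = k" using t(1) by (simp add: obj_lists_def)
    show "distinct (blocks \<sigma> (sizes \<beta>s))"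
      using t(1,3) sizes_pos[OF t(1)] by (intro distinct_blocks) (auto simp: obj_lists_def)
  qed
  have "bij_betw ?h ?T ?S"
    unfolding bij_betw_def
  proof (intro conjI equalityI subsetI)
    \<comment> \<open>The cardinals of the blocks give back the sizes; with the numberings then
      fixed, each component and the outer object are determined by their structures, by
      \<open>placed_inj\<close>.\<close>
    show "inj_on ?h ?T"
    proof (rule inj_onI)
      fix x y assume x: "x \<in> ?T" and y: "y \<in> ?T" and eq: "?h x = ?h y"
      obtain \<beta>s \<alpha> \<sigma> where x': "x = (\<beta>s, \<alpha>, \<sigma>)" by (cases x)
      obtain \<beta>s' \<alpha>' \<sigma>' where y': "y = (\<beta>s', \<alpha>', \<sigma>')" by (cases y)
      have \<sigma>: "\<sigma>' = \<sigma>" and bl: "blocks \<sigma> (sizes \<beta>s') = blocks \<sigma> (sizes \<beta>s)" using eq x' y' by auto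
      note Tx = T[OF x[unfolded x']] and Ty = T[OF y[unfolded y'], unfolded \<sigma>]
      have sz: "sizes \<beta>s' = sizes \<beta>s" using Tx(3) Ty(3) bl by metis
      have perm: "\<sigma> permutes {1..n}" and mem: "\<beta>s \<in> obj_lists B k n" "\<beta>s' \<in> obj_lists B k n"
        "\<alpha> \<in> objs_of_size A k" "\<alpha>' \<in> objs_of_size A k"
        using x y by (auto simp: x' y')
      have "\<beta>s ! i = \<beta>s' ! i" if i: "i < k" for i
      proof (rule placed_inj[OF B])
        show "placed B (embedding \<sigma> (sizes \<beta>s) i) (\<beta>s ! i) = placed B (embedding \<sigma> (sizes \<beta>s) i) (\<beta>s' ! i)"
          using Tx(6)[OF i] Ty(6)[OF i] by (simp add: sz)
        show "\<beta>s ! i \<in> objs_of_size B (sizes \<beta>s ! i)"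
          using mem(1) i Tx(4) nth_mem[of i \<beta>s] by (auto simp: obj_lists_def objs_of_size_def)
        have "sizes \<beta>s ! i = sizes \<beta>s' ! i" using sz by simp
        thus "\<beta>s' ! i \<in> objs_of_size B (sizes \<beta>s ! i)"
          using mem(2) i Ty(4) nth_mem[of i \<beta>s'] by (auto simp: obj_lists_def objs_of_size_def)
        show "inj_on (embedding \<sigma> (sizes \<beta>s) i) {1..sizes \<beta>s ! i}"
          using bij_betw_embedding[OF perm, of i "sizes \<beta>s"] i Tx(4) by (simp add: bij_betw_def)
      qed
      hence "\<beta>s = \<beta>s'" using Tx(4) Ty(4) by (intro nth_equalityI) auto
      moreover have "\<alpha> = \<alpha>'"
      proof (rule placed_inj[OF A mem(3,4)])
        show "placed A (\<lambda>i. blocks \<sigma> (sizes \<beta>s) ! (i - 1)) \<alpha> = placed A (\<lambda>i. blocks \<sigma> (sizes \<beta>s) ! (i - 1)) \<alpha>'"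
          using Tx(5) Ty(5) bl by simp
        show "inj_on (\<lambda>i. blocks \<sigma> (sizes \<beta>s) ! (i - 1)) {1..k}"
          using Tx(2,4) by (auto simp: inj_on_def nth_eq_iff_index_eq)
      qed
      ultimately show "x = y" by (simp add: x' y' \<sigma>)
    qed
    fix z assume "z \<in> ?h ` ?T"
    then obtain \<beta>s \<alpha> \<sigma> where z: "(\<beta>s, \<alpha>, \<sigma>) \<in> ?T" "z = (blocks \<sigma> (sizes \<beta>s), \<sigma>)" by auto
    thus "z \<in> ?S" using T(1,2,3)[OF z(1)] by (auto intro: permutations_of_setI)
  next
    fix z assume "z \<in> ?S"
    then obtain Us \<sigma> where z: "z = (Us, \<sigma>)" "set Us = P" "distinct Us" "\<sigma> permutes {1..n}" "blocks \<sigma> (map card Us) = Us"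
      by (auto dest: permutations_of_setD)
    have lenU: "length Us = k" using z by (simp add: k_def distinct_card[symmetric])
    \<comment> \<open>The order of the blocks and \<sigma> prescribe a numbering of each block, and
      every structure has a representative in that numbering.\<close>
    have ex\<beta>: "\<exists>\<beta>. \<beta> \<in> objs_of_size B (card (Us ! i)) \<and> placed B (embedding \<sigma> (map card Us) i) \<beta> = b (Us ! i)" if i: "i < k" for i
    proof -
      have "bij_betw (embedding \<sigma> (map card Us) i) {1..map card Us ! i} (blocks \<sigma> (map card Us) ! i)"
        using i lenU by (intro bij_betw_embedding[OF z(4)]) auto
      hence bij: "bij_betw (embedding \<sigma> (map card Us) i) {1..card (Us ! i)} (Us ! i)"
        using i lenU by (simp add: z(5))
      have "Us ! i \<in> P" using i lenU z(2) by auto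
      hence "b (Us ! i) \<in> structures_on B (Us ! i)" using b by auto
      from structures_on_placed[OF B this bij] show ?thesis by metis
    qed
    then obtain \<beta> where \<beta>: "\<And>i. i < k \<Longrightarrow> \<beta> i \<in> objs_of_size B (card (Us ! i))"
      "\<And>i. i < k \<Longrightarrow> placed B (embedding \<sigma> (map card Us) i) (\<beta> i) = b (Us ! i)" by metis
    define \<beta>s where "\<beta>s = map \<beta> [0..<k]"
    have sz: "sizes \<beta>s = map card Us"
      using \<beta>(1) lenU by (intro nth_equalityI) (auto simp: \<beta>s_def objs_of_size_def)
    have \<beta>s: "\<beta>s \<in> obj_lists B k n"
    proof -
      have "sum_list (map card Us) = sum card P" using z(2,3) by (simp add: sum_list_distinct_conv_sum_set)
      also have "\<dots> = card (\<Union> P)"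
        using partition_onD2[OF P] partition_onD1[OF P]
        by (intro card_Union_disjoint[symmetric]) (metis Union_upper finite_atLeastAtMost finite_subset)+
      also have "\<dots> = n" unfolding partition_onD1[OF P, symmetric] by simp
      finally show ?thesis using \<beta>(1) by (auto simp: obj_lists_def sz[symmetric] \<beta>s_def objs_of_size_def)
    qed
    have "bij_betw (\<lambda>i. Us ! (i - 1)) {1..card P} P"
    proof -
      have "bij_betw (\<lambda>i. i - 1) {1..k} {..<k}"
        by (rule bij_betw_byWitness[of _ Suc]) auto
      moreover have "bij_betw ((!) Us) {..<k} P" using z(2,3) lenU by (intro bij_betw_nth) auto
      ultimately show ?thesis using bij_betw_trans by (fastforce simp: o_def k_def)
    qed
    from structures_on_placed[OF A a this]
    obtain \<alpha> where \<alpha>: "\<alpha> \<in> objs_of_size A k" "placed A (\<lambda>i. Us ! (i - 1)) \<alpha> = a" by (auto simp: k_def)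
    obtain b' where b': "labeled_subst A B \<sigma> \<alpha> \<beta>s = LComp (set (blocks \<sigma> (sizes \<beta>s))) b' (placed A (\<lambda>i. blocks \<sigma> (sizes \<beta>s) ! (i - 1)) \<alpha>)"
      "b' \<in> extensional (set (blocks \<sigma> (sizes \<beta>s)))"
      "\<And>i. i < k \<Longrightarrow> b' (blocks \<sigma> (sizes \<beta>s) ! i) = placed B (embedding \<sigma> (sizes \<beta>s) i) (\<beta>s ! i)"
      using labeled_subst_eq[OF \<beta>s z(4) \<alpha>(1)] by blast
    have "b' = b"
    proof (rule extensionalityI)
      show "b' \<in> extensional P" using b'(2) by (simp add: sz z(2,5))
      show "b \<in> extensional P" using b by (auto simp: PiE_def)
      fix U assume "U \<in> P"
      then obtain i where i: "i < k" "U = Us ! i" using z(2) lenU by (metis in_set_conv_nth)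
      have "\<beta>s ! i = \<beta> i" using i(1) by (simp add: \<beta>s_def)
      thus "b' U = b U" using b'(3)[OF i(1)] \<beta>(2)[OF i(1)] by (simp only: i(2) sz z(5))
    qed
    hence "labeled_subst A B \<sigma> \<alpha> \<beta>s = LComp P b a" using b'(1) \<alpha>(2) by (simp add: sz z(2,5))
    hence "(\<beta>s, \<alpha>, \<sigma>) \<in> ?T" using \<beta>s \<alpha>(1) z(4) by auto
    moreover have "z = ?h (\<beta>s, \<alpha>, \<sigma>)" by (simp only: sz z(1,5) prod.case)
    ultimately show "z \<in> ?h ` ?T" by (rule image_eqI[rotated])
  qed
  hence "card ?T = card ?S" by (rule bij_betw_same_card)
  also have "\<dots> = (\<Sum>Us\<in>permutations_of_set P. card {\<sigma>. \<sigma> permutes {1..n} \<and> blocks \<sigma> (map card Us) = Us})"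
  proof (rule card_SigmaI)
    show "\<forall>Us\<in>permutations_of_set P. finite {\<sigma>. \<sigma> permutes {1..n} \<and> blocks \<sigma> (map card Us) = Us}"
      by (auto intro: finite_subset[OF _ finite_permutations[of "{1..n}"]])
  qed simp
  also have "\<dots> = (\<Sum>Us\<in>permutations_of_set P. \<Prod>U\<in>P. fact (card U))"
  proof (intro sum.cong refl)
    fix Us assume "Us \<in> permutations_of_set P"
    hence Us: "set Us = P" "distinct Us" by (auto dest: permutations_of_setD)
    have "card {\<sigma>. \<sigma> permutes {1..n} \<and> blocks \<sigma> (map card Us) = Us} = (\<Prod>U\<in>set Us. fact (card U))"
    proof (rule card_permutes_with_blocks(2)[OF Us(2)])
      show "\<Union> (set Us) = {1..n}" using partition_onD1[OF P] Us by simp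
      fix i j assume "i < length Us" "j < length Us" "i \<noteq> j"
      thus "Us ! i \<inter> Us ! j = {}" using partition_onD2[OF P] Us
        by (auto simp: disjoint_def nth_eq_iff_index_eq) (metis disjoint_iff nth_eq_iff_index_eq nth_mem)
    qed
    thus "card {\<sigma>. \<sigma> permutes {1..n} \<and> blocks \<sigma> (map card Us) = Us} = (\<Prod>U\<in>P. fact (card U))"
      using Us(1) by simp
  qed
  also have "\<dots> = fact (card P) * (\<Prod>U\<in>P. fact (card U))" using finP by simp
  finally show ?thesis by (simp add: k_def)
qed

end

section \<open>Objects of a composition by core-size\<close>

lemma obj_lists_0: "obj_lists B 0 n = (if n = 0 then {[]} else {})"
  by (auto simp: obj_lists_def)

lemma obj_lists_Suc:
  "obj_lists B (Suc k) n =
     (\<lambda>(j, \<beta>, \<beta>s). \<beta> # \<beta>s) ` (SIGMA j:{..n}. objs_of_size B j \<times> obj_lists B k (n - j))"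
proof (intro equalityI subsetI)
  fix \<beta>s assume "\<beta>s \<in> obj_lists B (Suc k) n"
  then obtain \<beta> \<beta>s' where "\<beta>s = \<beta> # \<beta>s'" "length \<beta>s' = k" "\<beta> \<in> objs B" "set \<beta>s' \<subseteq> objs B"
    "osize B \<beta> + sum_list (map (osize B) \<beta>s') = n"
    by (auto simp: obj_lists_def length_Suc_conv)
  thus "\<beta>s \<in> (\<lambda>(j, \<beta>, \<beta>s). \<beta> # \<beta>s) ` (SIGMA j:{..n}. objs_of_size B j \<times> obj_lists B k (n - j))"
    by (intro image_eqI[of _ _ "(osize B \<beta>, \<beta>, \<beta>s')"]) (auto simp: obj_lists_def objs_of_size_def)
qed (auto simp: obj_lists_def objs_of_size_def)

lemma sum_obj_lists:
  fixes g :: "'b \<Rightarrow> real"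
  assumes fin: "\<And>n. finite (objs_of_size B n)"
  shows "finite (obj_lists B k n)"
    and "(\<Sum>\<beta>s\<in>obj_lists B k n. prod_list (map g \<beta>s)) =
           fps_nth (Abs_fps (\<lambda>j. \<Sum>\<beta>\<in>objs_of_size B j. g \<beta>) ^ k) n"
proof -
  show finl: "finite (obj_lists B k n)" for k n
    by (induction k arbitrary: n) (auto simp: obj_lists_0 obj_lists_Suc fin intro!: finite_imageI finite_SigmaI)
  show "(\<Sum>\<beta>s\<in>obj_lists B k n. prod_list (map g \<beta>s)) =
           fps_nth (Abs_fps (\<lambda>j. \<Sum>\<beta>\<in>objs_of_size B j. g \<beta>) ^ k) n"
  proof (induction k arbitrary: n)
    case (Suc k)
    let ?S = "SIGMA j:{..n}. objs_of_size B j \<times> obj_lists B k (n - j)"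
    have inj: "inj_on (\<lambda>(j, \<beta>, \<beta>s). \<beta> # \<beta>s) ?S"
      by (auto simp: inj_on_def objs_of_size_def)
    have "(\<Sum>\<beta>s\<in>obj_lists B (Suc k) n. prod_list (map g \<beta>s)) = (\<Sum>(j, \<beta>, \<beta>s)\<in>?S. g \<beta> * prod_list (map g \<beta>s))"
      unfolding obj_lists_Suc sum.reindex[OF inj] by (intro sum.cong refl) auto
    also have "\<dots> = (\<Sum>j\<le>n. \<Sum>(\<beta>, \<beta>s)\<in>objs_of_size B j \<times> obj_lists B k (n - j). g \<beta> * prod_list (map g \<beta>s))"
      by (subst sum.Sigma[symmetric]) (auto simp: fin finl)
    also have "\<dots> = (\<Sum>j\<le>n. (\<Sum>\<beta>\<in>objs_of_size B j. g \<beta>) * (\<Sum>\<beta>s\<in>obj_lists B k (n - j). prod_list (map g \<beta>s)))"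
      by (simp add: sum_product sum.cartesian_product)
    also have "\<dots> = fps_nth (Abs_fps (\<lambda>j. \<Sum>\<beta>\<in>objs_of_size B j. g \<beta>) ^ Suc k) n"
      by (simp add: Suc fps_mult_nth atLeast0AtMost)
    finally show ?case .
  qed (simp add: obj_lists_0)
qed

fun core_size :: "('a, 'b) composite \<Rightarrow> nat" where
  "core_size (UComp \<alpha> \<beta>s) = length \<beta>s"
| "core_size (LComp P b a) = card P"

lemma size_weight_pos [simp]: "size_weight t n > 0"
  by (cases t) auto

lemma size_weight_nonneg [simp]: "size_weight t n \<ge> 0"
  using size_weight_pos[of t n] by linarith

locale composition_scheme =
  fixes t :: setting and A :: "'a lclass" and B :: "'b lclass"
  assumes A: "comb_class t A" and B: "comb_class t B" and B0: "objs_of_size B 0 = {}"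
begin

abbreviation "C \<equiv> composition t A B"

definition C_core :: "nat \<Rightarrow> nat \<Rightarrow> ('a, 'b) composite set" where
  "C_core n k = {\<gamma> \<in> objs_of_size C n. core_size \<gamma> = k}"

lemma finite_A: "finite (objs_of_size A n)" and finite_B: "finite (objs_of_size B n)"
  using A B by (auto simp: comb_class_def)

lemma labeled: "t = Labeled \<Longrightarrow> labeled_composition A B"
  using A B B0 by (simp add: labeled_composition_def comb_class_def)

lemma C_core_Unlabeled:
  assumes "t = Unlabeled"
  shows "C_core n k = {UComp \<alpha> \<beta>s | \<alpha> \<beta>s. \<alpha> \<in> objs_of_size A k \<and> \<beta>s \<in> obj_lists B k n}"
  unfolding C_core_def objs_of_size_def composition_def obj_lists_def by (auto simp: assms)

lemma C_core_Labeled: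
  assumes "t = Labeled"
  shows "C_core n k = {LComp P b a | P b a. partition_on {1..n} P \<and> card P = k \<and>
           b \<in> (\<Pi>\<^sub>E U\<in>P. structures_on B U) \<and> a \<in> structures_on A P}"
proof -
  have sz: "(\<Sum>U\<in>P. card U) = m" if P: "partition_on {1..m} P" for P and m :: nat
  proof -
    have "(\<Sum>U\<in>P. card U) = card (\<Union> P)"
      using partition_onD2[OF P] partition_onD1[OF P]
      by (intro card_Union_disjoint[symmetric]) (metis Union_upper finite_atLeastAtMost finite_subset)+
    thus ?thesis unfolding partition_onD1[OF P, symmetric] by simp
  qed
  show ?thesis
  proof (intro equalityI subsetI)
    fix \<gamma> assume "\<gamma> \<in> C_core n k"
    then obtain P b a m where \<gamma>: "\<gamma> = LComp P b a" "partition_on {1..m} P" "b \<in> (\<Pi>\<^sub>E U\<in>P. structures_on B U)"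
      "a \<in> structures_on A P" "card P = k" "(\<Sum>U\<in>P. card U) = n"
      unfolding C_core_def objs_of_size_def composition_def by (auto simp: assms)
    \<comment> \<open>The label set is existentially quantified in the objects; the size determines
      it.\<close>
    have "m = n" using sz[OF \<gamma>(2)] \<gamma>(6) by simp
    thus "\<gamma> \<in> {LComp P b a | P b a. partition_on {1..n} P \<and> card P = k \<and>
           b \<in> (\<Pi>\<^sub>E U\<in>P. structures_on B U) \<and> a \<in> structures_on A P}" using \<gamma> by blast
  next
    fix \<gamma> assume "\<gamma> \<in> {LComp P b a | P b a. partition_on {1..n} P \<and> card P = k \<and>
           b \<in> (\<Pi>\<^sub>E U\<in>P. structures_on B U) \<and> a \<in> structures_on A P}"
    then obtain P b a where \<gamma>: "\<gamma> = LComp P b a" "partition_on {1..n} P" "card P = k"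
      "b \<in> (\<Pi>\<^sub>E U\<in>P. structures_on B U)" "a \<in> structures_on A P" by blast
    thus "\<gamma> \<in> C_core n k" using sz[OF \<gamma>(2)]
      unfolding C_core_def objs_of_size_def composition_def by (simp add: assms) blast
  qed
qed

lemma finite_set_substitute: "finite (set_pmf (substitute t A B n \<alpha> \<beta>s))"
proof -
  have "{\<sigma>. \<sigma> permutes {1..n}} \<noteq> {}" using permutes_id by blast
  thus ?thesis by (cases t) (simp_all add: finite_permutations)
qed

lemma set_substitute:
  assumes "\<alpha> \<in> objs_of_size A k" "\<beta>s \<in> obj_lists B k n"
  shows "set_pmf (substitute t A B n \<alpha> \<beta>s) \<subseteq> C_core n k"
proof (cases t)
  case Unlabeled
  show ?thesis unfolding C_core_Unlabeled[OF Unlabeled] using assms Unlabeled by auto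
next
  case Labeled
  then interpret labeled_composition A B by (rule labeled)
  have "{\<sigma>. \<sigma> permutes {1..n}} \<noteq> {}" using permutes_id by blast
  hence "set_pmf (substitute t A B n \<alpha> \<beta>s) = (\<lambda>\<sigma>. labeled_subst A B \<sigma> \<alpha> \<beta>s) ` {\<sigma>. \<sigma> permutes {1..n}}"
    using Labeled by (simp add: finite_permutations)
  also have "\<dots> \<subseteq> C_core n k"
  proof
    fix \<gamma> assume "\<gamma> \<in> (\<lambda>\<sigma>. labeled_subst A B \<sigma> \<alpha> \<beta>s) ` {\<sigma>. \<sigma> permutes {1..n}}"
    then obtain \<sigma> where \<sigma>: "\<sigma> permutes {1..n}" "\<gamma> = labeled_subst A B \<sigma> \<alpha> \<beta>s" by auto
    show "\<gamma> \<in> C_core n k"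
    proof (rule labeled_subst_in_objs[OF assms(2) \<sigma>(1) assms(1)])
      fix P b a assume "labeled_subst A B \<sigma> \<alpha> \<beta>s = LComp P b a" "partition_on {1..n} P" "card P = k"
        "b \<in> (\<Pi>\<^sub>E U\<in>P. structures_on B U)" "a \<in> structures_on A P"
      thus "\<gamma> \<in> C_core n k" unfolding C_core_Labeled[OF Labeled] \<sigma>(2) by blast
    qed
  qed
  finally show ?thesis .
qed

text \<open>
  Summed over \<open>\<gamma>\<close> this counts the objects of given core-size; for fixed \<open>\<gamma>\<close> it is, up to a factor that
  depends on the sizes only, the probability that a trial of the leap generator returns \<open>\<gamma>\<close>.
\<close>

lemma sum_weight_substitute:
  assumes \<gamma>: "\<gamma> \<in> C_core n k"
  shows "(\<Sum>\<beta>s\<in>obj_lists B k n. \<Sum>\<alpha>\<in>objs_of_size A k.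
            prod_list (map (\<lambda>\<beta>. size_weight t (osize B \<beta>)) \<beta>s) * pmf (substitute t A B n \<alpha> \<beta>s) \<gamma>) =
          size_weight t n / size_weight t k"
proof (cases t)
  case Unlabeled
  then obtain \<alpha>0 \<beta>s0 where \<gamma>': "\<gamma> = UComp \<alpha>0 \<beta>s0" "\<alpha>0 \<in> objs_of_size A k" "\<beta>s0 \<in> obj_lists B k n"
    using \<gamma> unfolding C_core_Unlabeled[OF Unlabeled] by blast
  have 1: "prod_list (map (\<lambda>\<beta>. 1) \<beta>s) = (1::real)" for \<beta>s :: "'b list"
    by (induction \<beta>s) auto
  have "(\<Sum>\<beta>s\<in>obj_lists B k n. \<Sum>\<alpha>\<in>objs_of_size A k.
            prod_list (map (\<lambda>\<beta>. size_weight t (osize B \<beta>)) \<beta>s) * pmf (substitute t A B n \<alpha> \<beta>s) \<gamma>) =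
     (\<Sum>\<beta>s\<in>obj_lists B k n. \<Sum>\<alpha>\<in>objs_of_size A k. if \<alpha> = \<alpha>0 then (if \<beta>s = \<beta>s0 then 1 else 0) else 0)"
    using Unlabeled by (intro sum.cong refl) (auto simp: \<gamma>'(1) 1 indicator_def)
  also have "\<dots> = 1"
    using \<gamma>' sum_obj_lists(1)[OF finite_B] by (simp add: sum.delta finite_A)
  finally show ?thesis using Unlabeled by simp
next
  case Labeled
  then interpret labeled_composition A B by (rule labeled)
  obtain P b a where \<gamma>': "\<gamma> = LComp P b a" "partition_on {1..n} P" "card P = k"
      "b \<in> (\<Pi>\<^sub>E U\<in>P. structures_on B U)" "a \<in> structures_on A P"
    using \<gamma> unfolding C_core_Labeled[OF Labeled] by blast
  let ?S = "{\<sigma>. \<sigma> permutes {1..n}}"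
  let ?F = "\<lambda>\<beta>s \<alpha>. {\<sigma> \<in> ?S. labeled_subst A B \<sigma> \<alpha> \<beta>s = \<gamma>}"
  define w :: real where "w = (\<Prod>U\<in>P. fact (card U))"
  have S: "finite ?S" "?S \<noteq> {}" "card ?S = fact n"
    using permutes_id card_permutations[of "{1..n}" n] by (auto simp: finite_permutations intro: permutes_id)
  have "w > 0" by (simp add: w_def prod_pos)
  have pmf: "pmf (substitute t A B n \<alpha> \<beta>s) \<gamma> = real (card (?F \<beta>s \<alpha>)) / fact n" for \<alpha> \<beta>s
  proof -
    have "pmf (substitute t A B n \<alpha> \<beta>s) \<gamma> = measure (pmf_of_set ?S) ((\<lambda>\<sigma>. labeled_subst A B \<sigma> \<alpha> \<beta>s) -` {\<gamma>})"
      using Labeled by (simp add: pmf_map)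
    also have "\<dots> = real (card (?S \<inter> (\<lambda>\<sigma>. labeled_subst A B \<sigma> \<alpha> \<beta>s) -` {\<gamma>})) / real (card ?S)"
      using S by (intro measure_pmf_of_set)
    also have "?S \<inter> (\<lambda>\<sigma>. labeled_subst A B \<sigma> \<alpha> \<beta>s) -` {\<gamma>} = ?F \<beta>s \<alpha>" by auto
    finally show ?thesis using S by simp
  qed
  \<comment> \<open>On a nonempty fiber the sizes of the components are the block sizes of P, so the
    product of inverse factorials depends on \<gamma> only and can be taken out of the sum.\<close>
  have weight: "prod_list (map (\<lambda>\<beta>. size_weight t (osize B \<beta>)) \<beta>s) * real (card (?F \<beta>s \<alpha>)) = real (card (?F \<beta>s \<alpha>)) / w"
    if \<beta>s: "\<beta>s \<in> obj_lists B k n" and \<alpha>: "\<alpha> \<in> objs_of_size A k" for \<alpha> \<beta>s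
  proof (cases "?F \<beta>s \<alpha> = {}")
    case False
    then obtain \<sigma> where \<sigma>: "\<sigma> permutes {1..n}" "labeled_subst A B \<sigma> \<alpha> \<beta>s = \<gamma>" by auto
    have P: "P = set (blocks \<sigma> (sizes \<beta>s))"
      using labeled_subst_eq[OF \<beta>s \<sigma>(1) \<alpha>] \<sigma>(2) \<gamma>'(1) by (metis composite.inject(2))
    have "distinct (blocks \<sigma> (sizes \<beta>s))"
      using \<beta>s \<sigma>(1) sizes_pos[OF \<beta>s] by (intro distinct_blocks) (auto simp: obj_lists_def)
    hence "w = prod_list (map (\<lambda>U. fact (card U)) (blocks \<sigma> (sizes \<beta>s)))"
      unfolding w_def P by (simp add: prod.distinct_set_conv_list)
    also have "\<dots> = prod_list (map fact (map card (blocks \<sigma> (sizes \<beta>s))))" by (simp add: o_def)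
    also have "map card (blocks \<sigma> (sizes \<beta>s)) = sizes \<beta>s" using \<sigma>(1) by (rule card_blocks)
    finally have w: "w = prod_list (map (\<lambda>\<beta>. fact (osize B \<beta>)) \<beta>s)" by (simp add: o_def)
    have "prod_list (map (\<lambda>\<beta>. 1 / fact (osize B \<beta>)) \<beta>s) * prod_list (map (\<lambda>\<beta>. fact (osize B \<beta>)) \<beta>s) = (1::real)"
      by (induction \<beta>s) auto
    hence "prod_list (map (\<lambda>\<beta>. size_weight t (osize B \<beta>)) \<beta>s) * w = 1"
      using Labeled by (simp add: w)
    hence "prod_list (map (\<lambda>\<beta>. size_weight t (osize B \<beta>)) \<beta>s) = 1 / w"
      using \<open>w > 0\<close> by (simp add: field_simps)
    thus ?thesis by simp
  next
    case True
    show ?thesis unfolding True by simp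
  qed
  have "(\<Sum>\<beta>s\<in>obj_lists B k n. \<Sum>\<alpha>\<in>objs_of_size A k.
            prod_list (map (\<lambda>\<beta>. size_weight t (osize B \<beta>)) \<beta>s) * pmf (substitute t A B n \<alpha> \<beta>s) \<gamma>) =
     (\<Sum>\<beta>s\<in>obj_lists B k n. \<Sum>\<alpha>\<in>objs_of_size A k. real (card (?F \<beta>s \<alpha>)) / w / fact n)"
    by (intro sum.cong refl) (simp only: pmf times_divide_eq_right weight)
  also have "\<dots> = real (\<Sum>\<beta>s\<in>obj_lists B k n. \<Sum>\<alpha>\<in>objs_of_size A k. card (?F \<beta>s \<alpha>)) / w / fact n"
    by (simp add: sum_divide_distrib)
  also have "(\<Sum>\<beta>s\<in>obj_lists B k n. \<Sum>\<alpha>\<in>objs_of_size A k. card (?F \<beta>s \<alpha>)) =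
     card (SIGMA \<beta>s:obj_lists B k n. SIGMA \<alpha>:objs_of_size A k. ?F \<beta>s \<alpha>)"
    using S by (simp add: card_SigmaI sum_obj_lists(1)[OF finite_B] finite_A)
  also have "(SIGMA \<beta>s:obj_lists B k n. SIGMA \<alpha>:objs_of_size A k. ?F \<beta>s \<alpha>) =
     {(\<beta>s, \<alpha>, \<sigma>). \<beta>s \<in> obj_lists B (card P) n \<and> \<alpha> \<in> objs_of_size A (card P) \<and>
           \<sigma> permutes {1..n} \<and> labeled_subst A B \<sigma> \<alpha> \<beta>s = LComp P b a}"
    using \<gamma>' by auto
  also have "card \<dots> = fact k * (\<Prod>U\<in>P. fact (card U))"
    using card_labeled_subst_fiber[OF \<gamma>'(2,4,5)] \<gamma>'(3) by simp
  also have "real (fact k * (\<Prod>U\<in>P. fact (card U))) / w / fact n = fact k / fact n"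
    using \<open>w > 0\<close> by (simp add: w_def of_nat_prod)
  finally show ?thesis using Labeled by simp
qed

lemma gf_B_altdef: "gf t B = Abs_fps (\<lambda>j. \<Sum>\<beta>\<in>objs_of_size B j. size_weight t (osize B \<beta>))"
  by (rule fps_ext) (simp add: gf_def osize_objs_of_size mult.commute)

lemma gf_B_0: "fps_nth (gf t B) 0 = 0"
  using B0 by (simp add: gf_def)

text \<open>By \<open>sum_weight_substitute\<close> every object receives positive total weight, so
  it is an output of one of finitely many substitutions, each with finite support.\<close>

lemma finite_C_core: "finite (C_core n k)"
proof (rule finite_subset)
  show "C_core n k \<subseteq> (\<Union>\<beta>s\<in>obj_lists B k n. \<Union>\<alpha>\<in>objs_of_size A k. set_pmf (substitute t A B n \<alpha> \<beta>s))"
  proof (rule subsetI, rule ccontr)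
    fix \<gamma> assume \<gamma>: "\<gamma> \<in> C_core n k"
      and "\<gamma> \<notin> (\<Union>\<beta>s\<in>obj_lists B k n. \<Union>\<alpha>\<in>objs_of_size A k. set_pmf (substitute t A B n \<alpha> \<beta>s))"
    hence "pmf (substitute t A B n \<alpha> \<beta>s) \<gamma> = 0" if "\<beta>s \<in> obj_lists B k n" "\<alpha> \<in> objs_of_size A k" for \<alpha> \<beta>s
      using that by (auto simp: set_pmf_eq)
    hence "(\<Sum>\<beta>s\<in>obj_lists B k n. \<Sum>\<alpha>\<in>objs_of_size A k.
            prod_list (map (\<lambda>\<beta>. size_weight t (osize B \<beta>)) \<beta>s) * pmf (substitute t A B n \<alpha> \<beta>s) \<gamma>) = 0"
      by (intro sum.neutral ballI) auto
    thus False using sum_weight_substitute[OF \<gamma>] size_weight_pos[of t n] size_weight_pos[of t k]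
      by (metis divide_eq_0_iff less_irrefl)
  qed
qed (auto simp: finite_A finite_set_substitute sum_obj_lists(1)[OF finite_B])

text \<open>Double counting: \<open>sum_weight_substitute\<close> is summed over \<gamma> and the
  sums are exchanged; each substitution is a probability distribution on \<open>C_core n k\<close>
  and so contributes its weight once. Summed over k this is the coefficient form of C(z) =
  A(B(z)).\<close>

lemma card_C_core:
  "size_weight t n * real (card (C_core n k)) = fps_nth (gf t A) k * fps_nth (gf t B ^ k) n"
proof -
  let ?w = "\<lambda>\<beta>s. prod_list (map (\<lambda>\<beta>. size_weight t (osize B \<beta>)) \<beta>s)"
  have "real (card (C_core n k)) * (size_weight t n / size_weight t k) =
     (\<Sum>\<gamma>\<in>C_core n k. \<Sum>\<beta>s\<in>obj_lists B k n. \<Sum>\<alpha>\<in>objs_of_size A k. ?w \<beta>s * pmf (substitute t A B n \<alpha> \<beta>s) \<gamma>)"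
    using sum_weight_substitute by simp
  also have "\<dots> = (\<Sum>\<beta>s\<in>obj_lists B k n. \<Sum>\<gamma>\<in>C_core n k. \<Sum>\<alpha>\<in>objs_of_size A k. ?w \<beta>s * pmf (substitute t A B n \<alpha> \<beta>s) \<gamma>)"
    by (rule sum.swap)
  also have "\<dots> = (\<Sum>\<beta>s\<in>obj_lists B k n. \<Sum>\<alpha>\<in>objs_of_size A k. \<Sum>\<gamma>\<in>C_core n k. ?w \<beta>s * pmf (substitute t A B n \<alpha> \<beta>s) \<gamma>)"
    by (intro sum.cong refl sum.swap)
  also have "\<dots> = (\<Sum>\<beta>s\<in>obj_lists B k n. \<Sum>\<alpha>\<in>objs_of_size A k. ?w \<beta>s)"
  proof (intro sum.cong refl)
    fix \<beta>s \<alpha> assume "\<beta>s \<in> obj_lists B k n" "\<alpha> \<in> objs_of_size A k"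
    hence "(\<Sum>\<gamma>\<in>C_core n k. pmf (substitute t A B n \<alpha> \<beta>s) \<gamma>) = 1"
      by (intro sum_pmf_eq_1 finite_C_core set_substitute)
    thus "(\<Sum>\<gamma>\<in>C_core n k. ?w \<beta>s * pmf (substitute t A B n \<alpha> \<beta>s) \<gamma>) = ?w \<beta>s"
      by (simp add: sum_distrib_left[symmetric])
  qed
  also have "\<dots> = real (card (objs_of_size A k)) * (\<Sum>\<beta>s\<in>obj_lists B k n. ?w \<beta>s)"
    by (simp add: sum_distrib_left)
  also have "(\<Sum>\<beta>s\<in>obj_lists B k n. ?w \<beta>s) = fps_nth (gf t B ^ k) n"
    unfolding gf_B_altdef by (rule sum_obj_lists(2)[OF finite_B])
  finally show ?thesis using size_weight_pos[of t k] by (simp add: gf_def field_simps)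
qed

lemma C_core_eq_empty: "n < k \<Longrightarrow> C_core n k = {}"
proof -
  assume "n < k"
  hence "fps_nth (gf t B ^ k) n = 0"
    using startsby_zero_power_prefix[OF gf_B_0, of k] by simp
  hence "card (C_core n k) = 0" using card_C_core[of n k] size_weight_pos[of t n] by simp
  thus ?thesis using finite_C_core by simp
qed

lemma objs_of_size_C: "objs_of_size C n = (\<Union>k\<le>n. C_core n k)"
proof (intro equalityI subsetI)
  fix \<gamma> assume "\<gamma> \<in> objs_of_size C n"
  hence \<gamma>: "\<gamma> \<in> C_core n (core_size \<gamma>)" by (simp add: C_core_def)
  have "core_size \<gamma> \<le> n"
  proof (rule ccontr)
    assume "\<not> core_size \<gamma> \<le> n"
    thus False using \<gamma> C_core_eq_empty[of n "core_size \<gamma>"] by simp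
  qed
  thus "\<gamma> \<in> (\<Union>k\<le>n. C_core n k)" using \<gamma> by auto
qed (auto simp: C_core_def)

lemma sum_objs_of_size_C: "(\<Sum>\<gamma>\<in>objs_of_size C n. f \<gamma>) = (\<Sum>k\<le>n. \<Sum>\<gamma>\<in>C_core n k. f \<gamma>)"
  unfolding objs_of_size_C
  by (rule sum.UNION_disjoint) (auto simp: finite_C_core, auto simp: C_core_def)

lemma gf_C: "fps_nth (gf t C) n = (\<Sum>k\<le>n. fps_nth (gf t A) k * fps_nth (gf t B ^ k) n)"
proof -
  have "real (card (objs_of_size C n)) = (\<Sum>k\<le>n. real (card (C_core n k)))"
    using sum_objs_of_size_C[of "\<lambda>_. 1::real" n] by simp
  thus ?thesis by (simp add: gf_def sum_distrib_left card_C_core)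
qed

end

section \<open>The leap generator\<close>

text \<open>Draws are only appended, and positive sizes make the remaining room decrease, which is
  the induction measure. It implies that a run with a given output must start with the first entry
  of that output.\<close>

lemma leap_run_extends:
  fixes p :: "'b pmf"
  assumes pos: "\<And>\<beta>. \<beta> \<in> set_pmf p \<Longrightarrow> sz \<beta> > 0"
  shows "ys \<in> set_spmf (leap_run p sz n xs) \<Longrightarrow> \<exists>zs. ys = xs @ zs \<and> set zs \<subseteq> set_pmf p"
proof (induction "n - sum_list (map sz xs)" arbitrary: xs rule: less_induct)
  case less
  from less.prems obtain \<beta> where \<beta>: "\<beta> \<in> set_pmf p"
    "ys \<in> set_spmf (if sum_list (map sz xs) + sz \<beta> \<le> n then leap_run p sz n (xs @ [\<beta>]) else return_spmf xs)"
    by (subst (asm) leap_run.simps) (auto simp: set_spmf_bind_pmf Set.bind_def)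
  show ?case
  proof (cases "sum_list (map sz xs) + sz \<beta> \<le> n")
    case True
    have "n - sum_list (map sz (xs @ [\<beta>])) < n - sum_list (map sz xs)"
      using True pos[OF \<beta>(1)] by simp
    from less.hyps[OF this] \<beta>(2) True obtain zs where "ys = (xs @ [\<beta>]) @ zs" "set zs \<subseteq> set_pmf p" by auto
    thus ?thesis using \<beta>(1) by (intro exI[of _ "\<beta> # zs"]) auto
  next
    case False
    thus ?thesis using \<beta>(2) by auto
  qed
qed

lemma lossless_leap_run:
  fixes p :: "'b pmf"
  assumes pos: "\<And>\<beta>. \<beta> \<in> set_pmf p \<Longrightarrow> sz \<beta> > 0"
  shows "lossless_spmf (leap_run p sz n xs)"
proof (induction "n - sum_list (map sz xs)" arbitrary: xs rule: less_induct)
  case less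
  show ?case
  proof (subst leap_run.simps, subst lossless_bind_spmf, intro conjI ballI)
    fix \<beta> assume "\<beta> \<in> set_spmf (spmf_of_pmf p)"
    hence \<beta>: "\<beta> \<in> set_pmf p" by simp
    show "lossless_spmf (if sum_list (map sz xs) + sz \<beta> \<le> n then leap_run p sz n (xs @ [\<beta>]) else return_spmf xs)"
    proof (cases "sum_list (map sz xs) + sz \<beta> \<le> n")
      case True
      have "n - sum_list (map sz (xs @ [\<beta>])) < n - sum_list (map sz xs)"
        using True pos[OF \<beta>] by simp
      from less.hyps[OF this] show ?thesis using True by simp
    qed simp
  qed simp
qed

text \<open>The draw that ends the run contributes no factor: once the total is exactly n, every
  further draw has positive size and overshoots, so the run stops with certainty.\<close>

lemma spmf_leap_run:
  fixes p :: "'b pmf"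
  assumes pos: "\<And>\<beta>. \<beta> \<in> set_pmf p \<Longrightarrow> sz \<beta> > 0"
  shows "sum_list (map sz (xs @ zs)) = n \<Longrightarrow> spmf (leap_run p sz n xs) (xs @ zs) = prod_list (map (pmf p) zs)"
proof (induction zs arbitrary: xs)
  case Nil
  have "leap_run p sz n xs = bind_pmf p (\<lambda>_. return_spmf xs)"
    unfolding leap_run.simps[of p sz n xs] bind_spmf_of_pmf
    using Nil pos by (intro bind_pmf_cong refl) force
  thus ?case by (simp add: bind_pmf_const)
next
  case (Cons \<beta> zs)
  let ?f = "\<lambda>\<beta>. if sum_list (map sz xs) + sz \<beta> \<le> n then leap_run p sz n (xs @ [\<beta>]) else return_spmf xs"
  have "spmf (leap_run p sz n xs) (xs @ \<beta> # zs) = (\<integral>x. spmf (?f x) (xs @ \<beta> # zs) \<partial>measure_pmf p)"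
    by (subst leap_run.simps) (simp add: pmf_bind)
  also have "\<dots> = (\<Sum>x\<in>{\<beta>}. pmf p x *\<^sub>R spmf (?f x) (xs @ \<beta> # zs))"
  proof (rule integral_measure_pmf)
    fix x assume x: "spmf (?f x) (xs @ \<beta> # zs) \<noteq> 0"
    hence "xs @ \<beta> # zs \<in> set_spmf (?f x)" by (simp add: spmf_eq_0_set_spmf)
    thus "x \<in> {\<beta>}" using leap_run_extends[where p = p and sz = sz, OF pos, where ys = "xs @ \<beta> # zs" and n = n and xs = "xs @ [x]"]
      by (auto split: if_splits)
  qed simp
  also have "\<dots> = pmf p \<beta> * spmf (?f \<beta>) (xs @ \<beta> # zs)" by simp
  also have "?f \<beta> = leap_run p sz n (xs @ [\<beta>])" using Cons.prems by simp
  also have "spmf \<dots> (xs @ \<beta> # zs) = prod_list (map (pmf p) zs)"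
    using Cons.IH[of "xs @ [\<beta>]"] Cons.prems by simp
  finally show ?case by simp
qed

lemma integral_measure_spmf_finite:
  fixes f :: "'a \<Rightarrow> real"
  assumes "finite A" "\<And>x. x \<in> set_spmf M \<Longrightarrow> f x \<noteq> 0 \<Longrightarrow> x \<in> A"
  shows "(\<integral>x. f x \<partial>measure_spmf M) = (\<Sum>x\<in>A. spmf M x * f x)"
proof -
  have "(\<integral>x. f x \<partial>measure_spmf M) = (\<integral>x. indicator A x * f x \<partial>measure_spmf M)"
    by (intro integral_cong_AE) (use assms(2) in \<open>auto simp: AE_measure_spmf_iff indicator_def\<close>)
  also have "\<dots> = (\<integral>x. (\<Sum>a\<in>A. f a * indicator {a} x) \<partial>measure_spmf M)"
  proof (intro Bochner_Integration.integral_cong refl)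
    fix x
    have "(\<Sum>a\<in>A. f a * indicator {a} x) = (\<Sum>a\<in>A. if a = x then f x else 0)"
      by (intro sum.cong) (auto simp: indicator_def)
    thus "indicator A x * f x = (\<Sum>a\<in>A. f a * indicator {a} x)"
      using assms(1) by (simp add: indicator_def)
  qed
  also have "\<dots> = (\<Sum>a\<in>A. f a * measure (measure_spmf M) {a})"
    by (subst Bochner_Integration.integral_sum)
       (auto intro!: integrable_real_indicator simp: less_top[symmetric] measure_spmf.emeasure_finite)
  finally show ?thesis by (simp add: spmf_conv_measure_spmf mult.commute)
qed

section \<open>Output distribution of the leap generator\<close>

context composition_scheme
begin

lemma nn_integral_boltzmann_weight:
  assumes \<rho>: "0 < \<rho>" "ereal \<rho> < fps_conv_radius (gf t B)" and pos: "eval_fps (gf t B) \<rho> > 0"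
  shows "(\<integral>\<^sup>+ \<beta>. ennreal (if \<beta> \<in> objs B then size_weight t (osize B \<beta>) * \<rho> ^ osize B \<beta> / eval_fps (gf t B) \<rho> else 0)
           \<partial>count_space UNIV) = 1"
proof -
  let ?f = "\<lambda>\<beta>. if \<beta> \<in> objs B then size_weight t (osize B \<beta>) * \<rho> ^ osize B \<beta> / eval_fps (gf t B) \<rho> else 0"
  have nonneg: "?f \<beta> \<ge> 0" for \<beta> using \<rho> pos by (auto intro!: divide_nonneg_nonneg mult_nonneg_nonneg)
  have sing: "ennreal (?f \<beta>) = (\<Sum>n. ennreal (?f \<beta>) * indicator (objs_of_size B n) \<beta>)" for \<beta>
  proof -
    have "(\<Sum>n. ennreal (?f \<beta>) * indicator (objs_of_size B n) \<beta>) =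
       (\<Sum>n\<in>{osize B \<beta>}. ennreal (?f \<beta>) * indicator (objs_of_size B n) \<beta>)"
      by (rule suminf_finite) (auto simp: objs_of_size_def indicator_def)
    thus ?thesis by (simp add: objs_of_size_def indicator_def)
  qed
  have "(\<integral>\<^sup>+ \<beta>. ennreal (?f \<beta>) \<partial>count_space UNIV) =
     (\<integral>\<^sup>+ \<beta>. (\<Sum>n. ennreal (?f \<beta>) * indicator (objs_of_size B n) \<beta>) \<partial>count_space UNIV)"
    by (intro nn_integral_cong sing)
  also have "\<dots> = (\<Sum>n. \<integral>\<^sup>+ \<beta>. ennreal (?f \<beta>) * indicator (objs_of_size B n) \<beta> \<partial>count_space UNIV)"
    by (intro nn_integral_suminf) auto
  also have "\<dots> = (\<Sum>n. ennreal (fps_nth (gf t B) n * \<rho> ^ n / eval_fps (gf t B) \<rho>))"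
  proof (rule suminf_cong)
    fix n
    have "(\<integral>\<^sup>+ \<beta>. ennreal (?f \<beta>) * indicator (objs_of_size B n) \<beta> \<partial>count_space UNIV) =
       (\<integral>\<^sup>+ \<beta>. ennreal (?f \<beta>) \<partial>count_space (objs_of_size B n))"
      by (simp add: nn_integral_count_space_indicator)
    also have "\<dots> = (\<Sum>\<beta>\<in>objs_of_size B n. ennreal (?f \<beta>))"
      using finite_B by (rule nn_integral_count_space_finite)
    also have "\<dots> = ennreal (\<Sum>\<beta>\<in>objs_of_size B n. ?f \<beta>)" using nonneg by (rule sum_ennreal)
    also have "(\<Sum>\<beta>\<in>objs_of_size B n. ?f \<beta>) =
       (\<Sum>\<beta>\<in>objs_of_size B n. size_weight t n * \<rho> ^ n / eval_fps (gf t B) \<rho>)"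
      by (intro sum.cong refl) (auto simp: objs_of_size_def)
    also have "\<dots> = fps_nth (gf t B) n * \<rho> ^ n / eval_fps (gf t B) \<rho>" by (simp add: gf_def)
    finally show "(\<integral>\<^sup>+ \<beta>. ennreal (?f \<beta>) * indicator (objs_of_size B n) \<beta> \<partial>count_space UNIV) =
      ennreal (fps_nth (gf t B) n * \<rho> ^ n / eval_fps (gf t B) \<rho>)" .
  qed
  also have "\<dots> = ennreal 1"
  proof (rule suminf_ennreal_eq)
    show "0 \<le> fps_nth (gf t B) n * \<rho> ^ n / eval_fps (gf t B) \<rho>" for n
      using \<rho> pos by (auto simp: gf_def intro!: divide_nonneg_nonneg mult_nonneg_nonneg)
    have "(\<lambda>n. fps_nth (gf t B) n * \<rho> ^ n) sums eval_fps (gf t B) \<rho>"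
      using \<rho> by (intro sums_eval_fps) auto
    from sums_divide[OF this, of "eval_fps (gf t B) \<rho>"] pos
    show "(\<lambda>n. fps_nth (gf t B) n * \<rho> ^ n / eval_fps (gf t B) \<rho>) sums 1" by simp
  qed
  finally show ?thesis by simp
qed

lemma pmf_boltzmann:
  assumes \<rho>: "0 < \<rho>" "ereal \<rho> < fps_conv_radius (gf t B)" and pos: "eval_fps (gf t B) \<rho> > 0"
  shows "pmf (boltzmann t B \<rho>) \<beta> =
    (if \<beta> \<in> objs B then size_weight t (osize B \<beta>) * \<rho> ^ osize B \<beta> / eval_fps (gf t B) \<rho> else 0)"
  unfolding boltzmann_def
  using \<rho> pos by (intro pmf_embed_pmf nn_integral_boltzmann_weight)
    (auto intro!: divide_nonneg_nonneg mult_nonneg_nonneg)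

lemma pmf_boltzmann_size:
  assumes \<rho>: "0 < \<rho>" "ereal \<rho> < fps_conv_radius (gf t B)" and pos: "eval_fps (gf t B) \<rho> > 0"
  shows "pmf (map_pmf (osize B) (boltzmann t B \<rho>)) n = fps_nth (gf t B) n * \<rho> ^ n / eval_fps (gf t B) \<rho>"
proof -
  let ?p = "boltzmann t B \<rho>"
  have "pmf (map_pmf (osize B) ?p) n = measure ?p (osize B -` {n})" by (rule pmf_map)
  also have "\<dots> = measure ?p (osize B -` {n} \<inter> set_pmf ?p)" by (rule measure_Int_set_pmf[symmetric])
  also have "osize B -` {n} \<inter> set_pmf ?p = objs_of_size B n \<inter> set_pmf ?p"
    using pmf_boltzmann[OF assms] by (auto simp: objs_of_size_def set_pmf_eq split: if_splits)
  also have "measure ?p \<dots> = measure ?p (objs_of_size B n)" by (rule measure_Int_set_pmf)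
  also have "\<dots> = (\<Sum>\<beta>\<in>objs_of_size B n. pmf ?p \<beta>)"
    using finite_B by (rule measure_measure_pmf_finite)
  also have "\<dots> = (\<Sum>\<beta>\<in>objs_of_size B n. size_weight t n * \<rho> ^ n / eval_fps (gf t B) \<rho>)"
    by (intro sum.cong refl) (auto simp: pmf_boltzmann[OF assms] objs_of_size_def)
  also have "\<dots> = fps_nth (gf t B) n * \<rho> ^ n / eval_fps (gf t B) \<rho>" by (simp add: gf_def)
  finally show ?thesis .
qed

text \<open>The renewal quantity \<open>q k n\<close> for the size of a Boltzmann object, expressed
  through the coefficients of the powers of B.\<close>

definition hit_prob :: "real \<Rightarrow> nat \<Rightarrow> nat \<Rightarrow> real" where
  "hit_prob \<rho> k n = fps_nth (gf t B ^ k) n * \<rho> ^ n / eval_fps (gf t B) \<rho> ^ k"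

lemma prod_pmf_boltzmann:
  assumes \<rho>: "0 < \<rho>" "ereal \<rho> < fps_conv_radius (gf t B)" and pos: "eval_fps (gf t B) \<rho> > 0"
    and \<beta>s: "\<beta>s \<in> obj_lists B k n"
  shows "prod_list (map (pmf (boltzmann t B \<rho>)) \<beta>s) =
    prod_list (map (\<lambda>\<beta>. size_weight t (osize B \<beta>)) \<beta>s) * (\<rho> ^ n / eval_fps (gf t B) \<rho> ^ k)"
proof -
  have "set \<beta>s \<subseteq> objs B \<Longrightarrow> prod_list (map (pmf (boltzmann t B \<rho>)) \<beta>s) =
    prod_list (map (\<lambda>\<beta>. size_weight t (osize B \<beta>)) \<beta>s) *
      (\<rho> ^ sum_list (map (osize B) \<beta>s) / eval_fps (gf t B) \<rho> ^ length \<beta>s)"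
    by (induction \<beta>s) (auto simp: pmf_boltzmann[OF \<rho> pos] power_add)
  thus ?thesis using \<beta>s by (simp add: obj_lists_def)
qed

text \<open>
  The probability \<open>x\<close> of \<open>\<gamma>\<close> satisfies \<open>x = t + (1 - u) x\<close>, where \<open>t\<close> is the probability that a trial
  returns \<open>\<gamma>\<close> and \<open>u > 0\<close> that it succeeds; so the unfolding equation alone determines \<open>x\<close>.
\<close>

lemma spmf_leap_generator:
  assumes \<rho>: "0 < \<rho>" "ereal \<rho> < fps_conv_radius (gf t B)" and pos: "eval_fps (gf t B) \<rho> > 0"
    and \<gamma>: "\<gamma> \<in> C_core n k" and k: "k > 0" and Ak: "fps_nth (gf t A) k \<noteq> 0"
    and u: "(\<Sum>k\<le>n. hit_prob \<rho> k n) > 0"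
  shows "spmf (leap_generator t A B \<rho> n) \<gamma> =
    \<rho> ^ n * size_weight t n / (eval_fps (gf t B) \<rho> ^ k * fps_nth (gf t A) k) / (\<Sum>k\<le>n. hit_prob \<rho> k n)"
proof -
  let ?p = "boltzmann t B \<rho>"
  let ?run = "leap_run ?p (osize B) n []"
  let ?G = "\<lambda>\<beta>s. bind_spmf (spmf_of_set (objs_of_size A (length \<beta>s))) (\<lambda>\<alpha>. spmf_of_pmf (substitute t A B n \<alpha> \<beta>s))"
  define x where "x = spmf (leap_generator t A B \<rho> n) \<gamma>"
  define E where "E = eval_fps (gf t B) \<rho>"
  \<comment> \<open>The successful runs. They are finitely many, as n bounds their length when all
    sizes are positive.\<close>
  define L where "L = (\<Union>k\<le>n. obj_lists B k n)"
  have supp: "\<beta> \<in> objs B" if "\<beta> \<in> set_pmf ?p" for \<beta>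
    using that by (auto simp: set_pmf_eq pmf_boltzmann[OF \<rho> pos] split: if_splits)
  have szpos: "osize B \<beta> > 0" if "\<beta> \<in> objs B" for \<beta>
    using that B0 by (auto simp: objs_of_size_def intro!: Nat.gr0I)
  have szpos': "osize B \<beta> > 0" if "\<beta> \<in> set_pmf ?p" for \<beta> using szpos supp that by blast
  have finL: "finite L" unfolding L_def using sum_obj_lists(1)[OF finite_B] by auto
  have in_L: "\<beta>s \<in> L" if "\<beta>s \<in> set_spmf ?run" "sum_list (map (osize B) \<beta>s) = n" for \<beta>s
  proof -
    have "set \<beta>s \<subseteq> objs B" using leap_run_extends[where p = ?p and sz = "osize B", OF szpos' that(1)] supp by auto
    moreover from this have "length \<beta>s \<le> sum_list (map (osize B) \<beta>s)"
    proof (induction \<beta>s)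
      case (Cons \<beta> \<beta>s)
      thus ?case using szpos[of \<beta>] by auto
    qed auto
    ultimately show ?thesis using that(2) by (auto simp: L_def obj_lists_def)
  qed
  have L_sum: "sum_list (map (osize B) \<beta>s) = n" if "\<beta>s \<in> L" for \<beta>s
    using that by (auto simp: L_def obj_lists_def)
  have run: "spmf ?run \<beta>s = prod_list (map (pmf ?p) \<beta>s)" if "\<beta>s \<in> L" for \<beta>s
    using spmf_leap_run[where p = ?p and sz = "osize B", OF szpos', where xs = "[]" and zs = \<beta>s and n = n] L_sum[OF that] by simp
  have sumL: "(\<Sum>\<beta>s\<in>L. f \<beta>s) = (\<Sum>k\<le>n. \<Sum>\<beta>s\<in>obj_lists B k n. f \<beta>s)" for f :: "'b list \<Rightarrow> real"
    unfolding L_def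
    by (rule sum.UNION_disjoint) (auto simp: sum_obj_lists(1)[OF finite_B], auto simp: obj_lists_def)
  have hit: "(\<Sum>\<beta>s\<in>obj_lists B k n. prod_list (map (pmf ?p) \<beta>s)) = hit_prob \<rho> k n" for k
  proof -
    have "(\<Sum>\<beta>s\<in>obj_lists B k n. prod_list (map (pmf ?p) \<beta>s)) =
      (\<Sum>\<beta>s\<in>obj_lists B k n. prod_list (map (\<lambda>\<beta>. size_weight t (osize B \<beta>)) \<beta>s)) * (\<rho> ^ n / E ^ k)"
      unfolding sum_distrib_right E_def by (intro sum.cong refl prod_pmf_boltzmann[OF \<rho> pos])
    also have "\<dots> = hit_prob \<rho> k n"
      unfolding sum_obj_lists(2)[OF finite_B] gf_B_altdef[symmetric] by (simp add: hit_prob_def E_def)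
    finally show ?thesis .
  qed
  have "x = (\<integral>\<beta>s. spmf (if sum_list (map (osize B) \<beta>s) = n then ?G \<beta>s else leap_generator t A B \<rho> n) \<gamma> \<partial>measure_spmf ?run)"
    unfolding x_def by (subst leap_generator.simps) (rule spmf_bind)
  \<comment> \<open>A failed run contributes the constant x. Subtracting x on L and adding it
    everywhere leaves a finite sum plus a constant, whose integral is x because a run terminates
    almost surely.\<close>
  also have "\<dots> = (\<integral>\<beta>s. (if \<beta>s \<in> L then spmf (?G \<beta>s) \<gamma> - x else 0) + x \<partial>measure_spmf ?run)"
  proof (rule integral_cong_AE)
    show "AE \<beta>s in measure_spmf ?run.
      spmf (if sum_list (map (osize B) \<beta>s) = n then ?G \<beta>s else leap_generator t A B \<rho> n) \<gamma> =
      (if \<beta>s \<in> L then spmf (?G \<beta>s) \<gamma> - x else 0) + x"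
      unfolding AE_measure_spmf_iff
    proof
      fix \<beta>s assume \<beta>s: "\<beta>s \<in> set_spmf ?run"
      show "spmf (if sum_list (map (osize B) \<beta>s) = n then ?G \<beta>s else leap_generator t A B \<rho> n) \<gamma> =
        (if \<beta>s \<in> L then spmf (?G \<beta>s) \<gamma> - x else 0) + x"
      proof (cases "sum_list (map (osize B) \<beta>s) = n")
        case True
        with \<beta>s have "\<beta>s \<in> L" by (rule in_L)
        thus ?thesis using True by simp
      next
        case False
        hence "\<beta>s \<notin> L" using L_sum by blast
        thus ?thesis using False by (simp add: x_def)
      qed
    qed
  qed simp_all
  also have "\<dots> = (\<integral>\<beta>s. (if \<beta>s \<in> L then spmf (?G \<beta>s) \<gamma> - x else 0) \<partial>measure_spmf ?run) + (\<integral>\<beta>s. x \<partial>measure_spmf ?run)"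
  proof (rule Bochner_Integration.integral_add)
    have "\<bar>spmf (?G \<beta>s) \<gamma> - x\<bar> \<le> 1" for \<beta>s
      using pmf_le_1[of "?G \<beta>s" "Some \<gamma>"] pmf_nonneg[of "?G \<beta>s" "Some \<gamma>"]
        pmf_le_1[of "leap_generator t A B \<rho> n" "Some \<gamma>"] pmf_nonneg[of "leap_generator t A B \<rho> n" "Some \<gamma>"]
      unfolding x_def by linarith
    thus "integrable (measure_spmf ?run) (\<lambda>\<beta>s. if \<beta>s \<in> L then spmf (?G \<beta>s) \<gamma> - x else 0)"
      by (intro measure_spmf.integrable_const_bound[where B = "1"] AE_I2) simp_all
  qed simp
  also have "(\<integral>\<beta>s. x \<partial>measure_spmf ?run) = x"
    using lossless_leap_run[where p = ?p and sz = "osize B", OF szpos', where n = n and xs = "[]"] by (simp add: lossless_spmf_def weight_spmf_def)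
  also have "(\<integral>\<beta>s. (if \<beta>s \<in> L then spmf (?G \<beta>s) \<gamma> - x else 0) \<partial>measure_spmf ?run) =
     (\<Sum>\<beta>s\<in>L. spmf ?run \<beta>s * (spmf (?G \<beta>s) \<gamma> - x))"
    by (subst integral_measure_spmf_finite[OF finL]) (auto split: if_splits)
  also have "\<dots> = (\<Sum>\<beta>s\<in>L. spmf ?run \<beta>s * spmf (?G \<beta>s) \<gamma>) - x * (\<Sum>\<beta>s\<in>L. spmf ?run \<beta>s)"
    by (simp add: right_diff_distrib sum_subtractf sum_distrib_left mult.commute)
  also have "(\<Sum>\<beta>s\<in>L. spmf ?run \<beta>s) = (\<Sum>k\<le>n. hit_prob \<rho> k n)"
    by (subst sumL[symmetric, of "\<lambda>\<beta>s. prod_list (map (pmf ?p) \<beta>s)", unfolded hit]) (intro sum.cong refl run)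
  finally have eq: "x * (\<Sum>k\<le>n. hit_prob \<rho> k n) = (\<Sum>\<beta>s\<in>L. spmf ?run \<beta>s * spmf (?G \<beta>s) \<gamma>)" by simp
  have kn: "k \<le> n"
  proof (rule ccontr)
    assume "\<not> k \<le> n"
    thus False using \<gamma> C_core_eq_empty[of n k] by simp
  qed
  have card_pos: "real (card (objs_of_size A k)) > 0" using Ak by (cases "card (objs_of_size A k)") (auto simp: gf_def)
  have G: "spmf (?G \<beta>s) \<gamma> = (\<Sum>\<alpha>\<in>objs_of_size A k. pmf (substitute t A B n \<alpha> \<beta>s) \<gamma>) / card (objs_of_size A k)"
    if "\<beta>s \<in> obj_lists B k n" for \<beta>s
  proof -
    have len: "length \<beta>s = k" using that by (simp add: obj_lists_def)
    have "objs_of_size A k \<noteq> {}" using card_pos by auto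
    hence "spmf (?G \<beta>s) \<gamma> = (\<integral>\<alpha>. pmf (substitute t A B n \<alpha> \<beta>s) \<gamma> \<partial>measure_pmf (pmf_of_set (objs_of_size A k)))"
      using finite_A by (simp add: len spmf_of_pmf_pmf_of_set[symmetric] pmf_bind del: spmf_of_pmf_pmf_of_set)
    also have "\<dots> = (\<Sum>\<alpha>\<in>objs_of_size A k. pmf (substitute t A B n \<alpha> \<beta>s) \<gamma>) / card (objs_of_size A k)"
      using finite_A \<open>objs_of_size A k \<noteq> {}\<close> by (intro integral_pmf_of_set)
    finally show ?thesis .
  qed
  \<comment> \<open>The core-size of the output is the length of the run, so only runs of length k
    can produce \<gamma>.\<close>
  have G0: "spmf (?G \<beta>s) \<gamma> = 0" if "\<beta>s \<in> obj_lists B j n" "j \<noteq> k" for \<beta>s j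
  proof (rule ccontr)
    assume "spmf (?G \<beta>s) \<gamma> \<noteq> 0"
    hence "\<gamma> \<in> set_spmf (?G \<beta>s)" by (simp add: spmf_eq_0_set_spmf)
    moreover have "length \<beta>s = j" using that(1) by (simp add: obj_lists_def)
    ultimately obtain \<alpha> where "\<alpha> \<in> objs_of_size A j" "\<gamma> \<in> set_pmf (substitute t A B n \<alpha> \<beta>s)"
      using finite_A by (auto simp: set_bind_spmf set_spmf_of_set)
    hence "\<gamma> \<in> C_core n j" using set_substitute that(1) by blast
    thus False using \<gamma> that(2) by (simp add: C_core_def)
  qed
  have "(\<Sum>\<beta>s\<in>L. spmf ?run \<beta>s * spmf (?G \<beta>s) \<gamma>) = (\<Sum>\<beta>s\<in>L. prod_list (map (pmf ?p) \<beta>s) * spmf (?G \<beta>s) \<gamma>)"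
    by (intro sum.cong refl) (simp only: run)
  also have "\<dots> = (\<Sum>j\<le>n. \<Sum>\<beta>s\<in>obj_lists B j n. prod_list (map (pmf ?p) \<beta>s) * spmf (?G \<beta>s) \<gamma>)"
    by (rule sumL)
  also have "\<dots> = (\<Sum>j\<in>{k}. \<Sum>\<beta>s\<in>obj_lists B j n. prod_list (map (pmf ?p) \<beta>s) * spmf (?G \<beta>s) \<gamma>)"
    using kn G0 by (intro sum.mono_neutral_right) (auto intro!: sum.neutral)
  also have "\<dots> = (\<Sum>\<beta>s\<in>obj_lists B k n. \<Sum>\<alpha>\<in>objs_of_size A k.
       prod_list (map (\<lambda>\<beta>. size_weight t (osize B \<beta>)) \<beta>s) * pmf (substitute t A B n \<alpha> \<beta>s) \<gamma>) *
       (\<rho> ^ n / E ^ k / card (objs_of_size A k))"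
    unfolding sum_distrib_right
    by (simp add: G prod_pmf_boltzmann[OF \<rho> pos] E_def sum_distrib_left sum_divide_distrib mult_ac)
  also have "\<dots> = size_weight t n / size_weight t k * (\<rho> ^ n / E ^ k / card (objs_of_size A k))"
    by (simp only: sum_weight_substitute[OF \<gamma>])
  also have "\<dots> = \<rho> ^ n * size_weight t n / (E ^ k * fps_nth (gf t A) k)"
    by (simp add: gf_def mult_ac)
  finally have "x * (\<Sum>k\<le>n. hit_prob \<rho> k n) = \<rho> ^ n * size_weight t n / (E ^ k * fps_nth (gf t A) k)"
    by (simp only: eq)
  hence "x = \<rho> ^ n * size_weight t n / (E ^ k * fps_nth (gf t A) k) / (\<Sum>k\<le>n. hit_prob \<rho> k n)"
    using u by (metis less_irrefl nonzero_mult_div_cancel_right)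
  thus ?thesis by (simp only: x_def E_def)
qed

end

section \<open>Total variation distance\<close>

lemma fps_power_nth_nonneg:
  fixes F :: "real fps"
  assumes "\<And>n. fps_nth F n \<ge> 0"
  shows "fps_nth (F ^ k) n \<ge> 0"
  by (induction k arbitrary: n) (auto simp: fps_mult_nth intro!: sum_nonneg mult_nonneg_nonneg assms)

lemma ereal_conv_rad:
  assumes "0 < fps_conv_radius F" "fps_conv_radius F < \<infinity>"
  shows "ereal (conv_rad F) = fps_conv_radius F" "conv_rad F > 0"
  using assms by (cases "fps_conv_radius F"; simp add: conv_rad_def)+

lemma fps_conv_radius_geI_summable:
  fixes F :: "real fps"
  assumes "summable (\<lambda>n. fps_nth F n * x ^ n)" "x \<ge> 0"
  shows "fps_conv_radius F \<ge> ereal x"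
  using conv_radius_geI[OF assms(1)] assms(2) by (simp add: fps_conv_radius_def)

text \<open>If B(\<rho>) were below the radius of A, C would converge at some point beyond \<rho>;
  if it were above, A would converge at a value B(x), with x < \<rho>, beyond its radius. Continuity
  of B at \<rho>, which lies inside its disc of convergence, supplies the point x in both
  cases.\<close>

lemma supercritical_eval_fps:
  fixes FA FB FC :: "real fps"
  assumes nonneg: "\<And>n. fps_nth FA n \<ge> 0" "\<And>n. fps_nth FB n \<ge> 0" and FB0: "fps_nth FB 0 = 0"
    and FC: "\<And>n. fps_nth FC n = (\<Sum>k\<le>n. fps_nth FA k * fps_nth (FB ^ k) n)"
    and RA: "0 < fps_conv_radius FA" "fps_conv_radius FA < \<infinity>"
    and RC: "0 < fps_conv_radius FC" "fps_conv_radius FC < \<infinity>"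
    and super: "fps_conv_radius FB > fps_conv_radius FC"
  shows "eval_fps FB (conv_rad FC) = conv_rad FA"
proof -
  define \<rho> where "\<rho> = conv_rad FC"
  have \<rho>: "ereal \<rho> = fps_conv_radius FC" "\<rho> > 0" unfolding \<rho>_def by (rule ereal_conv_rad[OF RC])+
  note \<alpha> = ereal_conv_rad[OF RA]
  let ?g = "eval_fps FB"
  note Bk = fps_power_nth_nonneg[of FB, OF nonneg(2)]
  have Bk0: "fps_nth (FB ^ k) n = 0" if "n < k" for k n
    using startsby_zero_power_prefix[OF FB0, of k] that by simp
  have FCn: "fps_nth FC n \<ge> 0" for n
    unfolding FC by (intro sum_nonneg mult_nonneg_nonneg nonneg Bk)
  have sumsB: "(\<lambda>n. fps_nth (FB ^ k) n * x ^ n) sums (?g x ^ k)" if "0 \<le> x" "ereal x < fps_conv_radius FB" for x k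
  proof -
    have "(\<lambda>n. fps_nth (FB ^ k) n * x ^ n) sums eval_fps (FB ^ k) x"
      using that fps_conv_radius_power[of FB k] by (intro sums_eval_fps) auto
    thus ?thesis using that by (subst (asm) eval_fps_power) auto
  qed
  have g_nonneg: "?g x \<ge> 0" if "0 \<le> x" "ereal x < fps_conv_radius FB" for x
    using sumsB[OF that, of 1] nonneg(2) that by (intro sums_le[OF _ sums_zero, of _ "?g x"]) auto
  have "ereal \<rho> < fps_conv_radius FB" using super \<rho>(1) by simp
  from ereal_dense2[OF this] obtain r where r: "\<rho> < r" "ereal r < fps_conv_radius FB" by auto
  have "\<rho> \<in> eball 0 (fps_conv_radius FB)" using super \<rho> by simp
  hence cont: "isCont ?g \<rho>"
    using continuous_on_eval_fps[of FB] continuous_on_eq_continuous_at[OF open_eball] by blast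
  have "\<not> ?g \<rho> < conv_rad FA"
  proof
    assume less: "?g \<rho> < conv_rad FA"
    have "(?g \<longlongrightarrow> ?g \<rho>) (at_right \<rho>)" using cont by (simp add: isCont_def filterlim_at_split)
    from order_tendstoD(2)[OF this less] have "eventually (\<lambda>x. ?g x < conv_rad FA \<and> x \<in> {\<rho><..<r}) (at_right \<rho>)"
      using eventually_at_right_real[OF r(1)] by (rule eventually_conj)
    then obtain x where x: "?g x < conv_rad FA" "\<rho> < x" "x < r"
      using eventually_happens'[OF trivial_limit_at_right_real] by force
    have xB: "0 \<le> x" "ereal x < fps_conv_radius FB"
      using x \<rho>(2) less_trans[of "ereal x" "ereal r"] r(2) by auto
    have sumA: "summable (\<lambda>k. fps_nth FA k * ?g x ^ k)"
      using x(1) g_nonneg[OF xB] by (intro summable_fps) (simp add: \<alpha>(1)[symmetric])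
    have "summable (\<lambda>n. fps_nth FC n * x ^ n)"
    proof (rule summableI_nonneg_bounded)
      fix N
      \<comment> \<open>For n < N only k < N occur, so by nonnegativity the double sum may be
        enlarged to a square and exchanged as a finite sum.\<close>
      have "(\<Sum>n<N. fps_nth FC n * x ^ n) \<le> (\<Sum>n<N. (\<Sum>k<N. fps_nth FA k * fps_nth (FB ^ k) n) * x ^ n)"
        unfolding FC using xB
        by (intro sum_mono mult_right_mono sum_mono2) (auto intro!: mult_nonneg_nonneg nonneg Bk)
      also have "\<dots> = (\<Sum>k<N. fps_nth FA k * (\<Sum>n<N. fps_nth (FB ^ k) n * x ^ n))"
        unfolding sum_distrib_right sum_distrib_left by (subst sum.swap) (simp only: mult.assoc)
      also have "\<dots> \<le> (\<Sum>k<N. fps_nth FA k * ?g x ^ k)"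
      proof (intro sum_mono mult_left_mono nonneg)
        fix k
        have "(\<Sum>n<N. fps_nth (FB ^ k) n * x ^ n) \<le> (\<Sum>n. fps_nth (FB ^ k) n * x ^ n)"
          using sumsB[OF xB, of k] xB Bk by (intro sum_le_suminf) (auto simp: sums_iff)
        thus "(\<Sum>n<N. fps_nth (FB ^ k) n * x ^ n) \<le> ?g x ^ k"
          using sumsB[OF xB, of k] by (simp add: sums_iff)
      qed
      also have "\<dots> \<le> (\<Sum>k. fps_nth FA k * ?g x ^ k)"
        using sumA g_nonneg[OF xB] nonneg by (intro sum_le_suminf) auto
      finally show "(\<Sum>n<N. fps_nth FC n * x ^ n) \<le> (\<Sum>k. fps_nth FA k * ?g x ^ k)" .
    qed (use FCn xB in auto)
    from fps_conv_radius_geI_summable[OF this xB(1)] show False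
      using x(2) by (simp add: \<rho>(1)[symmetric])
  qed
  moreover have "\<not> ?g \<rho> > conv_rad FA"
  proof
    assume less: "?g \<rho> > conv_rad FA"
    have "(?g \<longlongrightarrow> ?g \<rho>) (at_left \<rho>)" using cont by (simp add: isCont_def filterlim_at_split)
    from order_tendstoD(1)[OF this less] have "eventually (\<lambda>x. ?g x > conv_rad FA \<and> x \<in> {0<..<\<rho>}) (at_left \<rho>)"
      using eventually_at_left_real[OF \<rho>(2)] by (rule eventually_conj)
    then obtain x where x: "?g x > conv_rad FA" "0 < x" "x < \<rho>"
      using eventually_happens'[OF trivial_limit_at_left_real] by force
    have xC: "ereal x < fps_conv_radius FC" using x by (simp add: \<rho>(1)[symmetric])
    have xB: "0 \<le> x" "ereal x < fps_conv_radius FB" using x(2) xC super by auto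
    have sumC: "summable (\<lambda>n. fps_nth FC n * x ^ n)"
      using xC x(2) by (intro summable_fps) auto
    have "summable (\<lambda>k. fps_nth FA k * ?g x ^ k)"
    proof (rule summableI_nonneg_bounded)
      fix K
      have "(\<lambda>n. \<Sum>k<K. fps_nth FA k * (fps_nth (FB ^ k) n * x ^ n)) sums (\<Sum>k<K. fps_nth FA k * ?g x ^ k)"
        by (intro sums_sum sums_mult sumsB xB)
      moreover have "(\<lambda>n. fps_nth FC n * x ^ n) sums (\<Sum>n. fps_nth FC n * x ^ n)"
        using sumC by (rule summable_sums)
      ultimately show "(\<Sum>k<K. fps_nth FA k * ?g x ^ k) \<le> (\<Sum>n. fps_nth FC n * x ^ n)"
      proof (rule sums_le[rotated])
        fix n
        have "(\<Sum>k<K. fps_nth FA k * fps_nth (FB ^ k) n) = (\<Sum>k\<in>{..<K} \<inter> {..n}. fps_nth FA k * fps_nth (FB ^ k) n)"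
          by (intro sum.mono_neutral_right) (auto intro!: leI dest: Bk0)
        also have "\<dots> \<le> fps_nth FC n"
          unfolding FC by (intro sum_mono2) (auto intro!: mult_nonneg_nonneg nonneg Bk)
        finally have "(\<Sum>k<K. fps_nth FA k * fps_nth (FB ^ k) n) * x ^ n \<le> fps_nth FC n * x ^ n"
          using xB by (intro mult_right_mono) auto
        thus "(\<Sum>k<K. fps_nth FA k * (fps_nth (FB ^ k) n * x ^ n)) \<le> fps_nth FC n * x ^ n"
          by (simp add: sum_distrib_right mult.assoc)
      qed
    qed (use nonneg g_nonneg[OF xB] in auto)
    from fps_conv_radius_geI_summable[OF this g_nonneg[OF xB]] show False
      using x(1) by (simp add: \<alpha>(1)[symmetric])
  qed
  ultimately show ?thesis by (simp add: \<rho>_def)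
qed

lemma fps_nth_power_scaled:
  fixes F :: "real fps"
  shows "fps_nth (Abs_fps (\<lambda>n. fps_nth F n * x ^ n / c) ^ k) n = fps_nth (F ^ k) n * x ^ n / c ^ k"
proof (induction k arbitrary: n)
  case (Suc k)
  have "fps_nth (Abs_fps (\<lambda>n. fps_nth F n * x ^ n / c) ^ Suc k) n =
    (\<Sum>j=0..n. fps_nth F j * x ^ j / c * (fps_nth (F ^ k) (n - j) * x ^ (n - j) / c ^ k))"
    by (simp add: fps_mult_nth Suc)
  also have "\<dots> = (\<Sum>j=0..n. fps_nth F j * fps_nth (F ^ k) (n - j) * (x ^ n / c ^ Suc k))"
  proof (intro sum.cong refl)
    fix j assume "j \<in> {0..n}"
    hence "x ^ n = x ^ j * x ^ (n - j)" by (simp flip: power_add)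
    thus "fps_nth F j * x ^ j / c * (fps_nth (F ^ k) (n - j) * x ^ (n - j) / c ^ k) =
      fps_nth F j * fps_nth (F ^ k) (n - j) * (x ^ n / c ^ Suc k)" by simp
  qed
  also have "\<dots> = fps_nth (F ^ Suc k) n * x ^ n / c ^ Suc k"
    by (simp add: fps_mult_nth sum_distrib_right sum_divide_distrib)
  finally show ?case .
qed auto

section \<open>Reduction to the two laws of the core-size\<close>

context composition_scheme
begin

text \<open>Both distributions are constant on each \<open>C_core n k\<close>, so absolute
  differences add up without cancellation inside a core-size and the distance equals that between
  the core-size laws.\<close>

lemma tv_dist_leap_generator:
  assumes \<rho>: "0 < \<rho>" "ereal \<rho> < fps_conv_radius (gf t B)" and pos: "eval_fps (gf t B) \<rho> > 0"
    and Ak: "{1..} \<subseteq> fps_support (gf t A)" and n: "n > 0"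
    and u: "(\<Sum>k\<le>n. hit_prob \<rho> k n) > 0"
  defines "w \<equiv> \<lambda>k. fps_nth (gf t A) k * eval_fps (gf t B) \<rho> ^ k"
  shows "tv_dist (objs_of_size C n) (spmf_of_set (objs_of_size C n)) (leap_generator t A B \<rho> n) =
    (\<Sum>k\<le>n. \<bar>w k * hit_prob \<rho> k n / (\<Sum>k\<le>n. w k * hit_prob \<rho> k n) - hit_prob \<rho> k n / (\<Sum>k\<le>n. hit_prob \<rho> k n)\<bar>) / 2"
proof -
  define U where "U = (\<Sum>k\<le>n. hit_prob \<rho> k n)"
  define E where "E = eval_fps (gf t B) \<rho>"
  define N where "N = real (card (objs_of_size C n))"
  define m where "m = size_weight t n * \<rho> ^ n"
  have m: "m > 0" using \<rho> by (simp add: m_def)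
  have wq: "w k * hit_prob \<rho> k n = real (card (C_core n k)) * m" for k
  proof -
    have "w k * hit_prob \<rho> k n = fps_nth (gf t A) k * fps_nth (gf t B ^ k) n * \<rho> ^ n"
      using pos by (simp add: w_def hit_prob_def)
    thus ?thesis unfolding card_C_core[symmetric] m_def by (simp add: mult_ac)
  qed
  have "(\<Sum>k\<le>n. w k * hit_prob \<rho> k n) = (\<Sum>k\<le>n. real (card (C_core n k))) * m"
    by (simp add: wq sum_distrib_right)
  also have "(\<Sum>k\<le>n. real (card (C_core n k))) = N"
    using sum_objs_of_size_C[of "\<lambda>_. 1::real" n] by (simp add: N_def)
  finally have W: "(\<Sum>k\<le>n. w k * hit_prob \<rho> k n) = N * m" .
  have core: "(\<Sum>\<gamma>\<in>C_core n k. \<bar>spmf (spmf_of_set (objs_of_size C n)) \<gamma> - spmf (leap_generator t A B \<rho> n) \<gamma>\<bar>) =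
     \<bar>w k * hit_prob \<rho> k n / (\<Sum>k\<le>n. w k * hit_prob \<rho> k n) - hit_prob \<rho> k n / U\<bar>" for k
  proof (cases "k = 0")
    case True
    have "hit_prob \<rho> 0 n = 0" using n by (simp add: hit_prob_def)
    moreover from this have "C_core n 0 = {}" using wq[of 0] m finite_C_core[of n 0] by simp
    ultimately show ?thesis using True by simp
  next
    case False
    hence "k \<in> fps_support (gf t A)" using Ak by (intro subsetD[OF Ak]) simp
    hence a: "fps_nth (gf t A) k \<noteq> 0" by (simp add: fps_support_def)
    have "spmf (spmf_of_set (objs_of_size C n)) \<gamma> = 1 / N" if "\<gamma> \<in> C_core n k" for \<gamma>
      using that by (simp add: spmf_of_set N_def C_core_def)
    moreover have "spmf (leap_generator t A B \<rho> n) \<gamma> = m / w k / U" if "\<gamma> \<in> C_core n k" for \<gamma>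
      using spmf_leap_generator[OF \<rho> pos that _ a u] False by (simp add: m_def w_def U_def mult_ac)
    ultimately have "(\<Sum>\<gamma>\<in>C_core n k. \<bar>spmf (spmf_of_set (objs_of_size C n)) \<gamma> - spmf (leap_generator t A B \<rho> n) \<gamma>\<bar>) =
      real (card (C_core n k)) * \<bar>1 / N - m / w k / U\<bar>" by simp
    also have "\<dots> = \<bar>real (card (C_core n k)) / N - real (card (C_core n k)) * m / w k / U\<bar>"
      by (subst abs_of_nat[symmetric], subst abs_mult[symmetric]) (simp add: right_diff_distrib)
    also have "real (card (C_core n k)) / N = w k * hit_prob \<rho> k n / (\<Sum>k\<le>n. w k * hit_prob \<rho> k n)"
      unfolding W unfolding wq using m by simp
    also have "real (card (C_core n k)) * m / w k / U = hit_prob \<rho> k n / U"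
      using a pos by (simp add: wq[symmetric] w_def)
    finally show ?thesis .
  qed
  show ?thesis
    unfolding tv_dist_def sum_objs_of_size_C core U_def ..
qed

end

theorem proposition6:
  fixes t :: setting and A :: "'a lclass" and B :: "'b lclass"
    and C :: "('a, 'b) composite cclass"
    and s \<rho> \<mu> \<sigma> :: real and d :: "nat \<Rightarrow> real"
  assumes "admissible_scheme t A B"
    and "has_singular_exponent (gf t A) s"
    and "C = composition t A B"
    and "\<rho> = conv_rad (gf t C)"
    and "\<mu> = measure_pmf.expectation (boltzmann t B \<rho>) (\<lambda>\<beta>. real (osize B \<beta>))"
    and "\<sigma> = sqrt (measure_pmf.variance (boltzmann t B \<rho>) (\<lambda>\<beta>. real (osize B \<beta>)))"
    and "\<And>n. d n = tv_dist (objs_of_size C n)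
                 (spmf_of_set (objs_of_size C n)) (leap_generator t A B \<rho> n)"
  shows "(\<lambda>n. d n - \<bar>s - 1\<bar> * \<sigma> / sqrt (2 * pi * \<mu>) * (1 / sqrt (real n)))
             \<in> o(\<lambda>n. 1 / sqrt (real n)) \<and>
         (s \<noteq> 1 \<longrightarrow>
           d \<sim>[at_top] (\<lambda>n. \<bar>s - 1\<bar> * \<sigma> / sqrt (2 * pi * \<mu>) * (1 / sqrt (real n))))"
proof -
  let ?FA = "gf t A" and ?FB = "gf t B" and ?FC = "gf t C"
  have adm: "comb_class t A" "comb_class t B" "objs_of_size B 0 = {}"
    "0 < fps_conv_radius ?FA" "fps_conv_radius ?FA < \<infinity>"
    "0 < fps_conv_radius ?FC" "fps_conv_radius ?FC < \<infinity>"
    "fps_conv_radius ?FB > fps_conv_radius ?FC" "\<not> periodic ?FB" "{1..} \<subseteq> fps_support ?FA"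
    using assms(1) unfolding assms(3) by (simp_all add: admissible_scheme_def supercritical_def Let_def)
  interpret composition_scheme t A B by unfold_locales (fact adm)+
  have \<rho>: "ereal \<rho> = fps_conv_radius ?FC" "\<rho> > 0"
    unfolding assms(4) by (rule ereal_conv_rad[OF adm(6,7)])+
  define E where "E = eval_fps ?FB \<rho>"
  have E: "E = conv_rad ?FA" unfolding E_def assms(4)
  proof (rule supercritical_eval_fps)
    show "fps_nth ?FA n \<ge> 0" "fps_nth ?FB n \<ge> 0" for n by (auto simp: gf_def)
    show "fps_nth ?FC n = (\<Sum>k\<le>n. fps_nth ?FA k * fps_nth (?FB ^ k) n)" for n
      unfolding assms(3) by (rule gf_C)
  qed (use adm gf_B_0 in auto)
  have E_pos: "E > 0" unfolding E by (rule ereal_conv_rad[OF adm(4,5)])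
  have \<rho>B: "ereal \<rho> < fps_conv_radius ?FB" using adm(8) \<rho>(1) by simp
  define p where "p = map_pmf (osize B) (boltzmann t B \<rho>)"
  have pmf_p: "pmf p n = fps_nth ?FB n * \<rho> ^ n / E" for n
    unfolding p_def E_def using pmf_boltzmann_size[OF \<rho>(2) \<rho>B] E_pos E_def by simp
  \<comment> \<open>Supercriticality leaves room between \<rho> and the radius of B, which provides
    the exponential moments of the step law.\<close>
  obtain r where r: "\<rho> < r" "ereal r < fps_conv_radius ?FB"
    using ereal_dense2[OF \<rho>B] by auto
  define R where "R = r / \<rho>"
  have R1: "R > 1" using r \<rho>(2) by (simp add: R_def)
  have sumR: "summable (\<lambda>n. pmf p n * R ^ n)"
  proof -
    have "summable (\<lambda>n. fps_nth ?FB n * r ^ n)"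
      using r \<rho>(2) by (intro summable_fps) auto
    hence "summable (\<lambda>n. fps_nth ?FB n * r ^ n / E)" by (rule summable_divide)
    also have "(\<lambda>n. fps_nth ?FB n * r ^ n / E) = (\<lambda>n. pmf p n * R ^ n)"
      using \<rho>(2) by (simp add: pmf_p R_def power_divide)
    finally show ?thesis .
  qed
  have p_support: "pmf p n \<noteq> 0 \<longleftrightarrow> n \<in> fps_support ?FB" for n
    using \<rho>(2) E_pos by (simp add: pmf_p fps_support_def)
  \<comment> \<open>The offset c is used twice: c = 0 gives the aperiodicity of the renewal process,
    and c equal to a support point excludes a one-point support, hence zero variance.\<close>
  have not_ap: "\<exists>n. pmf p n \<noteq> 0 \<and> n \<notin> {c + d * k | k. True}" if "d \<ge> 2" for c d :: nat
    using adm(9) that unfolding periodic_def p_support by blast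
  have aper: "\<exists>n. pmf p n \<noteq> 0 \<and> \<not> d dvd n" if "d \<ge> 2" for d
    using not_ap[OF that, of 0] by (auto simp: dvd_def)
  have sum2: "summable (\<lambda>n. pmf p n * \<bar>(real n - c)\<^sup>2\<bar>)" for c
  proof -
    have "(\<lambda>n. (real n - c)\<^sup>2) \<in> O(\<lambda>n. R ^ n)" using R1 by real_asymp
    hence "(\<lambda>n. pmf p n * (real n - c)\<^sup>2) \<in> O(\<lambda>n. pmf p n * R ^ n)" by (rule landau_o.big.mult_left)
    hence "summable (\<lambda>n. pmf p n * (real n - c)\<^sup>2)"
      by (rule summable_comparison_test_bigo[rotated]) (use sumR R1 in \<open>simp add: abs_mult\<close>)
    thus ?thesis by simp
  qed
  have var: "measure_pmf.variance p real > 0"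
  proof -
    define c where "c = measure_pmf.expectation p real"
    have v: "measure_pmf.variance p real = (\<Sum>n. pmf p n * (real n - c)\<^sup>2)"
      unfolding c_def[symmetric] by (rule expectation_pmf_nat[OF sum2])
    have "(\<Sum>n. pmf p n * (real n - c)\<^sup>2) \<noteq> 0"
    proof
      assume "(\<Sum>n. pmf p n * (real n - c)\<^sup>2) = 0"
      moreover have "summable (\<lambda>n. pmf p n * (real n - c)\<^sup>2)" using sum2[of c] by simp
      ultimately have "pmf p n * (real n - c)\<^sup>2 = 0" for n
        by (subst (asm) suminf_eq_zero_iff) auto
      hence *: "real n = c" if "pmf p n \<noteq> 0" for n using that by fastforce
      obtain n0 where n0: "pmf p n0 \<noteq> 0" using not_ap[of 2 0] by auto
      obtain n1 where n1: "pmf p n1 \<noteq> 0" "n1 \<notin> {n0 + 2 * k | k. True}" using not_ap[of 2 n0] by auto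
      have "n1 = n0" using *[OF n0] *[OF n1(1)] by simp
      thus False using n1(2) by auto
    qed
    moreover have "(\<Sum>n. pmf p n * (real n - c)\<^sup>2) \<ge> 0" using sum2[of c] by (intro suminf_nonneg) auto
    ultimately show ?thesis unfolding v by simp
  qed
  interpret R: renewal_law p R
  proof
    show "pmf p 0 = 0" by (simp add: pmf_p gf_B_0)
  qed (use R1 sumR aper var in auto)
  have \<mu>: "\<mu> = R.\<mu>" unfolding assms(5) R.\<mu>_def unfolding p_def by simp
  have \<sigma>: "\<sigma> = R.\<sigma>" unfolding assms(6) R.\<sigma>_def unfolding p_def by simp
  have q: "R.q k n = hit_prob \<rho> k n" for k n
    unfolding R.q_def pmf_p hit_prob_def E_def[symmetric] by (rule fps_nth_power_scaled)
  \<comment> \<open>As E is the radius of A, this is the normalised coefficient sequence of the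
    singularity analysis as well as the density between the two laws, up to normalisation.\<close>
  define w where "w = (\<lambda>k. fps_nth ?FA k * E ^ k)"
  obtain D where D: "D \<noteq> 0" "(\<lambda>k. w k - D * real k powr (s - 1)) \<in> O(\<lambda>k. real k powr (s - 2))"
    using singular_exponent_coeff_asymptotics[OF assms(2)] unfolding w_def E by blast
  define c where "c = \<bar>s - 1\<bar> * \<sigma> / sqrt (2 * pi * \<mu>)"
  have "(\<lambda>n. sqrt n * ((\<Sum>k\<le>n. \<bar>w k * R.q k n / (\<Sum>k\<le>n. w k * R.q k n) - R.q k n / R.u n\<bar>) / 2)) \<longlonglongrightarrow> c"
    unfolding c_def \<mu> \<sigma> by (rule R.weighted_law_tv_distance[OF D])
  moreover have "eventually (\<lambda>n. R.u n > 0) at_top"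
    using R.\<mu>_ge_1 by (intro order_tendstoD(1)[OF R.u_tendsto]) simp
  hence "eventually (\<lambda>n. sqrt n * ((\<Sum>k\<le>n. \<bar>w k * R.q k n / (\<Sum>k\<le>n. w k * R.q k n) - R.q k n / R.u n\<bar>) / 2) = sqrt n * d n) at_top"
    using eventually_gt_at_top[of 0]
  proof eventually_elim
    case (elim n)
    have "R.u n = (\<Sum>k\<le>n. hit_prob \<rho> k n)" by (simp add: R.u_def q)
    thus ?case
      using tv_dist_leap_generator[OF \<rho>(2) \<rho>B _ adm(10) elim(2)] elim(1) E_pos
      by (simp add: assms(3,7) q w_def E_def)
  qed
  ultimately have lim: "(\<lambda>n. sqrt n * d n) \<longlonglongrightarrow> c" by (rule Lim_transform_eventually)
  have "(\<lambda>n. d n - c * (1 / sqrt n)) \<in> o(\<lambda>n. 1 / sqrt (real n))"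
  proof (rule smalloI_tendsto)
    have "(\<lambda>n. sqrt n * d n - c) \<longlonglongrightarrow> 0" using tendsto_diff[OF lim tendsto_const[of c]] by simp
    moreover have "eventually (\<lambda>n. sqrt n * d n - c = (d n - c * (1 / sqrt n)) / (1 / sqrt (real n))) at_top"
      using eventually_gt_at_top[of 0] by eventually_elim (simp add: field_simps)
    ultimately show "((\<lambda>n. (d n - c * (1 / sqrt n)) / (1 / sqrt (real n))) \<longlongrightarrow> 0) at_top"
      by (rule Lim_transform_eventually)
    show "eventually (\<lambda>n. 1 / sqrt (real n) \<noteq> 0) at_top"
      using eventually_gt_at_top[of 0] by eventually_elim simp
  qed
  moreover have "d \<sim>[at_top] (\<lambda>n. c * (1 / sqrt n))" if "s \<noteq> 1"
  proof (rule asymp_equivI')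
    have c: "c \<noteq> 0" using that R.\<sigma>_pos R.\<mu>_ge_1 by (simp add: c_def \<sigma> \<mu>)
    have "(\<lambda>n. sqrt n * d n / c) \<longlonglongrightarrow> c / c" by (intro tendsto_divide lim tendsto_const c)
    moreover have "(\<lambda>n. sqrt n * d n / c) = (\<lambda>n. d n / (c * (1 / sqrt n)))" by (simp add: mult.commute)
    ultimately show "(\<lambda>n. d n / (c * (1 / sqrt n))) \<longlonglongrightarrow> 1" using c by simp
  qed
  ultimately show ?thesis unfolding c_def by blast
qed

end
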